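(* For $(c_1,c_2)$ and $c<0$ as below, let $V(c_1,c_2;c)$ denote the Hilbert tensor product of $N(c_1,c_2)$ and $N(c,0)$ (described in the context). Then: (1) Let $a,b<0$. The discrete spectrum of $V(0,a;b)=N(0,a)\otimes N(b,0)$ is $N(b,a)$ if $-1<a+b<0$; is $\bigoplus_{n\in\mathbb{Z},\,0\le 2n<a-b-1}N(b-a+2n,0)$ if $0<a-b-1$; and is $\bigoplus_{n\in\mathbb{Z},\,a-b+1<2n\le0}N(0,a-b-2n)$ if $a-b+1<0$. (2) Let $-1\le x<0$, $y\in\mathbb{R}\setminus\{0\}$ and $a<0$. The discrete spectrum of $N(-1-x+iy,x+iy)\otimes N(a,0)$ is $\bigoplus_{n\in\mathbb{Z},\,2n<2x-a}N(-1-2x+a+2n,0)$. (3) Let $-1<a_1,a_2<0$ and $a<0$. The discrete spectrum of $N(a_1,a_2)\otimes N(a,0)$ is $\left(\bigoplus_{n\in\mathbb{Z},\,2n<a_2-a_1-a-1}N(a+a_1-a_2+2n,0)\right)\oplus N(a+a_1,a_2)$ if $-1<a+a_1+a_2<0$; is $\left(\bigoplus_{n\in\mathbb{Z},\,2n<a_2-a_1-a-1}N(a+a_1-a_2+2n,0)\right)\oplus N(a_1,a_2-a)$ if $-2<a_1+a_2-a<-1$; and is $\bigoplus_{n\in\mathbb{Z},\,2n<a_2-a_1-a-1}N(a+a_1-a_2+2n,0)$ otherwise.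
   Context: $\mathfrak{sl}(2,\mathbb{C})$ has basis $H,E,F$ with $[H,E]=2E$, $[H,F]=-2F$, $[E,F]=H$. For $(c_1,c_2)\in\mathbb{C}^2$ let $\mathcal{K}(c_1,c_2)$ be the set of $k\in\mathbb{Z}$ such that for each $i$ with $c_i\in\mathbb{Z}$ one has ($c_i+(-1)^{i-1}k<0$ iff $c_i<0$). $N(c_1,c_2)$ has basis $\{x(k):k\in\mathcal{K}(c_1,c_2)\}$ ($x(k):=0$ otherwise), $H x(k)=(c_1-c_2+2k)x(k)$, and: (I) neither $c_i$ a negative integer: $E x(k)=(c_2-k)x(k+1)$, $F x(k)=(c_1+k)x(k-1)$; (II) only $c_2$ a negative integer: $E x(k)=x(k+1)$, $F x(k)=(c_1+k)(c_2-k+1)x(k-1)$; (III) only $c_1$ a negative integer: $E x(k)=(c_1+k+1)(c_2-k)x(k+1)$, $F x(k)=x(k-1)$; (IV) both: $E x(k)=(c_1+k+1)x(k+1)$, $F x(k)=(c_2-k+1)x(k-1)$. Hilbert structures, for the first factor $N(c_1,c_2)$ (with $c_1=0,c_2<0$, or $c_1=-1-x+iy,c_2=x+iy$, or $-1<c_1,c_2<0$): the $x(k)$ are orthogonal, $\|x(0)\|=1$, and for $k>0$: if $c_2$ is not a negative integer, $\|x(k)\|^2=\prod_{j=1}^k\frac{j+c_1}{j-1-\bar c_2}$ and (when $c_1\neq0$) $\|x(-k)\|^2=\prod_{j=1}^k\frac{j+\bar c_2}{j-1-c_1}$; if $c_1=0$ and $c_2\in\mathbb{Z}_{<0}$, $\|x(k)\|^2=k!\prod_{j=1}^k(j-1-c_2)$.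 On $N(c,0)$ ($c<0$) put $y(l)=x(-l)$, $l\in\mathbb{Z}_{\ge0}$, orthogonal with $\|y(0)\|=1$ and $\|y(l)\|^2=l!/\prod_{j=1}^l(j-1-c)$ if $c\notin\mathbb{Z}$, $\|y(l)\|^2=l!\prod_{j=1}^l(j-1-c)$ if $c\in\mathbb{Z}$. With $z(k,l)=x(k)\otimes y(l)$, the Hilbert tensor product is $\{\sum u_{k,l}z(k,l):\sum|u_{k,l}|^2\|x(k)\|^2\|y(l)\|^2<\infty\}$. $H,E,F$ act on formal sums $\sum u_{k,l}z(k,l)$ termwise via $X(v\otimes w)=Xv\otimes w+v\otimes Xw$. A module $M$ is a Hilbert submodule if there is an injective module homomorphism from $M$ into the module of such formal sums with image in the Hilbert tensor product. The discrete spectrum is the direct sum of the (isomorphism classes of) nontrivial simple unitarisable weight modules that are Hilbert submodules, these being: highest weight modules $N(\lambda,0)$, $\lambda<0$; lowest weight modules $N(0,\lambda)$, $\lambda<0$; principal series $N(-1-x'+iy',x'+iy')$; complementary series $N(b_1,b_2)$, $-1<b_1,b_2<0$. *)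

theory Defs
  imports "HOL-Analysis.Analysis"
begin

definition negint :: "complex \<Rightarrow> bool" where
  "negint c \<longleftrightarrow> c \<in> \<int> \<and> Re c < 0"

definition inK :: "complex \<Rightarrow> complex \<Rightarrow> int \<Rightarrow> bool" where
  "inK c1 c2 k \<longleftrightarrow>
     (c1 \<in> \<int> \<longrightarrow> (Re c1 + of_int k < 0 \<longleftrightarrow> Re c1 < 0)) \<and>
     (c2 \<in> \<int> \<longrightarrow> (Re c2 - of_int k < 0 \<longleftrightarrow> Re c2 < 0))"

definition Hcoef :: "complex \<Rightarrow> complex \<Rightarrow> int \<Rightarrow> complex" where
  "Hcoef c1 c2 k = c1 - c2 + 2 * of_int k"

text \<open>E x(k) = Ecoef c1 c2 k * x(k+1)\<close>
definition Ecoef :: "complex \<Rightarrow> complex \<Rightarrow> int \<Rightarrow> complex" where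
  "Ecoef c1 c2 k =
    (if \<not> negint c1 \<and> \<not> negint c2 then c2 - of_int k
     else if \<not> negint c1 \<and> negint c2 then 1
     else if negint c1 \<and> \<not> negint c2 then (c1 + of_int k + 1) * (c2 - of_int k)
     else c1 + of_int k + 1)"

text \<open>F x(k) = Fcoef c1 c2 k * x(k-1)\<close>
definition Fcoef :: "complex \<Rightarrow> complex \<Rightarrow> int \<Rightarrow> complex" where
  "Fcoef c1 c2 k =
    (if \<not> negint c1 \<and> \<not> negint c2 then c1 + of_int k
     else if \<not> negint c1 \<and> negint c2 then (c1 + of_int k) * (c2 - of_int k + 1)
     else if negint c1 \<and> \<not> negint c2 then 1
     else c2 - of_int k + 1)"

text \<open>Vectors are coefficient functions (coefficient of x(k)); the actions below
  are also used termwise on formal (infinite) sums.  x(k) = 0 for k outside K.\<close>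
definition actH :: "complex \<Rightarrow> complex \<Rightarrow> (int \<Rightarrow> complex) \<Rightarrow> (int \<Rightarrow> complex)" where
  "actH c1 c2 v = (\<lambda>k. if inK c1 c2 k then Hcoef c1 c2 k * v k else 0)"

definition actE :: "complex \<Rightarrow> complex \<Rightarrow> (int \<Rightarrow> complex) \<Rightarrow> (int \<Rightarrow> complex)" where
  "actE c1 c2 v = (\<lambda>k. if inK c1 c2 k \<and> inK c1 c2 (k - 1)
                        then Ecoef c1 c2 (k - 1) * v (k - 1) else 0)"

definition actF :: "complex \<Rightarrow> complex \<Rightarrow> (int \<Rightarrow> complex) \<Rightarrow> (int \<Rightarrow> complex)" where
  "actF c1 c2 v = (\<lambda>k. if inK c1 c2 k \<and> inK c1 c2 (k + 1)
                        then Fcoef c1 c2 (k + 1) * v (k + 1) else 0)"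

definition Nvec :: "complex \<Rightarrow> complex \<Rightarrow> (int \<Rightarrow> complex) set" where
  "Nvec c1 c2 = {v. finite {k. v k \<noteq> 0} \<and> (\<forall>k. v k \<noteq> 0 \<longrightarrow> inK c1 c2 k)}"

definition Niso :: "complex \<Rightarrow> complex \<Rightarrow> complex \<Rightarrow> complex \<Rightarrow> bool" where
  "Niso d1 d2 e1 e2 \<longleftrightarrow> (\<exists>T :: (int \<Rightarrow> complex) \<Rightarrow> (int \<Rightarrow> complex).
     bij_betw T (Nvec d1 d2) (Nvec e1 e2) \<and>
     (\<forall>v\<in>Nvec d1 d2. \<forall>w\<in>Nvec d1 d2. T (\<lambda>k. v k + w k) = (\<lambda>k. T v k + T w k)) \<and>
     (\<forall>v\<in>Nvec d1 d2. \<forall>a. T (\<lambda>k. a * v k) = (\<lambda>k. a * T v k)) \<and>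
     (\<forall>v\<in>Nvec d1 d2. T (actH d1 d2 v) = actH e1 e2 (T v) \<and>
                      T (actE d1 d2 v) = actE e1 e2 (T v) \<and>
                      T (actF d1 d2 v) = actF e1 e2 (T v)))"

definition isoclass :: "complex \<times> complex \<Rightarrow> (complex \<times> complex) set" where
  "isoclass d = {e. Niso (fst d) (snd d) (fst e) (snd e)}"

text \<open>Nontrivial simple unitarisable weight modules, as listed in the paper.\<close>
definition candidate :: "complex \<times> complex \<Rightarrow> bool" where
  "candidate d \<longleftrightarrow>
     (\<exists>lam::real. lam < 0 \<and> d = (complex_of_real lam, 0)) \<or>
     (\<exists>lam::real. lam < 0 \<and> d = (0, complex_of_real lam)) \<or>
     (\<exists>x y :: real. d = (- 1 - complex_of_real x + \<i> * complex_of_real y,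
                            complex_of_real x + \<i> * complex_of_real y)) \<or>
     (\<exists>b1 b2 :: real. -1 < b1 \<and> b1 < 0 \<and> -1 < b2 \<and> b2 < 0 \<and>
                      d = (complex_of_real b1, complex_of_real b2))"

text \<open>Formal sums: u k m is the coefficient of x(k) (x) x(m), where x(m) is the
  basis of N(c,0); in the paper's notation m = -l, i.e. x(k)(x)x(m) = z(k,-m).\<close>
definition FS :: "complex \<Rightarrow> complex \<Rightarrow> real \<Rightarrow> (int \<Rightarrow> int \<Rightarrow> complex) set" where
  "FS c1 c2 c = {u. \<forall>k m. u k m \<noteq> 0 \<longrightarrow> inK c1 c2 k \<and> inK (complex_of_real c) 0 m}"

definition tensor_op ::
  "((int \<Rightarrow> complex) \<Rightarrow> (int \<Rightarrow> complex)) \<Rightarrow> ((int \<Rightarrow> complex) \<Rightarrow> (int \<Rightarrow> complex))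
    \<Rightarrow> (int \<Rightarrow> int \<Rightarrow> complex) \<Rightarrow> (int \<Rightarrow> int \<Rightarrow> complex)" where
  "tensor_op X Y u = (\<lambda>k m. X (\<lambda>k'. u k' m) k + Y (u k) m)"

definition tH :: "complex \<Rightarrow> complex \<Rightarrow> real \<Rightarrow> (int \<Rightarrow> int \<Rightarrow> complex) \<Rightarrow> (int \<Rightarrow> int \<Rightarrow> complex)" where
  "tH c1 c2 c = tensor_op (actH c1 c2) (actH (complex_of_real c) 0)"
definition tE :: "complex \<Rightarrow> complex \<Rightarrow> real \<Rightarrow> (int \<Rightarrow> int \<Rightarrow> complex) \<Rightarrow> (int \<Rightarrow> int \<Rightarrow> complex)" where
  "tE c1 c2 c = tensor_op (actE c1 c2) (actE (complex_of_real c) 0)"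
definition tF :: "complex \<Rightarrow> complex \<Rightarrow> real \<Rightarrow> (int \<Rightarrow> int \<Rightarrow> complex) \<Rightarrow> (int \<Rightarrow> int \<Rightarrow> complex)" where
  "tF c1 c2 c = tensor_op (actF c1 c2) (actF (complex_of_real c) 0)"

text \<open>Squared norm of x(k) in the first factor.\<close>
definition w1 :: "complex \<Rightarrow> complex \<Rightarrow> int \<Rightarrow> real" where
  "w1 c1 c2 k =
    (if k = 0 then 1
     else if k > 0 then
       (if negint c2 then Re (fact (nat k) * (\<Prod>j\<in>{1..nat k}. of_nat j - 1 - c2))
        else Re (\<Prod>j\<in>{1..nat k}. (of_nat j + c1) / (of_nat j - 1 - cnj c2)))
     else Re (\<Prod>j\<in>{1..nat (- k)}. (of_nat j + cnj c2) / (of_nat j - 1 - c1)))"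

text \<open>Squared norm of x(m) = y(-m) in the second factor N(c,0).\<close>
definition w2 :: "real \<Rightarrow> int \<Rightarrow> real" where
  "w2 c m = (let l = nat (- m) in
     if c \<in> \<int> then fact l * (\<Prod>j\<in>{1..l}. real j - 1 - c)
     else fact l / (\<Prod>j\<in>{1..l}. real j - 1 - c))"

definition HT :: "complex \<Rightarrow> complex \<Rightarrow> real \<Rightarrow> (int \<Rightarrow> int \<Rightarrow> complex) set" where
  "HT c1 c2 c = {u \<in> FS c1 c2 c.
     (\<lambda>(k, m). (cmod (u k m))\<^sup>2 * w1 c1 c2 k * w2 c m) summable_on UNIV}"

definition hilbert_submodule :: "complex \<Rightarrow> complex \<Rightarrow> complex \<Rightarrow> complex \<Rightarrow> real \<Rightarrow> bool" where
  "hilbert_submodule d1 d2 c1 c2 c \<longleftrightarrow>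
    (\<exists>T :: (int \<Rightarrow> complex) \<Rightarrow> (int \<Rightarrow> int \<Rightarrow> complex).
       (\<forall>v\<in>Nvec d1 d2. T v \<in> HT c1 c2 c) \<and>
       inj_on T (Nvec d1 d2) \<and>
       (\<forall>v\<in>Nvec d1 d2. \<forall>w\<in>Nvec d1 d2. T (\<lambda>k. v k + w k) = (\<lambda>k m. T v k m + T w k m)) \<and>
       (\<forall>v\<in>Nvec d1 d2. \<forall>a. T (\<lambda>k. a * v k) = (\<lambda>k m. a * T v k m)) \<and>
       (\<forall>v\<in>Nvec d1 d2. T (actH d1 d2 v) = tH c1 c2 c (T v) \<and>
                        T (actE d1 d2 v) = tE c1 c2 c (T v) \<and>
                        T (actF d1 d2 v) = tF c1 c2 c (T v)))"

definition disc_spectrum :: "complex \<Rightarrow> complex \<Rightarrow> real \<Rightarrow> (complex \<times> complex) set set" where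
  "disc_spectrum c1 c2 c =
     {isoclass d | d. candidate d \<and> hilbert_submodule (fst d) (snd d) c1 c2 c}"

end

theory Submission
  imports Defs "HOL-Real_Asymp.Real_Asymp"
begin

text \<open>
  Rescaling the basis brings all cases into one normal form. There the vectors of a given weight \<open>\<mu>\<close> are
  sequences along a diagonal \<open>k - l = n\<close>, and the Casimir operator becomes the three-term recurrence of
  the continuous dual Hahn polynomials with parameters \<open>(\<mu> + 1) / 2\<close> and \<open>(\<plusminus>(c\<^sub>1 + c\<^sub>2 + 1) - c) / 2\<close>, the
  module \<open>N(d\<^sub>1, d\<^sub>2)\<close> having the eigenvalue \<open>S = ((d\<^sub>1 + d\<^sub>2 + 1) / 2)\<^sup>2\<close>. The recurrence starts at one end, so
  a weight vector of a submodule is determined up to a scalar and only its square summability is in question.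
  Highest weight vectors satisfy a two-term recurrence, and Gauss's test gives the bound \<open>-1\<close> on the weight;
  applying \<open>F\<close> only multiplies their coefficients by polynomials. For a doubly infinite submodule with
  \<open>S \<ge> 0\<close> a comparison with a quotient of Pochhammer symbols shows that the solution is not square summable,
  unless \<open>S\<close> is the square of a negative parameter \<open>(\<plusminus>(c\<^sub>1 + c\<^sub>2 + 1) - c) / 2\<close>, in which case the
  eigenvectors have product form. For \<open>S < 0\<close> the solutions oscillate with the critical amplitude \<open>l\<close> to the
  power \<open>-1/2\<close>. Lowest weight modules in \<open>N(0,a) \<otimes> N(b,0)\<close> follow from the symmetry exchanging \<open>E\<close> and \<open>F\<close>.
\<close>


section \<open>Gauss's test for ratio expansions\<close>

text \<open>A doubly infinite submodule has a nonzero vector on every diagonal, so \<open>n\<close>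
  may be taken as large as needed. This makes the parameter \<open>(\<mu> + 1) / 2\<close> positive,
  and only the other two, r and r', remain to be studied. In the principal series they are complex
  conjugates, so only their sum \<open>\<rho> = - c\<close> and product
  \<open>e = c\<^sup>2 / 4 - g\<close> are used, \<open>g\<close> being the square of
  \<open>(c1 + c2 + 1) / 2\<close>. As \<open>\<rho> > 0\<close>, one of them is negative exactly
  when \<open>e < 0\<close>. The polynomials are symmetric in the three parameters, so a
  renormalisation lets the negative one take the place of \<open>t\<close>; then the constant
  solution is square summable and all others have to be excluded. For \<open>S < 0\<close> the terms
  of the norm series are 1/l times an oscillating factor that may come close to 0, so they admit no
  useful termwise lower bound. A second fact is therefore used: the image of the vector under E is
  square summable too. It controls the differences of the solution, and a complex combination of
  value and difference does not oscillate in modulus.\<close>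

definition ratio_expansion :: "(nat \<Rightarrow> real) \<Rightarrow> real \<Rightarrow> bool" where
  "ratio_expansion r \<kappa> \<longleftrightarrow> (\<lambda>l. r l - 1 - \<kappa> / real l) \<in> O(\<lambda>l. 1 / (real l)\<^sup>2)"

lemma ratio_expansion_quadratic:
  "ratio_expansion (\<lambda>l. ((real l)\<^sup>2 + p * real l + q) / ((real l)\<^sup>2 + p' * real l + q')) (p - p')"
  unfolding ratio_expansion_def
  by real_asymp

lemma ratio_expansion_mult:
  assumes "ratio_expansion r \<kappa>" "ratio_expansion r' \<kappa>'"
  shows "ratio_expansion (\<lambda>l. r l * r' l) (\<kappa> + \<kappa>')"
proof -
  let ?d = "\<lambda>l. r l - 1 - \<kappa> / real l" and ?d' = "\<lambda>l. r' l - 1 - \<kappa>' / real l"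
  have d: "?d \<in> O(\<lambda>l. 1 / (real l)\<^sup>2)" "?d' \<in> O(\<lambda>l. 1 / (real l)\<^sup>2)"
    using assms unfolding ratio_expansion_def by auto
  have one: "(\<lambda>l. 1 + k / real l) \<in> O(\<lambda>l. 1)" for k by real_asymp
  have "(\<lambda>l::nat. 1 / (real l)\<^sup>2) \<in> O(\<lambda>l. 1)" by real_asymp
  then have d1: "?d \<in> O(\<lambda>l. 1)" using d(1) landau_o.big_trans by blast
  have "(\<lambda>l. (1 + \<kappa>' / real l) * ?d l) \<in> O(\<lambda>l. 1 * (1 / (real l)\<^sup>2))"
    "(\<lambda>l. (1 + \<kappa> / real l) * ?d' l) \<in> O(\<lambda>l. 1 * (1 / (real l)\<^sup>2))"
    "(\<lambda>l. ?d l * ?d' l) \<in> O(\<lambda>l. 1 * (1 / (real l)\<^sup>2))"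
    using landau_o.big.mult[OF one d(1)] landau_o.big.mult[OF one d(2)] landau_o.big.mult[OF d1 d(2)] by auto
  moreover have "(\<lambda>l. \<kappa> * \<kappa>' / (real l)\<^sup>2) \<in> O(\<lambda>l. 1 / (real l)\<^sup>2)" by real_asymp
  ultimately have "(\<lambda>l. (1 + \<kappa>' / real l) * ?d l + (1 + \<kappa> / real l) * ?d' l + ?d l * ?d' l
      + \<kappa> * \<kappa>' / (real l)\<^sup>2) \<in> O(\<lambda>l. 1 / (real l)\<^sup>2)"
    by (intro sum_in_bigo) simp_all
  moreover have "(\<lambda>l. (1 + \<kappa>' / real l) * ?d l + (1 + \<kappa> / real l) * ?d' l + ?d l * ?d' l
      + \<kappa> * \<kappa>' / (real l)\<^sup>2) = (\<lambda>l. r l * r' l - 1 - (\<kappa> + \<kappa>') / real l)"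
    by (rule ext) (simp add: algebra_simps power2_eq_square add_divide_distrib)
  ultimately show ?thesis unfolding ratio_expansion_def by simp
qed

text \<open>The borderline case of Gauss's test; the comparison series is essentially
  \<open>1 / (l - 1)\<close> times a factor increasing to 1.\<close>
lemma gauss_test_divergence:
  fixes T :: "nat \<Rightarrow> real"
  assumes r: "ratio_expansion r \<kappa>" and \<kappa>: "\<kappa> \<ge> -1"
    and nn: "\<And>l. T l \<ge> 0" and pos: "eventually (\<lambda>l. T l > 0) sequentially"
    and step: "\<And>l. T (Suc l) \<ge> r l * T l"
  shows "\<not> summable T"
proof -
  obtain K0 where K0: "K0 > 0" "eventually (\<lambda>l. norm (r l - 1 - \<kappa> / real l) \<le> K0 * norm (1 / (real l)\<^sup>2)) sequentially"
    using r unfolding ratio_expansion_def by (auto elim!: landau_o.bigE)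
  define K where "K = K0 + 1"
  have K: "K > 0" using K0 by (simp add: K_def)
  from K0(2) pos obtain L0 where L0: "\<And>l. l \<ge> L0 \<Longrightarrow> norm (r l - 1 - \<kappa> / real l) \<le> K0 * norm (1 / (real l)\<^sup>2)"
     "\<And>l. l \<ge> L0 \<Longrightarrow> T l > 0"
    unfolding eventually_sequentially by (metis nle_le order_trans)
  define L where "L = max (max L0 2) (nat \<lceil>4 * K\<rceil> + 2)"
  have L: "L \<ge> L0" "L \<ge> 2" "real L \<ge> 4 * K + 2" unfolding L_def by linarith+
  have rl: "r l \<ge> 1 - 1 / real l - K / (real l)\<^sup>2" if "l \<ge> L" for l
  proof -
    have "\<bar>r l - 1 - \<kappa> / real l\<bar> \<le> K0 / (real l)\<^sup>2" using L0(1)[of l] that L by simp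
    moreover have "\<kappa> / real l \<ge> -1 / real l" using \<kappa> by (intro divide_right_mono) auto
    moreover have "K0 / (real l)\<^sup>2 \<le> K / (real l)\<^sup>2" by (intro divide_right_mono) (auto simp: K_def)
    ultimately show ?thesis by linarith
  qed
  \<comment> \<open>One step of \<open>\<tau>\<close> may lose the relative amount
    \<open>K / (l * (l - 1))\<close>; \<open>\<psi>\<close> gains twice that amount, so
    \<open>\<tau> * \<psi>\<close> cannot decrease. The choice of \<open>L\<close> keeps
    \<open>\<psi>\<close> at least 1/2.\<close>
  define \<psi> where "\<psi> l = 1 - 2 * K / (real l - 1)" for l
  define \<tau> where "\<tau> l = (real l - 1) * T l" for l
  have \<psi>: "\<psi> l \<ge> 0" "\<psi> l \<le> 1" "\<psi> l \<ge> 1/2" if "l \<ge> L" for l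
  proof -
    have "real l - 1 \<ge> 4 * K" "real l - 1 > 0" using that L K by linarith+
    then have "2 * K / (real l - 1) \<le> 1/2" "2 * K / (real l - 1) \<ge> 0" using K by (auto simp: field_simps)
    then show "\<psi> l \<ge> 0" "\<psi> l \<le> 1" "\<psi> l \<ge> 1/2" unfolding \<psi>_def by linarith+
  qed
  have mono: "\<tau> l * \<psi> l \<le> \<tau> (Suc l) * \<psi> (Suc l)" if l: "l \<ge> L" for l
  proof -
    have l1: "real l \<ge> 2" using l L by linarith
    have T: "T l \<ge> 0" by (rule nn)
    have "(1 - 1 / real l - K / (real l)\<^sup>2) * T l \<le> T (Suc l)"
      using step[of l] mult_right_mono[OF rl[OF l] T] by linarith
    then have "real l * ((1 - 1 / real l - K / (real l)\<^sup>2) * T l) \<le> real l * T (Suc l)"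
      by (intro mult_left_mono) auto
    moreover have "real l * ((1 - 1 / real l - K / (real l)\<^sup>2) * T l) = \<tau> l * (1 - K / (real l * (real l - 1)))"
      using l1 by (simp add: \<tau>_def field_simps power2_eq_square)
    ultimately have a: "\<tau> l * (1 - K / (real l * (real l - 1))) \<le> \<tau> (Suc l)"
      by (simp add: \<tau>_def)
    have p: "\<psi> (Suc l) \<ge> 0" "\<psi> (Suc l) \<le> 1" using \<psi>[of "Suc l"] l by auto
    have q: "\<psi> l \<le> (1 - K / (real l * (real l - 1))) * \<psi> (Suc l)"
    proof -
      have "\<psi> (Suc l) - \<psi> l = 2 * (K / (real l * (real l - 1)))"
        using l1 by (simp add: \<psi>_def field_simps)
      moreover have "K / (real l * (real l - 1)) \<ge> 0" using K l1 by simp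
      then have "K / (real l * (real l - 1)) * \<psi> (Suc l) \<le> K / (real l * (real l - 1))"
        using p by (metis mult.right_neutral mult_left_mono)
      ultimately show ?thesis using \<open>K / (real l * (real l - 1)) \<ge> 0\<close> by (simp add: left_diff_distrib)
    qed
    have "\<tau> l \<ge> 0" using T l1 by (simp add: \<tau>_def)
    then have "\<tau> l * \<psi> l \<le> \<tau> l * (1 - K / (real l * (real l - 1))) * \<psi> (Suc l)"
      using q by (simp add: mult.assoc mult_left_mono)
    also have "\<dots> \<le> \<tau> (Suc l) * \<psi> (Suc l)" using a p by (intro mult_right_mono)
    finally show ?thesis .
  qed
  define c where "c = \<tau> L * \<psi> L"
  have c: "c > 0" using L0(2)[of L] L \<psi>(3)[of L] by (simp add: c_def \<tau>_def)
  have low: "c \<le> \<tau> l * \<psi> l" if "l \<ge> L" for l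
    using that by (induction l rule: dec_induct) (auto simp: c_def intro: order_trans[OF _ mono])
  have T_low: "c * (1 / real l) \<le> T l" if "l \<ge> L" for l
  proof -
    have l1: "real l \<ge> 2" using that L by linarith
    have "\<tau> l \<ge> 0" using nn l1 by (simp add: \<tau>_def)
    then have "\<tau> l * \<psi> l \<le> \<tau> l" using \<psi>(2)[OF that] by (simp add: mult_left_le)
    also have "\<dots> \<le> real l * T l" unfolding \<tau>_def by (intro mult_right_mono nn) simp
    finally show ?thesis using low[OF that] l1 by (simp add: field_simps)
  qed
  show ?thesis
  proof
    assume "summable T"
    then have "summable (\<lambda>l. c * (1 / real l))"
      using T_low c by (intro summable_comparison_test[OF _ \<open>summable T\<close>])
        (auto intro!: exI[of _ L] simp: nn)
    then have "summable (\<lambda>l. 1 / real l)" using c by (subst (asm) summable_cmult_iff) auto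
    then show False using not_summable_harmonic[where 'a=real] by (simp add: inverse_eq_divide)
  qed
qed

text \<open>Raabe's test applies: by the expansion, \<open>l * (T l / T (l + 1) - 1)\<close> tends
  to \<open>- \<kappa> > 1\<close>.\<close>

lemma ratio_expansion_convergence:
  fixes T :: "nat \<Rightarrow> real"
  assumes r: "ratio_expansion r \<kappa>" and \<kappa>: "\<kappa> < -1"
    and pos: "eventually (\<lambda>l. T l > 0) sequentially"
    and step: "eventually (\<lambda>l. T (Suc l) = r l * T l) sequentially"
  shows "summable T"
proof (rule raabes_test_convergence)
  show "eventually (\<lambda>l. T l > 0) sequentially" by (rule pos)
  have "(\<lambda>l. r l - 1 - \<kappa> / real l) \<in> o(\<lambda>l. 1 / real l)"
    by (rule landau_o.big_small_trans[OF r[unfolded ratio_expansion_def]]) real_asymp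
  then have "((\<lambda>l. (r l - 1 - \<kappa> / real l) / (1 / real l)) \<longlongrightarrow> 0) sequentially"
    by (rule smalloD_tendsto)
  then have "((\<lambda>l. (r l - 1 - \<kappa> / real l) / (1 / real l) + \<kappa>) \<longlongrightarrow> \<kappa>) sequentially"
    by (rule tendsto_eq_intros) auto
  moreover have "eventually (\<lambda>l. (r l - 1 - \<kappa> / real l) / (1 / real l) + \<kappa> = real l * (r l - 1)) sequentially"
    using eventually_gt_at_top[of 0] by eventually_elim (simp add: field_simps)
  ultimately have lim: "(\<lambda>l. real l * (r l - 1)) \<longlonglongrightarrow> \<kappa>"
    by (rule Lim_transform_eventually)
  have "(\<lambda>l. real l * (r l - 1) * (1 / real l) + 1) \<longlonglongrightarrow> \<kappa> * 0 + 1"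
    by (intro tendsto_intros lim)
  moreover have "eventually (\<lambda>l. real l * (r l - 1) * (1 / real l) + 1 = r l) sequentially"
    using eventually_gt_at_top[of 0] by eventually_elim (simp add: field_simps)
  ultimately have lim1: "r \<longlonglongrightarrow> 1"
    using Lim_transform_eventually by force
  have "(\<lambda>l. - (real l * (r l - 1)) / r l) \<longlonglongrightarrow> - \<kappa> / 1"
    by (intro tendsto_intros lim lim1) simp
  moreover have "eventually (\<lambda>l. - (real l * (r l - 1)) / r l = real l * (T l / T (Suc l) - 1)) sequentially"
    using pos step order_tendstoD(1)[OF lim1 zero_less_one]
    by eventually_elim (simp add: field_simps)
  ultimately have "(\<lambda>l. real l * (T l / T (Suc l) - 1)) \<longlonglongrightarrow> - \<kappa>"
    using Lim_transform_eventually by force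
  then have "(\<lambda>l. ereal (real l * (T l / T (Suc l) - 1))) \<longlonglongrightarrow> ereal (- \<kappa>)" by simp
  then have "liminf (\<lambda>l. ereal (real l * (T l / T (Suc l) - 1))) = ereal (- \<kappa>)"
    by (rule lim_imp_Liminf[rotated]) simp
  then show "liminf (\<lambda>l. ereal (real l * (T l / T (Suc l) - 1))) > 1"
    using \<kappa> by (simp add: one_ereal_def)
qed


section \<open>Continuous dual Hahn recurrences\<close>

text \<open>With \<open>\<rho> = r + r'\<close> and \<open>e = r * r'\<close> this is
  \<open>(l + t + r) * (l + t + r')\<close>; sum and product stay real when r and r' are complex
  conjugates.\<close>

definition up_coeff :: "real \<Rightarrow> real \<Rightarrow> real \<Rightarrow> nat \<Rightarrow> real" where
  "up_coeff t \<rho> e l = (real l + t) * (real l + t + \<rho>) + e"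

text \<open>With \<open>\<rho> = r + r'\<close> and \<open>e = r r'\<close> this is the recurrence of the continuous dual Hahn polynomials
  with parameters \<open>t, r, r'\<close>; the spectral variable \<open>x\<^sup>2\<close> is \<open>- S\<close>. The term \<open>h (0 - 1) = h 0\<close> has coefficient 0.\<close>
definition dual_hahn_rec :: "real \<Rightarrow> real \<Rightarrow> real \<Rightarrow> real \<Rightarrow> (nat \<Rightarrow> 'a::real_normed_field) \<Rightarrow> bool" where
  "dual_hahn_rec t \<rho> e S h \<longleftrightarrow> (\<forall>l. of_real (up_coeff t \<rho> e l) * (h (Suc l) - h l)
      - of_real (real l * (real l + \<rho> - 1)) * (h l - h (l - 1)) = of_real (S - t\<^sup>2) * h l)"

text \<open>The weight for which the recurrence operator is symmetric (detailed balance between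
  \<open>l\<close> and \<open>l + 1\<close>). It grows like \<open>l\<close> to the power
  \<open>2 * t - 1\<close>.\<close>

definition dual_hahn_weight :: "real \<Rightarrow> real \<Rightarrow> real \<Rightarrow> (nat \<Rightarrow> real) \<Rightarrow> bool" where
  "dual_hahn_weight t \<rho> e W \<longleftrightarrow> (\<forall>l. W l > 0 \<and>
      W (Suc l) * ((real l + 1) * (real l + \<rho>)) = W l * up_coeff t \<rho> e l)"

lemma up_coeff_pos: "t > 0 \<Longrightarrow> \<rho> > 0 \<Longrightarrow> e \<ge> 0 \<Longrightarrow> up_coeff t \<rho> e l > 0"
  unfolding up_coeff_def
  by (rule add_pos_nonneg[OF mult_pos_pos]) (use of_nat_0_le_iff[of l] in linarith)+

lemma dual_hahn_rec_Re:
  assumes "dual_hahn_rec t \<rho> e S (h :: nat \<Rightarrow> complex)"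
  shows "dual_hahn_rec t \<rho> e S (\<lambda>l. Re (h l * z))"
  unfolding dual_hahn_rec_def
proof
  fix l
  have "Re ((of_real (up_coeff t \<rho> e l) * (h (Suc l) - h l)
      - of_real (real l * (real l + \<rho> - 1)) * (h l - h (l - 1))) * z) = Re (of_real (S - t\<^sup>2) * h l * z)"
    using assms unfolding dual_hahn_rec_def by presburger
  then show "of_real (up_coeff t \<rho> e l) * (Re (h (Suc l) * z) - Re (h l * z))
      - of_real (real l * (real l + \<rho> - 1)) * (Re (h l * z) - Re (h (l - 1) * z)) = of_real (S - t\<^sup>2) * Re (h l * z)"
    by (simp add: algebra_simps)
qed

text \<open>The factor \<open>(l + \<rho>) / (l + \<rho> + t)\<close> is the ratio of the positive supersolution
  \<open>(\<rho>)\<^sub>l / (\<rho> + t)\<^sub>l\<close> for \<open>S = 0\<close>.\<close>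
lemma dual_hahn_growth:
  fixes h :: "nat \<Rightarrow> real"
  assumes t: "t > 0" and \<rho>: "\<rho> > 0" and e: "e \<ge> 0" and S: "S \<ge> 0"
    and rec: "dual_hahn_rec t \<rho> e S h" and h0: "h 0 > 0"
  shows "h l > 0 \<and> h (Suc l) \<ge> (real l + \<rho>) / (real l + \<rho> + t) * h l"
proof (induction l)
  have R: "up_coeff t \<rho> e l * h (Suc l)
      = (up_coeff t \<rho> e l + real l * (real l + \<rho> - 1) + S - t\<^sup>2) * h l - real l * (real l + \<rho> - 1) * h (l - 1)" for l
    using rec unfolding dual_hahn_rec_def by (auto simp: algebra_simps dest!: spec[of _ l])
  \<comment> \<open>One induction step. The premise \<open>le\<close> is trivial at
    \<open>l = 0\<close>; at a successor it is the induction hypothesis multiplied by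
    \<open>l + 1\<close>.\<close>
  have fin: "h (Suc l) \<ge> (real l + \<rho>) / (real l + \<rho> + t) * h l"
    if pos: "h l > 0" and le: "real l * (real l + \<rho> - 1) * h (l - 1) \<le> real l * (real l - 1 + \<rho> + t) * h l" for l
  proof -
    have A: "up_coeff t \<rho> e l > 0" using t \<rho> e by (rule up_coeff_pos)
    have d: "real l + \<rho> + t > 0" using t \<rho> by simp
    have "up_coeff t \<rho> e l * ((real l + \<rho>) / (real l + \<rho> + t)) = up_coeff t \<rho> e l - t * (up_coeff t \<rho> e l / (real l + \<rho> + t))"
      using d by (simp add: field_simps)
    also have "up_coeff t \<rho> e l / (real l + \<rho> + t) = real l + t + e / (real l + \<rho> + t)"
      using d by (simp add: up_coeff_def field_simps)
    also have "up_coeff t \<rho> e l - t * (real l + t + e / (real l + \<rho> + t)) \<le> up_coeff t \<rho> e l - t * (real l + t)"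
      using t e d by (intro diff_left_mono mult_left_mono) auto
    finally have "up_coeff t \<rho> e l * ((real l + \<rho>) / (real l + \<rho> + t)) \<le> up_coeff t \<rho> e l - t * (real l + t)" .
    then have "up_coeff t \<rho> e l * ((real l + \<rho>) / (real l + \<rho> + t)) * h l \<le> (up_coeff t \<rho> e l - t * (real l + t)) * h l"
      using pos by (intro mult_right_mono) auto
    also have "\<dots> \<le> (up_coeff t \<rho> e l + real l * (real l + \<rho> - 1) + S - t\<^sup>2) * h l - real l * (real l - 1 + \<rho> + t) * h l"
      using S pos by (simp add: algebra_simps power2_eq_square)
    also have "\<dots> \<le> up_coeff t \<rho> e l * h (Suc l)" using le unfolding R by simp
    finally have "up_coeff t \<rho> e l * ((real l + \<rho>) / (real l + \<rho> + t) * h l) \<le> up_coeff t \<rho> e l * h (Suc l)"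
      by (simp only: mult.assoc)
    then show ?thesis using A by (rule mult_left_le_imp_le)
  qed
  case 0
  show ?case using fin[of 0] h0 by simp
  case (Suc l)
  have d: "(real l + \<rho>) > 0" "real l + \<rho> + t > 0" using t \<rho> by auto
  then have q: "(real l + \<rho>) / (real l + \<rho> + t) > 0" by simp
  have pos: "h (Suc l) > 0" using Suc q by (smt (verit) mult_pos_pos)
  have "(real l + \<rho>) * h l \<le> (real l + \<rho> + t) * h (Suc l)"
    using Suc d by (simp add: field_simps)
  then have "(real l + 1) * ((real l + \<rho>) * h l) \<le> (real l + 1) * ((real l + \<rho> + t) * h (Suc l))"
    by (intro mult_left_mono) auto
  then show ?case using fin[of "Suc l"] pos by (simp add: algebra_simps)
qed

text \<open>\<open>W\<close> grows like \<open>l\<close> to the power \<open>2 * t - 1\<close>, and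
  \<open>f\<close> is at least of order \<open>l\<close> to the power \<open>- t\<close>, so the
  terms are at least of the critical order 1/l. The sign of \<open>t\<close> is left open because
  the lemma also serves for a comparison sequence with \<open>t < 0\<close>.\<close>

lemma supersolution_not_summable:
  fixes f :: "nat \<Rightarrow> real"
  assumes \<rho>: "\<rho> > 0" and \<rho>t: "\<rho> + t > 0" and W: "dual_hahn_weight t \<rho> e W"
    and f0: "f 0 > 0" and f: "\<And>l. f (Suc l) \<ge> (real l + \<rho>) / (real l + \<rho> + t) * f l"
  shows "\<not> summable (\<lambda>l. W l * (f l)\<^sup>2)"
proof -
  have q: "(real l + \<rho>) / (real l + \<rho> + t) > 0" for l
  proof -
    have "real l + \<rho> + t > 0" "real l + \<rho> > 0" using \<rho> \<rho>t by linarith+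
    then show ?thesis by simp
  qed
  have fpos: "f l > 0" for l
  proof (induction l)
    case (Suc l)
    then show ?case using mult_pos_pos[OF q[of l] Suc] f[of l] by linarith
  qed (rule f0)
  have Wpos: "W l > 0" for l using W unfolding dual_hahn_weight_def by blast
  let ?r = "\<lambda>l. (((real l)\<^sup>2 + (2 * t + \<rho>) * real l + (t * (t + \<rho>) + e)) / ((real l)\<^sup>2 + (1 + \<rho>) * real l + \<rho>)) *
     (((real l)\<^sup>2 + (2 * \<rho>) * real l + \<rho>\<^sup>2) / ((real l)\<^sup>2 + (2 * (\<rho> + t)) * real l + (\<rho> + t)\<^sup>2))"
  have r: "ratio_expansion ?r (((2 * t + \<rho>) - (1 + \<rho>)) + ((2 * \<rho>) - (2 * (\<rho> + t))))"
    by (intro ratio_expansion_mult ratio_expansion_quadratic)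
  show ?thesis
  proof (rule gauss_test_divergence[OF r])
    fix l
    have W': "W (Suc l) = W l * (up_coeff t \<rho> e l / ((real l + 1) * (real l + \<rho>)))"
    proof -
      have "(real l + 1) * (real l + \<rho>) \<noteq> 0" using \<rho> by auto
      moreover have "W (Suc l) * ((real l + 1) * (real l + \<rho>)) = W l * up_coeff t \<rho> e l"
        using W unfolding dual_hahn_weight_def by blast
      ultimately show ?thesis by (simp add: eq_divide_eq)
    qed
    have "?r l * (W l * (f l)\<^sup>2) = W (Suc l) * ((real l + \<rho>) / (real l + \<rho> + t) * f l)\<^sup>2"
      unfolding W' up_coeff_def by (simp add: power_mult_distrib power_divide) (simp add: power2_eq_square algebra_simps)
    also have "\<dots> \<le> W (Suc l) * (f (Suc l))\<^sup>2"
      using f[of l] q[of l] fpos[of l] Wpos[of "Suc l"]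
      by (intro mult_left_mono power_mono less_imp_le[OF mult_pos_pos[OF q]]) auto
    finally show "?r l * (W l * (f l)\<^sup>2) \<le> W (Suc l) * (f (Suc l))\<^sup>2" .
  next
    show "W l * (f l)\<^sup>2 \<ge> 0" for l using Wpos[of l] by simp
    show "\<forall>\<^sub>F l in sequentially. 0 < W l * (f l)\<^sup>2"
      using fpos Wpos by (intro always_eventually allI mult_pos_pos zero_less_power)
  qed simp
qed

lemma Re_mult_cnj_square_le: "(Re (z * cnj w))\<^sup>2 \<le> (cmod w)\<^sup>2 * (cmod z)\<^sup>2"
proof -
  have "\<bar>Re (z * cnj w)\<bar> \<le> cmod w * cmod z"
    using abs_Re_le_cmod[of "z * cnj w"] by (simp only: norm_mult complex_mod_cnj mult.commute)
  then have "\<bar>Re (z * cnj w)\<bar>\<^sup>2 \<le> (cmod w * cmod z)\<^sup>2" by (rule power_mono) simp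
  then show ?thesis by (simp only: power2_abs power_mult_distrib)
qed

text \<open>The coefficients are real, so multiplying by \<open>cnj (h 0)\<close> and taking real
  parts gives a real solution with positive initial value. The growth estimate applies to it, and it
  is dominated by a multiple of \<open>h\<close>.\<close>

lemma dual_hahn_not_l2_pos:
  fixes h :: "nat \<Rightarrow> complex"
  assumes t: "t > 0" and \<rho>: "\<rho> > 0" and e: "e \<ge> 0" and S: "S \<ge> 0"
    and rec: "dual_hahn_rec t \<rho> e S h" and W: "dual_hahn_weight t \<rho> e W" and h0: "h 0 \<noteq> 0"
  shows "\<not> summable (\<lambda>l. W l * (cmod (h l))\<^sup>2)"
proof
  assume "summable (\<lambda>l. W l * (cmod (h l))\<^sup>2)"
  then have s: "summable (\<lambda>l. W l * (cmod (h l))\<^sup>2 * (cmod (h 0))\<^sup>2)" by (rule summable_mult2)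
  define f where "f l = Re (h l * cnj (h 0))" for l
  have "f 0 > 0" using h0 by (simp add: f_def complex_mult_cnj sum_power2_gt_zero_iff complex_eq_iff)
  note g = dual_hahn_growth[OF t \<rho> e S dual_hahn_rec_Re[OF rec], of "cnj (h 0)", folded f_def, OF this]
  have "\<not> summable (\<lambda>l. W l * (f l)\<^sup>2)"
    by (rule supersolution_not_summable[where f = f, OF \<rho> _ W]) (use t \<rho> g \<open>f 0 > 0\<close> in auto)
  moreover have "summable (\<lambda>l. W l * (f l)\<^sup>2)"
  proof (rule summable_comparison_test[OF _ s], intro exI[of _ 0] allI impI)
    fix l
    have Wl: "W l > 0" using W unfolding dual_hahn_weight_def by blast
    have "(f l)\<^sup>2 \<le> (cmod (h 0))\<^sup>2 * (cmod (h l))\<^sup>2" unfolding f_def by (rule Re_mult_cnj_square_le)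
    then show "norm (W l * (f l)\<^sup>2) \<le> W l * (cmod (h l))\<^sup>2 * (cmod (h 0))\<^sup>2"
      using Wl mult_left_mono[of "(f l)\<^sup>2" _ "W l"] by (simp add: abs_mult mult_ac)
  qed
  ultimately show False by simp
qed

text \<open>Subtract consecutive equations: \<open>up_coeff t\<close> at \<open>l + 1\<close> is
  \<open>up_coeff (t + 1)\<close> at \<open>l\<close>. This is the Christoffel transformation at
  \<open>S = t\<^sup>2\<close>, the spectral value for which the constants are solutions.\<close>

lemma dual_hahn_rec_diff:
  assumes "dual_hahn_rec t \<rho> e S (h :: nat \<Rightarrow> complex)"
  shows "dual_hahn_rec (t + 1) \<rho> e S (\<lambda>l. h (Suc l) - h l)"
  unfolding dual_hahn_rec_def
proof
  fix l
  define D where "D l = h (Suc l) - h l" for l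
  have R: "of_real (up_coeff t \<rho> e l) * D l
      - of_real (real l * (real l + \<rho> - 1)) * D (l - 1) = of_real (S - t\<^sup>2) * h l" for l
    using assms[unfolded dual_hahn_rec_def, rule_format, of l] unfolding D_def by (cases l) auto
  have "of_real (up_coeff t \<rho> e (Suc l)) * D (Suc l) - of_real (real (Suc l) * (real (Suc l) + \<rho> - 1)) * D l
      - (of_real (up_coeff t \<rho> e l) * D l - of_real (real l * (real l + \<rho> - 1)) * D (l - 1))
      = of_real (S - t\<^sup>2) * h (Suc l) - of_real (S - t\<^sup>2) * h l"
    using R[of "Suc l"] R[of l] by (simp only: diff_Suc_1)
  also have "\<dots> = of_real (S - t\<^sup>2) * D l"
    by (simp only: D_def right_diff_distrib)
  finally have "of_real (up_coeff t \<rho> e (Suc l)) * D (Suc l) - of_real (real (Suc l) * (real (Suc l) + \<rho> - 1)) * D l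
      - (of_real (up_coeff t \<rho> e l) * D l - of_real (real l * (real l + \<rho> - 1)) * D (l - 1)) = of_real (S - t\<^sup>2) * D l" .
  then show "of_real (up_coeff (t + 1) \<rho> e l) * ((h (Suc (Suc l)) - h (Suc l)) - (h (Suc l) - h l))
      - of_real (real l * (real l + \<rho> - 1)) * ((h (Suc l) - h l) - (h (Suc (l - 1)) - h (l - 1)))
      = of_real (S - (t + 1)\<^sup>2) * (h (Suc l) - h l)"
    unfolding D_def[symmetric] up_coeff_def by (simp add: algebra_simps power2_eq_square)
qed

lemma dual_hahn_weight_step:
  assumes "dual_hahn_weight t \<rho> e W" "\<rho> > 0"
  shows "W (Suc l) = ((real l)\<^sup>2 + (2 * t + \<rho>) * real l + (t * (t + \<rho>) + e)) / ((real l)\<^sup>2 + (1 + \<rho>) * real l + \<rho>) * W l"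
proof -
  have "(real l + 1) * (real l + \<rho>) \<noteq> 0" using assms by auto
  moreover have "W (Suc l) * ((real l + 1) * (real l + \<rho>)) = W l * up_coeff t \<rho> e l"
    using assms unfolding dual_hahn_weight_def by blast
  ultimately have "W (Suc l) = W l * up_coeff t \<rho> e l / ((real l + 1) * (real l + \<rho>))" by (simp add: eq_divide_eq)
  then show ?thesis by (simp add: up_coeff_def algebra_simps power2_eq_square)
qed

text \<open>For \<open>t < 0\<close> the constant solution is square summable; the differences of any other
  solution obey the recurrence with \<open>t + 1 > 0\<close>, to which the growth estimate applies.\<close>
lemma dual_hahn_not_l2_neg:
  fixes h :: "nat \<Rightarrow> complex"
  assumes t: "-1 < t" "t < 0" and \<rho>: "\<rho> + t > 0" and e: "e \<ge> 0" and S: "S \<ge> 0" "S \<noteq> t\<^sup>2"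
    and A0: "up_coeff t \<rho> e 0 \<noteq> 0"
    and rec: "dual_hahn_rec t \<rho> e S h" and W: "dual_hahn_weight t \<rho> e W" and h0: "h 0 \<noteq> 0"
  shows "\<not> summable (\<lambda>l. W l * (cmod (h l))\<^sup>2)"
proof
  assume sum_h: "summable (\<lambda>l. W l * (cmod (h l))\<^sup>2)"
  have \<rho>0: "\<rho> > 0" using \<rho> t by linarith
  have Wpos: "W l > 0" for l using W unfolding dual_hahn_weight_def by blast
  define D where "D l = h (Suc l) - h l" for l
  have "of_real (up_coeff t \<rho> e 0) * D 0 = of_real (S - t\<^sup>2) * h 0"
    using rec unfolding dual_hahn_rec_def D_def by (auto dest: spec[of _ 0])
  moreover have "complex_of_real (S - t\<^sup>2) \<noteq> 0" using S(2) by (simp only: of_real_eq_0_iff right_minus_eq) simp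
  ultimately have D0: "D 0 \<noteq> 0" using h0 by (metis mult_eq_0_iff)
  define f where "f l = Re (D l * cnj (D 0))" for l
  have f0: "f 0 > 0" using D0 by (simp add: f_def complex_mult_cnj sum_power2_gt_zero_iff complex_eq_iff)
  have recD: "dual_hahn_rec (t + 1) \<rho> e S D" unfolding D_def by (rule dual_hahn_rec_diff[OF rec])
  have f: "f (Suc l) \<ge> (real l + \<rho>) / (real l + \<rho> + (t + 1)) * f l" for l
    using dual_hahn_growth[OF _ \<rho>0 e S(1) dual_hahn_rec_Re[OF recD], of "cnj (D 0)" l] t f0
    unfolding f_def by simp
  \<comment> \<open>\<open>\<psi>\<close> is of order \<open>l\<close> to the power
    \<open>- t\<close>, and its differences satisfy with equality the growth bound that
    \<open>f\<close> satisfies as an inequality. Hence \<open>f\<close> dominates a multiple of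
    these differences, and summation bounds \<open>g\<close> below by \<open>\<psi>\<close> up to
    constants.\<close>
  define \<psi> where "\<psi> l = (\<Prod>i<l. (real i + \<rho>) / (real i + \<rho> + t))" for l
  have d: "real l + \<rho> + t > 0" "real l + \<rho> > 0" for l using \<rho> t by linarith+
  have \<psi>S: "\<psi> (Suc l) = (real l + \<rho>) / (real l + \<rho> + t) * \<psi> l" for l by (simp add: \<psi>_def)
  have \<psi>pos: "\<psi> l > 0" for l unfolding \<psi>_def using d by (intro prod_pos) auto
  \<comment> \<open>Chosen so that \<open>f 0\<close> equals \<open>c\<close> times the first
    difference of \<open>\<psi>\<close>.\<close>
  define c where "c = f 0 * (\<rho> + t) / (- t)"
  have c: "c > 0" unfolding c_def using f0 \<rho> t by (intro divide_pos_pos mult_pos_pos) auto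
  have fl: "f l \<ge> c * (\<psi> l * (- t) / (real l + \<rho> + t))" for l
  proof (induction l)
    case 0
    then show ?case using \<rho> t by (simp add: c_def \<psi>_def)
  next
    case (Suc l)
    have "c * (\<psi> (Suc l) * (- t) / (real (Suc l) + \<rho> + t))
        = (real l + \<rho>) / (real l + \<rho> + (t + 1)) * (c * (\<psi> l * (- t) / (real l + \<rho> + t)))"
      using d[of l] d[of "Suc l"] by (simp add: \<psi>S add.assoc add.left_commute add.commute) (simp add: mult_ac)
    also have "\<dots> \<le> (real l + \<rho>) / (real l + \<rho> + (t + 1)) * f l"
      using Suc d[of l] t by (intro mult_left_mono) auto
    also have "\<dots> \<le> f (Suc l)" by (rule f)
    finally show ?case .
  qed
  define g where "g l = Re (h l * cnj (D 0))" for l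
  have g: "g l \<ge> g 0 + c * (\<psi> l - 1)" for l
  proof (induction l)
    case 0
    then show ?case by (simp add: \<psi>_def)
  next
    case (Suc l)
    have "\<psi> (Suc l) - \<psi> l = \<psi> l * (- t) / (real l + \<rho> + t)"
      using d[of l] by (simp add: \<psi>S field_simps)
    then have "c * (\<psi> (Suc l) - \<psi> l) \<le> f l" using fl[of l] by simp
    moreover have "g (Suc l) = g l + f l" by (simp add: g_def f_def D_def algebra_simps)
    ultimately show ?case using Suc by (simp add: algebra_simps)
  qed
  define B where "B = \<bar>g 0\<bar> + c"
  have bound: "c\<^sup>2 * (W l * (\<psi> l)\<^sup>2) \<le> 2 * (cmod (D 0))\<^sup>2 * (W l * (cmod (h l))\<^sup>2) + 2 * B\<^sup>2 * W l" for l
  proof -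
    have "\<bar>g l\<bar> \<le> cmod (h l) * cmod (D 0)"
      using abs_Re_le_cmod[of "h l * cnj (D 0)"] by (simp add: g_def norm_mult)
    moreover have "c * (\<psi> l - 1) = c * \<psi> l - c" by (simp add: right_diff_distrib)
    ultimately have "c * \<psi> l \<le> cmod (h l) * cmod (D 0) + B"
      using g[of l] unfolding B_def by linarith
    then have "(c * \<psi> l)\<^sup>2 \<le> (cmod (h l) * cmod (D 0) + B)\<^sup>2"
      using c \<psi>pos[of l] by (intro power_mono) auto
    also have "\<dots> \<le> 2 * (cmod (h l) * cmod (D 0))\<^sup>2 + 2 * B\<^sup>2"
      using zero_le_power2[of "cmod (h l) * cmod (D 0) - B"] by (simp only: power2_diff power2_sum)
    finally have "W l * (c * \<psi> l)\<^sup>2 \<le> W l * (2 * (cmod (h l) * cmod (D 0))\<^sup>2 + 2 * B\<^sup>2)"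
      using Wpos[of l] by (intro mult_left_mono) auto
    then show ?thesis by (simp add: algebra_simps power_mult_distrib)
  qed
  \<comment> \<open>For \<open>t < 0\<close> the weight itself is summable, so the constants in the
    lower bound for \<open>g\<close> are harmless, and a square summable \<open>h\<close> would make
    \<open>W * \<psi>\<^sup>2\<close> summable.\<close>
  have sum_W: "summable W"
  proof (rule ratio_expansion_convergence[OF ratio_expansion_quadratic[of "2 * t + \<rho>" "t * (t + \<rho>) + e" "1 + \<rho>" \<rho>]])
    show "\<forall>\<^sub>F l in sequentially. W (Suc l) = ((real l)\<^sup>2 + (2 * t + \<rho>) * real l + (t * (t + \<rho>) + e)) / ((real l)\<^sup>2 + (1 + \<rho>) * real l + \<rho>) * W l"
      using dual_hahn_weight_step[OF W \<rho>0] by (intro always_eventually allI)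
  qed (use t Wpos in auto)
  have "summable (\<lambda>l. c\<^sup>2 * (W l * (\<psi> l)\<^sup>2))"
    by (rule summable_comparison_test[OF _ summable_add[OF summable_mult[OF sum_h] summable_mult[OF sum_W]]])
      (use bound Wpos in \<open>auto intro!: exI[of _ 0] simp: less_imp_le abs_mult\<close>)
  then have "summable (\<lambda>l. W l * (\<psi> l)\<^sup>2)" using c by (subst (asm) summable_cmult_iff) auto
  moreover have "\<not> summable (\<lambda>l. W l * (\<psi> l)\<^sup>2)"
    by (rule supersolution_not_summable[where f = \<psi>, OF \<rho>0 \<rho> W]) (use \<psi>S \<psi>pos in auto)
  ultimately show False by simp
qed

text \<open>The oscillatory case: \<open>\<xi> = (l + \<rho> - 1) (h l - h (l - 1)) + (t + \<i> \<sigma>) h l\<close> diagonalises the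
  recurrence up to summable errors.\<close>
lemma dual_hahn_not_l2_osc:
  fixes h :: "nat \<Rightarrow> complex"
  assumes t: "t > 0" and \<rho>: "\<rho> > 0" and A_pos: "\<And>l. up_coeff t \<rho> e l > 0" and \<sigma>: "\<sigma> \<noteq> 0"
    and rec: "dual_hahn_rec t \<rho> e (- (\<sigma>\<^sup>2)) h" and W: "dual_hahn_weight t \<rho> e W" and h0: "h 0 \<noteq> 0"
    and sum_h: "summable (\<lambda>l. W l * (cmod (h l))\<^sup>2)"
  shows "\<not> summable (\<lambda>l. W l * up_coeff t \<rho> e l * (cmod (h (Suc l) - h l))\<^sup>2)"
proof
  assume sum_D: "summable (\<lambda>l. W l * up_coeff t \<rho> e l * (cmod (h (Suc l) - h l))\<^sup>2)"
  have Wpos: "W l > 0" for l using W unfolding dual_hahn_weight_def by blast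
  define A where "A = up_coeff t \<rho> e"
  have A: "A l > 0" for l unfolding A_def by (rule A_pos)
  define f where "f l = Re (h l * cnj (h 0))" for l
  have f0: "f 0 > 0" using h0 by (simp add: f_def complex_mult_cnj sum_power2_gt_zero_iff complex_eq_iff)
  have R: "A l * (f (Suc l) - f l) = real l * ((real l + \<rho> - 1) * (f l - f (l - 1))) - (t\<^sup>2 + \<sigma>\<^sup>2) * f l" for l
    using dual_hahn_rec_Re[OF rec, of "cnj (h 0)"] unfolding dual_hahn_rec_def A_def f_def
    by (auto simp: algebra_simps dest!: spec[of _ l])
  define \<theta> where "\<theta> = Complex t \<sigma>"
  define \<xi> where "\<xi> l = of_real ((real l + \<rho> - 1) * (f l - f (l - 1))) + \<theta> * of_real (f l)" for l
  \<comment> \<open>\<open>f\<close> is the imaginary part of \<open>\<xi>\<close> divided by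
    \<open>\<sigma>\<close>, so the error term in \<open>\<xi>S\<close> is at most
    \<open>K * cmod (\<xi> l)\<close>. Divided by the quadratic \<open>A l\<close>, it leaves the
    coefficient of 1/l unchanged.\<close>
  define K where "K = cmod \<theta> * cmod (Complex (e - \<sigma>\<^sup>2) (\<sigma> * \<rho>)) / \<bar>\<sigma>\<bar>"
  have f_le: "\<bar>f l\<bar> \<le> cmod (\<xi> l) / \<bar>\<sigma>\<bar>" for l
  proof -
    have "Im (\<xi> l) = \<sigma> * f l" by (simp add: \<xi>_def \<theta>_def)
    then show ?thesis using abs_Im_le_cmod[of "\<xi> l"] \<sigma> by (simp add: field_simps abs_mult)
  qed
  have \<xi>S: "of_real (A l) * \<xi> (Suc l)
      = of_real (real l) * Complex (real l + \<rho> + t) \<sigma> * \<xi> l + \<theta> * of_real (f l) * Complex (e - \<sigma>\<^sup>2) (\<sigma> * \<rho>)" for l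
  proof -
    define F where "F = (real l + \<rho> - 1) * (f l - f (l - 1))"
    define X where "X = real l * F - (t\<^sup>2 + \<sigma>\<^sup>2) * f l"
    have X: "A l * (f (Suc l) - f l) = X" using R[of l] by (simp add: X_def F_def)
    have F: "\<xi> l = of_real F + \<theta> * of_real (f l)" by (simp add: \<xi>_def F_def)
    have "of_real (A l) * \<xi> (Suc l) = of_real ((real l + \<rho>) * (A l * (f (Suc l) - f l)))
        + \<theta> * of_real (A l * f l + A l * (f (Suc l) - f l))"
      by (simp add: \<xi>_def algebra_simps)
    also have "\<dots> = of_real (real l) * Complex (real l + \<rho> + t) \<sigma> * \<xi> l + \<theta> * of_real (f l) * Complex (e - \<sigma>\<^sup>2) (\<sigma> * \<rho>)"
      unfolding X F unfolding A_def up_coeff_def \<theta>_def X_def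
      by (simp add: complex_eq_iff power2_eq_square algebra_simps)
    finally show ?thesis .
  qed
  have step: "cmod (\<xi> (Suc l)) \<ge> ((real l)\<^sup>2 + (\<rho> + t) * real l + (- K)) / ((real l)\<^sup>2 + (2 * t + \<rho>) * real l + (t * (t + \<rho>) + e)) * cmod (\<xi> l)" for l
  proof -
    have "real l * (real l + \<rho> + t) * cmod (\<xi> l) \<le> cmod (of_real (real l) * Complex (real l + \<rho> + t) \<sigma> * \<xi> l)"
      unfolding norm_mult using t \<rho> complex_Re_le_cmod[of "Complex (real l + \<rho> + t) \<sigma>"]
      by (intro mult_right_mono) (auto intro: mult_left_mono)
    moreover have "cmod (\<theta> * of_real (f l) * Complex (e - \<sigma>\<^sup>2) (\<sigma> * \<rho>)) \<le> K * cmod (\<xi> l)"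
    proof -
      have "cmod \<theta> * cmod (Complex (e - \<sigma>\<^sup>2) (\<sigma> * \<rho>)) * \<bar>f l\<bar> \<le> cmod \<theta> * cmod (Complex (e - \<sigma>\<^sup>2) (\<sigma> * \<rho>)) * (cmod (\<xi> l) / \<bar>\<sigma>\<bar>)"
        by (intro mult_left_mono f_le) auto
      then show ?thesis by (simp add: norm_mult K_def mult_ac)
    qed
    ultimately have "real l * (real l + \<rho> + t) * cmod (\<xi> l) - K * cmod (\<xi> l) \<le> cmod (of_real (A l) * \<xi> (Suc l))"
      unfolding \<xi>S by (rule order_trans[OF diff_mono norm_diff_ineq])
    also have "\<dots> = A l * cmod (\<xi> (Suc l))" using A[of l] by (simp add: norm_mult)
    finally have "(real l * (real l + \<rho> + t) - K) / A l * cmod (\<xi> l) \<le> cmod (\<xi> (Suc l))"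
      using A[of l] by (simp add: field_simps)
    then show ?thesis by (simp add: A_def up_coeff_def algebra_simps power2_eq_square)
  qed
  let ?q = "\<lambda>l. ((real l)\<^sup>2 + (\<rho> + t) * real l + (- K)) / ((real l)\<^sup>2 + (2 * t + \<rho>) * real l + (t * (t + \<rho>) + e))"
  let ?w = "\<lambda>l. ((real l)\<^sup>2 + (2 * t + \<rho>) * real l + (t * (t + \<rho>) + e)) / ((real l)\<^sup>2 + (1 + \<rho>) * real l + \<rho>)"
  \<comment> \<open>A zero of \<open>\<xi>\<close> at \<open>l > 0\<close> is a common zero of
    \<open>f l\<close> and \<open>f (l - 1)\<close>; running the recurrence downwards then gives
    \<open>f 0 = 0\<close>.\<close>
  have nz: "\<xi> l \<noteq> 0" if "l > 0" for l
  proof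
    assume "\<xi> l = 0"
    then have fl: "f l = 0" using f_le[of l] by simp
    moreover have "(real l + \<rho> - 1) * (f l - f (l - 1)) = 0" using \<open>\<xi> l = 0\<close> fl unfolding \<xi>_def
      by (simp only: of_real_0 mult_zero_right add_0_right of_real_eq_0_iff)
    ultimately have fl1: "f (l - 1) = 0" using that \<rho> by (cases l) auto
    have "f (l - k) = 0 \<and> f (l - Suc k) = 0" for k
    proof (induction k)
      case 0
      then show ?case using fl fl1 by simp
    next
      case (Suc k)
      then show ?case using R[of "l - Suc k"] \<rho>
        by (cases "l - Suc k") (auto simp: diff_Suc split: nat.splits)
    qed
    from this[of l] f0 show False by simp
  qed
  have ev: "\<forall>\<^sub>F l in sequentially. ?q l \<ge> 0"
    by real_asymp
  then obtain L0 where L0: "\<And>l. l \<ge> L0 \<Longrightarrow> ?q l \<ge> 0" unfolding eventually_sequentially by blast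
  \<comment> \<open>Squaring the bound \<open>step\<close> requires a nonnegative factor, which is
    available from \<open>L0\<close> on; below \<open>L0\<close> the trivial bound 0 is
    taken.\<close>
  define r where "r l = (if l \<ge> L0 then ?w l * (?q l * ?q l) else 0)" for l
  have "ratio_expansion (\<lambda>l. ?w l * (?q l * ?q l)) (((2 * t + \<rho>) - (1 + \<rho>)) + (((\<rho> + t) - (2 * t + \<rho>)) + ((\<rho> + t) - (2 * t + \<rho>))))"
    by (intro ratio_expansion_mult ratio_expansion_quadratic)
  moreover have "\<forall>\<^sub>F l in sequentially. r l = ?w l * (?q l * ?q l)"
    unfolding eventually_sequentially r_def by (rule exI[of _ L0]) auto
  ultimately have "ratio_expansion r (-1)"
    unfolding ratio_expansion_def by (subst landau_o.big.in_cong[where g = "\<lambda>l. ?w l * (?q l * ?q l) - 1 - (-1) / real l"])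
      (auto elim: eventually_mono)
  then have "\<not> summable (\<lambda>l. W l * (cmod (\<xi> l))\<^sup>2)"
  proof (rule gauss_test_divergence)
    fix l
    show "r l * (W l * (cmod (\<xi> l))\<^sup>2) \<le> W (Suc l) * (cmod (\<xi> (Suc l)))\<^sup>2"
    proof (cases "l \<ge> L0")
      case True
      have "r l * (W l * (cmod (\<xi> l))\<^sup>2) = (?w l * W l) * (?q l * cmod (\<xi> l))\<^sup>2"
        using True by (simp only: r_def if_True) (simp only: power2_eq_square mult_ac)
      also have "\<dots> = W (Suc l) * (?q l * cmod (\<xi> l))\<^sup>2" by (simp only: dual_hahn_weight_step[OF W \<rho>])
      also have "\<dots> \<le> W (Suc l) * (cmod (\<xi> (Suc l)))\<^sup>2"
        using Wpos[of "Suc l"] step[of l] L0[OF True]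
        by (intro mult_left_mono power_mono mult_nonneg_nonneg) auto
      finally show ?thesis .
    qed (use Wpos[of "Suc l"] in \<open>simp add: r_def\<close>)
    show "\<forall>\<^sub>F l in sequentially. 0 < W l * (cmod (\<xi> l))\<^sup>2"
      using eventually_gt_at_top[of 0] by eventually_elim (use nz Wpos in auto)
  qed (use Wpos in \<open>auto simp: less_imp_le\<close>)
  \<comment> \<open>On the other hand \<open>\<xi>\<close> is bounded by a difference and a value of
    \<open>f\<close>. The shift by one index allows \<open>W (l + 1) * (l + \<rho>)\<^sup>2\<close>
    to be compared with \<open>W l * up_coeff t \<rho> e l\<close>, the weight in
    \<open>sum_D\<close>.\<close>
  moreover have "summable (\<lambda>l. W l * (cmod (\<xi> l))\<^sup>2)"
  proof (subst summable_Suc_iff[symmetric])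
    define k where "k = (cmod (h 0))\<^sup>2"
    have fh: "(f l)\<^sup>2 \<le> k * (cmod (h l))\<^sup>2" for l
      unfolding f_def k_def by (rule Re_mult_cnj_square_le)
    have fD: "(f (Suc l) - f l)\<^sup>2 \<le> k * (cmod (h (Suc l) - h l))\<^sup>2" for l
    proof -
      have "f (Suc l) - f l = Re ((h (Suc l) - h l) * cnj (h 0))" by (simp add: f_def left_diff_distrib)
      then show ?thesis unfolding k_def by (simp only: Re_mult_cnj_square_le)
    qed
    have k: "k \<ge> 0" by (simp add: k_def)
    have "W (Suc l) * (cmod (\<xi> (Suc l)))\<^sup>2 \<le> 2 * (1 + \<rho>) * k * (W l * up_coeff t \<rho> e l * (cmod (h (Suc l) - h l))\<^sup>2)
        + 2 * (cmod \<theta>)\<^sup>2 * k * (W (Suc l) * (cmod (h (Suc l)))\<^sup>2)" for l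
    proof -
      have "cmod (\<xi> (Suc l)) \<le> \<bar>(real l + \<rho>) * (f (Suc l) - f l)\<bar> + cmod \<theta> * \<bar>f (Suc l)\<bar>"
        unfolding \<xi>_def by (rule order_trans[OF norm_triangle_ineq]) (simp add: norm_mult[of \<theta>] del: of_real_mult)
      then have "(cmod (\<xi> (Suc l)))\<^sup>2 \<le> (\<bar>(real l + \<rho>) * (f (Suc l) - f l)\<bar> + cmod \<theta> * \<bar>f (Suc l)\<bar>)\<^sup>2"
        by (intro power_mono) auto
      also have "\<dots> \<le> 2 * (\<bar>(real l + \<rho>) * (f (Suc l) - f l)\<bar>)\<^sup>2 + 2 * (cmod \<theta> * \<bar>f (Suc l)\<bar>)\<^sup>2"
        using zero_le_power2[of "\<bar>(real l + \<rho>) * (f (Suc l) - f l)\<bar> - cmod \<theta> * \<bar>f (Suc l)\<bar>"]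
        by (simp only: power2_diff power2_sum)
      also have "\<dots> = 2 * (real l + \<rho>)\<^sup>2 * (f (Suc l) - f l)\<^sup>2 + 2 * (cmod \<theta>)\<^sup>2 * (f (Suc l))\<^sup>2"
        by (simp add: power_mult_distrib)
      also have "\<dots> \<le> 2 * (real l + \<rho>)\<^sup>2 * (k * (cmod (h (Suc l) - h l))\<^sup>2) + 2 * (cmod \<theta>)\<^sup>2 * (k * (cmod (h (Suc l)))\<^sup>2)"
        by (intro add_mono mult_left_mono fD fh) auto
      finally have 1: "W (Suc l) * (cmod (\<xi> (Suc l)))\<^sup>2 \<le> W (Suc l) * (2 * (real l + \<rho>)\<^sup>2 * (k * (cmod (h (Suc l) - h l))\<^sup>2) + 2 * (cmod \<theta>)\<^sup>2 * (k * (cmod (h (Suc l)))\<^sup>2))"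
        using Wpos[of "Suc l"] by (intro mult_left_mono) auto
      have "W (Suc l) * (real l + \<rho>)\<^sup>2 \<le> (1 + \<rho>) * (W l * up_coeff t \<rho> e l)"
      proof -
        have "W l * up_coeff t \<rho> e l = W (Suc l) * ((real l + 1) * (real l + \<rho>))"
          using W unfolding dual_hahn_weight_def by simp
        moreover have "(real l + \<rho>) * (real l + \<rho>) \<le> ((1 + \<rho>) * (real l + 1)) * (real l + \<rho>)"
          using \<rho> by (intro mult_right_mono) (auto simp: algebra_simps)
        ultimately show ?thesis using Wpos[of "Suc l"] by (simp add: power2_eq_square mult_ac)
      qed
      then have "W (Suc l) * (real l + \<rho>)\<^sup>2 * (2 * k * (cmod (h (Suc l) - h l))\<^sup>2) \<le> (1 + \<rho>) * (W l * up_coeff t \<rho> e l) * (2 * k * (cmod (h (Suc l) - h l))\<^sup>2)"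
        using k by (intro mult_right_mono) auto
      with 1 show ?thesis by (simp only: distrib_left mult_ac)
    qed
    moreover have "summable (\<lambda>l. 2 * (1 + \<rho>) * k * (W l * up_coeff t \<rho> e l * (cmod (h (Suc l) - h l))\<^sup>2)
        + 2 * (cmod \<theta>)\<^sup>2 * k * (W (Suc l) * (cmod (h (Suc l)))\<^sup>2))"
      by (intro summable_add summable_mult sum_D
          iffD2[OF summable_Suc_iff[of "\<lambda>l. W l * (cmod (h l))\<^sup>2"] sum_h])
    moreover have "norm (W (Suc l) * (cmod (\<xi> (Suc l)))\<^sup>2) = W (Suc l) * (cmod (\<xi> (Suc l)))\<^sup>2" for l
      using Wpos[of "Suc l"] by (simp add: abs_mult)
    ultimately show "summable (\<lambda>l. W (Suc l) * (cmod (\<xi> (Suc l)))\<^sup>2)"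
      by (metis (no_types, lifting) summable_comparison_test)
  qed
  ultimately show False by simp
qed

lemma dual_hahn_rec_zero:
  fixes h :: "nat \<Rightarrow> complex"
  assumes rec: "dual_hahn_rec t \<rho> e S h" and A: "\<And>l. up_coeff t \<rho> e l \<noteq> 0" and h0: "h 0 = 0"
  shows "h l = 0"
proof -
  have "h l = 0 \<and> h (Suc l) = 0" for l
  proof (induction l)
    case 0
    then show ?case using rec[unfolded dual_hahn_rec_def, rule_format, of 0] A[of 0] h0 by simp
  next
    case (Suc l)
    then show ?case using rec[unfolded dual_hahn_rec_def, rule_format, of "Suc l"] A[of "Suc l"] by simp
  qed
  then show ?thesis by blast
qed


section \<open>Submodules as families of weight vectors\<close>

text \<open>\<open>U j\<close> stands for the image of the basis vector x(j). Injectivity is encoded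
  as nonvanishing of every \<open>U j\<close>, which suffices because the weights are
  distinct.\<close>

definition module_family ::
  "complex \<Rightarrow> complex \<Rightarrow> complex \<Rightarrow> complex \<Rightarrow> real \<Rightarrow> (int \<Rightarrow> int \<Rightarrow> int \<Rightarrow> complex) \<Rightarrow> bool" where
  "module_family d1 d2 c1 c2 c U \<longleftrightarrow> (\<forall>j. inK d1 d2 j \<longrightarrow>
     U j \<in> HT c1 c2 c \<and> U j \<noteq> (\<lambda>k m. 0) \<and>
     tH c1 c2 c (U j) = (\<lambda>k m. Hcoef d1 d2 j * U j k m) \<and>
     tE c1 c2 c (U j) = (\<lambda>k m. if inK d1 d2 (j + 1) then Ecoef d1 d2 j * U (j + 1) k m else 0) \<and>
     tF c1 c2 c (U j) = (\<lambda>k m. if inK d1 d2 (j - 1) then Fcoef d1 d2 j * U (j - 1) k m else 0))"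

lemma tE_apply: "tE c1 c2 c u k m =
   (if inK c1 c2 k \<and> inK c1 c2 (k - 1) then Ecoef c1 c2 (k - 1) else 0) * u (k - 1) m +
   (if inK (of_real c) 0 m \<and> inK (of_real c) 0 (m - 1) then Ecoef (of_real c) 0 (m - 1) else 0) * u k (m - 1)"
  by (simp add: tE_def tensor_op_def actE_def)

lemma tF_apply: "tF c1 c2 c u k m =
   (if inK c1 c2 k \<and> inK c1 c2 (k + 1) then Fcoef c1 c2 (k + 1) else 0) * u (k + 1) m +
   (if inK (of_real c) 0 m \<and> inK (of_real c) 0 (m + 1) then Fcoef (of_real c) 0 (m + 1) else 0) * u k (m + 1)"
  by (simp add: tF_def tensor_op_def actF_def)

lemma tH_apply: "u \<in> FS c1 c2 c \<Longrightarrow>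
    tH c1 c2 c u k m = (c1 - c2 + of_real c + 2 * of_int (k + m)) * u k m"
  by (cases "u k m = 0") (auto simp: tH_def tensor_op_def actH_def Hcoef_def FS_def algebra_simps)

lemma Nvec_unit: "inK d1 d2 j \<Longrightarrow> (\<lambda>i. if i = j then 1 else 0) \<in> Nvec d1 d2"
  by (auto simp: Nvec_def)

lemma summable_on_finite_sum:
  fixes f :: "'i \<Rightarrow> 'a \<Rightarrow> real"
  assumes "finite I" "\<And>i. i \<in> I \<Longrightarrow> f i summable_on A"
  shows "(\<lambda>x. \<Sum>i\<in>I. f i x) summable_on A"
  using assms by (induction I rule: finite_induct) (auto intro: summable_on_add)

lemma hilbert_submodule_imp_family:
  assumes "hilbert_submodule d1 d2 c1 c2 c"
  shows "\<exists>U. module_family d1 d2 c1 c2 c U"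
proof -
  obtain T where HT: "\<And>v. v \<in> Nvec d1 d2 \<Longrightarrow> T v \<in> HT c1 c2 c" and inj: "inj_on T (Nvec d1 d2)"
    and scale: "\<And>v a. v \<in> Nvec d1 d2 \<Longrightarrow> T (\<lambda>k. a * v k) = (\<lambda>k m. a * T v k m)"
    and act: "\<And>v. v \<in> Nvec d1 d2 \<Longrightarrow> T (actH d1 d2 v) = tH c1 c2 c (T v)"
      "\<And>v. v \<in> Nvec d1 d2 \<Longrightarrow> T (actE d1 d2 v) = tE c1 c2 c (T v)"
      "\<And>v. v \<in> Nvec d1 d2 \<Longrightarrow> T (actF d1 d2 v) = tF c1 c2 c (T v)"
    using assms unfolding hilbert_submodule_def by blast
  define e :: "int \<Rightarrow> int \<Rightarrow> complex" where "e j = (\<lambda>i. if i = j then 1 else 0)" for j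
  have e: "e j \<in> Nvec d1 d2" if "inK d1 d2 j" for j using that unfolding e_def by (rule Nvec_unit)
  have zero: "(\<lambda>_. 0) \<in> Nvec d1 d2" by (simp add: Nvec_def)
  have T0: "T (\<lambda>_. 0) = (\<lambda>k m. 0)" using scale[OF zero, of 0] by simp
  have "module_family d1 d2 c1 c2 c (\<lambda>j. T (e j))"
    unfolding module_family_def
  proof (intro allI impI conjI)
    fix j assume j: "inK d1 d2 j"
    show "T (e j) \<in> HT c1 c2 c" by (rule HT[OF e[OF j]])
    show "T (e j) \<noteq> (\<lambda>k m. 0)"
    proof
      assume "T (e j) = (\<lambda>k m. 0)"
      then have "e j = (\<lambda>_. 0)" using inj_onD[OF inj _ e[OF j] zero] T0 by simp
      then show False by (auto simp: e_def dest: fun_cong[of _ _ j])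
    qed
    have "actH d1 d2 (e j) = (\<lambda>k. Hcoef d1 d2 j * e j k)" using j by (auto simp: actH_def e_def)
    then show "tH c1 c2 c (T (e j)) = (\<lambda>k m. Hcoef d1 d2 j * T (e j) k m)"
      using act(1)[OF e[OF j]] scale[OF e[OF j]] by simp
    have "actE d1 d2 (e j) = (if inK d1 d2 (j + 1) then (\<lambda>k. Ecoef d1 d2 j * e (j + 1) k) else (\<lambda>_. 0))"
      using j by (auto simp: actE_def e_def fun_eq_iff)
    then show "tE c1 c2 c (T (e j)) = (\<lambda>k m. if inK d1 d2 (j + 1) then Ecoef d1 d2 j * T (e (j + 1)) k m else 0)"
      using act(2)[OF e[OF j]] scale[OF e[of "j + 1"]] T0 by (cases "inK d1 d2 (j + 1)") auto
    have "actF d1 d2 (e j) = (if inK d1 d2 (j - 1) then (\<lambda>k. Fcoef d1 d2 j * e (j - 1) k) else (\<lambda>_. 0))"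
      using j by (auto simp: actF_def e_def fun_eq_iff)
    then show "tF c1 c2 c (T (e j)) = (\<lambda>k m. if inK d1 d2 (j - 1) then Fcoef d1 d2 j * T (e (j - 1)) k m else 0)"
      using act(3)[OF e[OF j]] scale[OF e[of "j - 1"]] T0 by (cases "inK d1 d2 (j - 1)") auto
  qed
  then show ?thesis by blast
qed

text \<open>Weight vectors of different weights live on different antidiagonals \<open>k + m = const\<close>, so at
  each position \<open>(k, m)\<close> at most one index \<open>J k m\<close> contributes to the image of a vector.\<close>
lemma family_imp_hilbert_submodule:
  assumes fam: "module_family d1 d2 c1 c2 c U" and j0: "inK d1 d2 j0"
  shows "hilbert_submodule d1 d2 c1 c2 c"
proof -
  note fam' = fam[unfolded module_family_def, rule_format]
  have HT: "U j \<in> HT c1 c2 c" and FS: "U j \<in> FS c1 c2 c" if "inK d1 d2 j" for j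
    using fam'[OF that] by (auto simp: HT_def)
  have wt: "Hcoef d1 d2 j = c1 - c2 + of_real c + 2 * of_int (k + m)" if "inK d1 d2 j" "U j k m \<noteq> 0" for j k m
    using fam'[OF that(1)] tH_apply[OF FS[OF that(1)], of k m] that(2) by (auto simp: fun_eq_iff)
  obtain k0 m0 where km0: "U j0 k0 m0 \<noteq> 0" using fam'[OF j0] by (auto simp: fun_eq_iff)
  define J where "J k m = j0 + (k + m) - (k0 + m0)" for k m
  have J: "j = J k m" if "inK d1 d2 j" "U j k m \<noteq> 0" for j k m
  proof -
    have "Hcoef d1 d2 j - Hcoef d1 d2 j0 = 2 * of_int (k + m) - 2 * of_int (k0 + m0)"
      unfolding wt[OF that] wt[OF j0 km0] by simp
    then have "of_int (2 * (j - j0)) = (of_int (2 * ((k + m) - (k0 + m0))) :: complex)"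
      by (simp add: Hcoef_def algebra_simps)
    then have "2 * (j - j0) = 2 * ((k + m) - (k0 + m0))" by (simp only: of_int_eq_iff)
    then show ?thesis by (simp add: J_def)
  qed
  have Jshift: "J (k - 1) m = J k m - 1" "J k (m - 1) = J k m - 1" "J (k + 1) m = J k m + 1" "J k (m + 1) = J k m + 1" for k m
    by (auto simp: J_def)
  define T where "T v = (\<lambda>k m. v (J k m) * U (J k m) k m)" for v :: "int \<Rightarrow> complex"
  have supp: "inK d1 d2 j" if "v \<in> Nvec d1 d2" "v j \<noteq> 0" for v j using that by (auto simp: Nvec_def)
  have TFS: "T v \<in> FS c1 c2 c" if v: "v \<in> Nvec d1 d2" for v
    using FS supp[OF v] unfolding FS_def T_def by auto
  have THT: "T v \<in> HT c1 c2 c" if v: "v \<in> Nvec d1 d2" for v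
  proof -
    define I where "I = {j. v j \<noteq> 0}"
    have I: "finite I" "\<And>j. j \<in> I \<Longrightarrow> inK d1 d2 j" using v by (auto simp: I_def Nvec_def)
    let ?f = "\<lambda>j. \<lambda>(k, m). (cmod (v j))\<^sup>2 * ((cmod (U j k m))\<^sup>2 * w1 c1 c2 k * w2 c m)"
    have "?f j summable_on UNIV" if "j \<in> I" for j
    proof -
      have "(\<lambda>(k, m). (cmod (U j k m))\<^sup>2 * w1 c1 c2 k * w2 c m) summable_on UNIV"
        using HT[OF I(2)[OF that]] by (simp add: HT_def)
      from summable_on_cmult_right[OF this, of "(cmod (v j))\<^sup>2"] show ?thesis
        by (simp add: case_prod_unfold)
    qed
    then have "(\<lambda>x. \<Sum>j\<in>I. ?f j x) summable_on UNIV" by (rule summable_on_finite_sum[OF I(1)])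
    moreover have "(\<Sum>j\<in>I. ?f j (k, m)) = (cmod (T v k m))\<^sup>2 * w1 c1 c2 k * w2 c m" for k m
    proof -
      have "(\<Sum>j\<in>I. ?f j (k, m)) = (\<Sum>j\<in>I. if j = J k m then (cmod (T v k m))\<^sup>2 * w1 c1 c2 k * w2 c m else 0)"
        using J[OF I(2)] by (intro sum.cong) (auto simp: T_def norm_mult power_mult_distrib)
      then show ?thesis using I(1) by (auto simp: I_def T_def)
    qed
    then have "(\<lambda>x. \<Sum>j\<in>I. ?f j x) = (\<lambda>(k, m). (cmod (T v k m))\<^sup>2 * w1 c1 c2 k * w2 c m)"
      by (auto simp: fun_eq_iff)
    ultimately show ?thesis using TFS[OF v] by (simp add: HT_def)
  qed
  show ?thesis
    unfolding hilbert_submodule_def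
  proof (rule exI[of _ T], intro conjI ballI allI)
    show "T v \<in> HT c1 c2 c" if "v \<in> Nvec d1 d2" for v by (rule THT[OF that])
    show "inj_on T (Nvec d1 d2)"
    proof (rule inj_onI, rule ext)
      fix v w j assume v: "v \<in> Nvec d1 d2" and w: "w \<in> Nvec d1 d2" and eq: "T v = T w"
      show "v j = w j"
      proof (cases "inK d1 d2 j")
        case True
        then obtain k m where km: "U j k m \<noteq> 0" using fam'[OF True] by (auto simp: fun_eq_iff)
        then have "J k m = j" using J[OF True] by simp
        then show ?thesis using fun_cong[OF fun_cong[OF eq, of k], of m] km by (simp add: T_def)
      next
        case False
        then show ?thesis using supp[OF v] supp[OF w] by metis
      qed
    qed
    show "T (\<lambda>k. v k + w k) = (\<lambda>k m. T v k m + T w k m)" for v w by (simp add: T_def distrib_right)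
    show "T (\<lambda>k. a * v k) = (\<lambda>k m. a * T v k m)" for v a by (simp add: T_def mult.assoc)
    fix v assume v: "v \<in> Nvec d1 d2"
    show "T (actH d1 d2 v) = tH c1 c2 c (T v)"
    proof (intro ext)
      fix k m
      show "T (actH d1 d2 v) k m = tH c1 c2 c (T v) k m"
        unfolding tH_apply[OF TFS[OF v]] using supp[OF v, of "J k m"] wt[of "J k m" k m]
        by (auto simp: T_def actH_def)
    qed
    show "T (actE d1 d2 v) = tE c1 c2 c (T v)"
    proof (intro ext)
      fix k m
      let ?i = "J k m - 1"
      have "tE c1 c2 c (T v) k m = v ?i * tE c1 c2 c (U ?i) k m"
        unfolding tE_apply T_def Jshift by (simp add: algebra_simps)
      also have "\<dots> = T (actE d1 d2 v) k m"
        using supp[OF v, of ?i] fam'[of ?i] by (cases "v ?i = 0") (auto simp: T_def actE_def)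
      finally show "T (actE d1 d2 v) k m = tE c1 c2 c (T v) k m" ..
    qed
    show "T (actF d1 d2 v) = tF c1 c2 c (T v)"
    proof (intro ext)
      fix k m
      let ?i = "J k m + 1"
      have "tF c1 c2 c (T v) k m = v ?i * tF c1 c2 c (U ?i) k m"
        unfolding tF_apply T_def Jshift by (simp add: algebra_simps)
      also have "\<dots> = T (actF d1 d2 v) k m"
        using supp[OF v, of ?i] fam'[of ?i] by (cases "v ?i = 0") (auto simp: T_def actF_def)
      finally show "T (actF d1 d2 v) k m = tF c1 c2 c (T v) k m" ..
    qed
  qed
qed

section \<open>The symmetry exchanging E and F\<close>

lemma inK_minus: "inK c1 c2 (- k) \<longleftrightarrow> inK c2 c1 k"
  by (auto simp: inK_def)

lemma Ecoef_minus: "Ecoef c1 c2 (- k) = Fcoef c2 c1 k"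
  by (auto simp: Ecoef_def Fcoef_def algebra_simps)

lemma Fcoef_minus: "Fcoef c1 c2 (- k) = Ecoef c2 c1 k"
  by (auto simp: Ecoef_def Fcoef_def algebra_simps)

lemma Hcoef_minus: "Hcoef c1 c2 (- k) = - Hcoef c2 c1 k"
  by (auto simp: Hcoef_def)

lemma minus_shift:
  "inK c1 c2 (1 - k) \<longleftrightarrow> inK c2 c1 (k - 1)" "inK c1 c2 (- k - 1) \<longleftrightarrow> inK c2 c1 (k + 1)"
  "Ecoef c1 c2 (1 - k) = Fcoef c2 c1 (k - 1)" "Ecoef c1 c2 (- k - 1) = Fcoef c2 c1 (k + 1)"
  "Fcoef c1 c2 (1 - k) = Ecoef c2 c1 (k - 1)" "Fcoef c1 c2 (- k - 1) = Ecoef c2 c1 (k + 1)"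
  using inK_minus[of c1 c2 "k - 1"] inK_minus[of c1 c2 "k + 1"]
    Ecoef_minus[of c1 c2 "k - 1"] Ecoef_minus[of c1 c2 "k + 1"]
    Fcoef_minus[of c1 c2 "k - 1"] Fcoef_minus[of c1 c2 "k + 1"] by simp_all

lemma inK_0_neg: "a < 0 \<Longrightarrow> inK 0 (of_real a) k \<longleftrightarrow> 0 \<le> k"
  by (auto simp: inK_def)

lemma inK_neg_0: "a < 0 \<Longrightarrow> inK (of_real a) 0 k \<longleftrightarrow> k \<le> 0"
  by (auto simp: inK_def)

lemma negint_of_real: "a < 0 \<Longrightarrow> negint (of_real a) \<longleftrightarrow> a \<in> \<int>"
  by (simp add: negint_def)

text \<open>This makes the exchange of the two tensor factors norm preserving.\<close>

lemma w1_0_eq_w2: 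
  assumes "a < 0" "k \<ge> 0"
  shows "w1 0 (of_real a) k = w2 a (- k)"
proof -
  have "(\<Prod>j\<in>{1..nat k}. (of_nat j + (0::complex)) / (of_nat j - 1 - cnj (of_real a)))
      = of_real (fact (nat k) / (\<Prod>j\<in>{1..nat k}. real j - 1 - a))"
    by (simp add: prod_dividef fact_prod)
  moreover have "fact (nat k) * (\<Prod>j\<in>{1..nat k}. of_nat j - 1 - (of_real a :: complex))
      = of_real (fact (nat k) * (\<Prod>j\<in>{1..nat k}. real j - 1 - a))" by simp
  ultimately show ?thesis using assms
    by (auto simp: w1_def w2_def Let_def negint_of_real simp del: of_real_prod of_real_mult of_real_divide)
qed

text \<open>The Chevalley involution \<open>E \<leftrightarrow> F\<close>, \<open>H \<mapsto> -H\<close> exchanges \<open>N(c\<^sub>1,c\<^sub>2)\<close> and \<open>N(c\<^sub>2,c\<^sub>1)\<close> via \<open>x(k) \<mapsto> x(-k)\<close>.\<close>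
lemma hilbert_submodule_swap:
  assumes ab: "a < 0" "b < 0" and j0: "inK d1 d2 j0" and hs: "hilbert_submodule d1 d2 0 (of_real a) b"
  shows "hilbert_submodule d2 d1 0 (of_real b) a"
proof -
  obtain U where U: "module_family d1 d2 0 (of_real a) b U" using hilbert_submodule_imp_family[OF hs] by blast
  note U' = U[unfolded module_family_def, rule_format]
  \<comment> \<open>Both indices change sign and the factors trade places, so that the lowest weight
    factor again comes first.\<close>
  define sw :: "(int \<Rightarrow> int \<Rightarrow> complex) \<Rightarrow> int \<Rightarrow> int \<Rightarrow> complex" where "sw u = (\<lambda>k m. u (- m) (- k))" for u
  have swFS: "sw u \<in> FS 0 (of_real b) a" if "u \<in> FS 0 (of_real a) b" for u
  proof -
    have "0 \<le> k \<and> m \<le> 0" if "u (- m) (- k) \<noteq> 0" for k m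
    proof -
      have "inK 0 (of_real a) (- m) \<and> inK (of_real b) 0 (- k)"
        using \<open>u \<in> FS 0 (of_real a) b\<close> that unfolding FS_def by blast
      then show ?thesis using ab by (simp add: inK_0_neg inK_neg_0)
    qed
    then show ?thesis using ab by (simp add: FS_def sw_def inK_0_neg inK_neg_0)
  qed
  have swHT: "sw u \<in> HT 0 (of_real b) a" if u: "u \<in> HT 0 (of_real a) b" for u
  proof -
    have fs: "u \<in> FS 0 (of_real a) b" using u by (simp add: HT_def)
    have "(\<lambda>(k, m). (cmod (u k m))\<^sup>2 * w1 0 (of_real a) k * w2 b m) summable_on UNIV" using u by (simp add: HT_def)
    moreover have "bij_betw (\<lambda>(k, m). (- m, - k)) (UNIV :: (int \<times> int) set) UNIV"
      by (rule bij_betwI[where g = "\<lambda>(k, m). (- m, - k)"]) auto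
    ultimately have "(\<lambda>x. (\<lambda>(k, m). (cmod (u k m))\<^sup>2 * w1 0 (of_real a) k * w2 b m) ((\<lambda>(k, m). (- m, - k)) x)) summable_on UNIV"
      by (subst summable_on_reindex_bij_betw)
    moreover have "(\<lambda>(k, m). (cmod (u k m))\<^sup>2 * w1 0 (of_real a) k * w2 b m) ((\<lambda>(k, m). (- m, - k)) x)
        = (\<lambda>(k, m). (cmod (sw u k m))\<^sup>2 * w1 0 (of_real b) k * w2 a m) x" for x
    proof (cases x)
      case (Pair k m)
      show ?thesis
      proof (cases "u (- m) (- k) = 0")
        case False
        then have "m \<le> 0" "k \<ge> 0" using swFS[OF fs] ab unfolding FS_def
          by (auto simp: inK_0_neg inK_neg_0 sw_def)
        then show ?thesis using ab by (simp add: Pair sw_def w1_0_eq_w2)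
      qed (simp add: Pair sw_def)
    qed
    ultimately show ?thesis using swFS[OF fs] by (simp add: HT_def)
  qed
  have swE: "tE 0 (of_real b) a (sw u) = sw (tF 0 (of_real a) b u)" for u
    by (intro ext) (simp add: tE_apply tF_apply sw_def inK_minus minus_shift)
  have swF: "tF 0 (of_real b) a (sw u) = sw (tE 0 (of_real a) b u)" for u
    by (intro ext) (simp add: tE_apply tF_apply sw_def inK_minus minus_shift)
  have "module_family d2 d1 0 (of_real b) a (\<lambda>j. sw (U (- j)))"
    unfolding module_family_def
  proof (intro allI impI conjI)
    fix j assume "inK d2 d1 j"
    then have j: "inK d1 d2 (- j)" by (simp add: inK_minus)
    note Uj = U'[OF j]
    show "sw (U (- j)) \<in> HT 0 (of_real b) a" using Uj swHT by blast
    then have fs: "sw (U (- j)) \<in> FS 0 (of_real b) a" "U (- j) \<in> FS 0 (of_real a) b" using Uj by (auto simp: HT_def)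
    obtain k m where "U (- j) k m \<noteq> 0" using Uj by (auto simp: fun_eq_iff)
    then have "sw (U (- j)) (- m) (- k) \<noteq> 0" by (simp add: sw_def)
    then show "sw (U (- j)) \<noteq> (\<lambda>k m. 0)" by (auto simp: fun_eq_iff)
    show "tH 0 (of_real b) a (sw (U (- j))) = (\<lambda>k m. Hcoef d2 d1 j * sw (U (- j)) k m)"
    proof (intro ext)
      fix k m
      have "tH 0 (of_real a) b (U (- j)) (- m) (- k) = Hcoef d1 d2 (- j) * U (- j) (- m) (- k)"
        using Uj by (simp add: fun_eq_iff)
      then show "tH 0 (of_real b) a (sw (U (- j))) k m = Hcoef d2 d1 j * sw (U (- j)) k m"
        unfolding tH_apply[OF fs(1)] tH_apply[OF fs(2)] Hcoef_minus by (simp add: sw_def algebra_simps) 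
    qed
    have m1: "- j - 1 = - (j + 1)" "- j + 1 = - (j - 1)" by simp_all
    show "tE 0 (of_real b) a (sw (U (- j))) = (\<lambda>k m. if inK d2 d1 (j + 1) then Ecoef d2 d1 j * sw (U (- (j + 1))) k m else 0)"
      unfolding swE using Uj unfolding m1 inK_minus Fcoef_minus by (simp add: sw_def fun_eq_iff)
    show "tF 0 (of_real b) a (sw (U (- j))) = (\<lambda>k m. if inK d2 d1 (j - 1) then Fcoef d2 d1 j * sw (U (- (j - 1))) k m else 0)"
      unfolding swF using Uj unfolding m1 inK_minus Ecoef_minus by (simp add: sw_def fun_eq_iff)
  qed
  moreover have "inK d2 d1 (- j0)" using j0 by (simp add: inK_minus)
  ultimately show ?thesis by (rule family_imp_hilbert_submodule)
qed


section \<open>The normal form\<close>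

text \<open>Rescaling \<open>x(k)\<close> by \<open>rescale\<close> turns the type II and III modules at a negative integer parameter into
  the type I formulas.\<close>
definition rescale :: "complex \<Rightarrow> nat \<Rightarrow> complex" where
  "rescale z n = (if negint z then (\<Prod>i<n. z - of_nat i) else 1)"

lemma rescale_nonzero: "rescale z n \<noteq> 0"
proof -
  have "z - of_nat i \<noteq> 0" if "Re z < 0" for i
    using that by (auto simp: complex_eq_iff)
  then show ?thesis by (auto simp: rescale_def negint_def)
qed

lemma not_negint_0: "\<not> negint 0" by (simp add: negint_def)

lemma rescale_Ecoef: "Ecoef z 0 (- int l - 1) * rescale z l = (of_nat l + 1) * rescale z (Suc l)"
  by (auto simp: Ecoef_def not_negint_0 rescale_def)

lemma rescale_Fcoef: "Fcoef z 0 (- int l) * rescale z (Suc l) = (z - of_nat l) * rescale z l"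
  by (auto simp: Fcoef_def not_negint_0 rescale_def)

definition normal_form :: "complex \<Rightarrow> real \<Rightarrow> (int \<Rightarrow> int \<Rightarrow> complex) \<Rightarrow> int \<Rightarrow> nat \<Rightarrow> complex" where
  "normal_form c2 c u = (\<lambda>k l. u k (- int l) * rescale c2 (nat k) * rescale (of_real c) l)"

text \<open>The type I actions in the coordinates \<open>R k l\<close> of \<open>x(k) \<otimes> y(l)\<close>.\<close>
definition nE :: "complex \<Rightarrow> (int \<Rightarrow> nat \<Rightarrow> complex) \<Rightarrow> int \<Rightarrow> nat \<Rightarrow> complex" where
  "nE c2 R = (\<lambda>k l. (c2 - of_int k + 1) * R (k - 1) l + (of_nat l + 1) * R k (Suc l))"

definition nF :: "complex \<Rightarrow> real \<Rightarrow> (int \<Rightarrow> nat \<Rightarrow> complex) \<Rightarrow> int \<Rightarrow> nat \<Rightarrow> complex" where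
  "nF c1 c R = (\<lambda>k l. (c1 + of_int k + 1) * R (k + 1) l + (if l = 0 then 0 else (of_real c - of_nat l + 1) * R k (l - 1)))"

text \<open>Squared norms of the rescaled basis vectors: \<open>normal_form\<close> multiplies
  coefficients by \<open>rescale\<close>, so the basis vectors are divided by it.\<close>

definition om1 :: "complex \<Rightarrow> complex \<Rightarrow> int \<Rightarrow> real" where
  "om1 c1 c2 k = w1 c1 c2 k / (cmod (rescale c2 (nat k)))\<^sup>2"

definition om2 :: "real \<Rightarrow> nat \<Rightarrow> real" where
  "om2 c l = w2 c (- int l) / (cmod (rescale (of_real c) l))\<^sup>2"

lemma om2_0: "om2 c 0 = 1"
  by (simp add: om2_def w2_def rescale_def Let_def)

text \<open>For integral \<open>c\<close> the norm is a factorial times a product, and dividing by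
  the square of the rescaling factor turns it into the factorial over that product, which is the
  norm for nonintegral \<open>c\<close>. Both cases thus share one recurrence.\<close>

lemma om2_step:
  assumes "c < 0"
  shows "om2 c (Suc l) * (real l - c) = om2 c l * (real l + 1)"
proof -
  show ?thesis
  proof (cases "c \<in> \<int>")
    case True
    have "complex_of_real c - of_nat l = of_real (c - real l)" by simp
    then have "cmod (complex_of_real c - of_nat l) = real l - c" using assms by (simp only: norm_of_real)
    then have r: "cmod (rescale (of_real c) (Suc l)) = cmod (rescale (of_real c) l) * (real l - c)"
      using True assms by (simp add: rescale_def negint_of_real norm_mult del: of_real_of_nat_eq)
    have w: "w2 c (- int (Suc l)) = w2 c (- int l) * (real l + 1) * (real l - c)"
      using True by (simp add: w2_def Let_def nat_add_distrib algebra_simps)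
    have "W * a * b / (r * b)\<^sup>2 * b = W / r\<^sup>2 * a" if "r \<noteq> 0" "b \<noteq> 0" for W a b r :: real
      using that by (simp add: field_simps power2_eq_square)
    moreover have "cmod (rescale (of_real c) l) \<noteq> 0" "real l - c \<noteq> 0" using assms by (auto simp: rescale_nonzero)
    ultimately show ?thesis unfolding om2_def r w by blast
  next
    case False
    have w: "w2 c (- int (Suc l)) = w2 c (- int l) * (real l + 1) / (real l - c)"
      using False by (simp add: w2_def Let_def nat_add_distrib algebra_simps)
    then show ?thesis using assms False unfolding om2_def w by (simp add: rescale_def negint_of_real)
  qed
qed

lemma om2_pos:
  assumes "c < 0" shows "om2 c l > 0"
proof (induction l)
  case (Suc l)
  have "om2 c (Suc l) = om2 c l * (real l + 1) / (real l - c)"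
    using om2_step[OF assms, of l] assms by (simp add: field_simps)
  then show ?case using Suc assms by simp
qed (simp add: om2_0)

text \<open>Common interface to the three kinds of first factor. \<open>\<delta>\<close> and
  \<open>g\<close> encode its weights and its Casimir eigenvalue; they are real even when
  \<open>c1\<close> and \<open>c2\<close> are not. \<open>w1_step\<close> is unitarity, that is,
  \<open>- F\<close> is adjoint to \<open>E\<close>: the factor on its right-hand side equals
  \<open>(c1 + k + 1) * (k - c2)\<close>, the scalar by which \<open>- F E\<close> acts on
  x(k).\<close>

locale tensor_setup =
  fixes c1 c2 :: complex and c \<delta> g :: real
  assumes c: "c < 0"
    and \<delta>: "c1 - c2 = of_real \<delta>"
    and g: "((c1 + c2 + 1) / 2)\<^sup>2 = of_real g"
    and cases: "c1 = 0 \<and> c2 \<in> \<real> \<and> Re c2 < 0 \<or> c1 \<notin> \<int> \<and> c2 \<notin> \<int>"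
    and w1_pos: "inK c1 c2 k \<Longrightarrow> w1 c1 c2 k > 0"
    and w1_step: "inK c1 c2 k \<Longrightarrow>
      om1 c1 c2 (k + 1) * (cmod (c2 - of_int k))\<^sup>2 = om1 c1 c2 k * ((of_int k + (1 + \<delta>) / 2)\<^sup>2 - g)"
begin

definition A :: "int \<Rightarrow> real" where "A k = (of_int k + (1 + \<delta>) / 2)\<^sup>2 - g"

abbreviation "K \<equiv> inK c1 c2"
abbreviation "\<omega> \<equiv> om1 c1 c2"

lemma K_iff: "K k \<longleftrightarrow> (c1 = 0 \<longrightarrow> 0 \<le> k)"
proof -
  have "c2 \<in> \<int> \<longrightarrow> (Re c2 - of_int k < 0 \<longleftrightarrow> Re c2 < 0)" if "c1 = 0" "0 \<le> k" using cases that by auto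
  then show ?thesis using cases by (auto simp: inK_def)
qed

lemma K_add: "K k \<Longrightarrow> n \<ge> 0 \<Longrightarrow> K (k + n)" by (auto simp: K_iff)

lemma c2_neq: "K k \<Longrightarrow> c2 - of_int k \<noteq> 0"
proof
  assume k: "K k" and "c2 - of_int k = 0"
  then have e: "c2 = of_int k" by simp
  with cases have "c1 = 0" "Re c2 < 0" by auto
  with e k[unfolded K_iff] show False by simp
qed

lemma c1_neq: "K k \<Longrightarrow> c1 + of_int k + 1 \<noteq> 0"
proof
  assume k: "K k" and "c1 + of_int k + 1 = 0"
  then have e: "c1 = of_int (- k - 1)" by (simp add: algebra_simps eq_neg_iff_add_eq_0)
  with cases have "c1 = 0" by auto
  with e have "of_int (- k - 1) = (0 :: complex)" by metis
  then have "- k - 1 = 0" by (simp only: of_int_eq_0_iff)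
  with \<open>c1 = 0\<close> k[unfolded K_iff] show False by simp
qed

lemma A_eq: "of_real (A k) = (c1 + of_int k + 1) * (of_int k - c2)"
proof -
  have "of_real (A k) = (of_int k + (1 + (c1 - c2)) / 2)\<^sup>2 - ((c1 + c2 + 1) / 2)\<^sup>2"
    unfolding \<delta> g by (simp add: A_def)
  also have "\<dots> = ((of_int k + (1 + (c1 - c2)) / 2) + (c1 + c2 + 1) / 2) * ((of_int k + (1 + (c1 - c2)) / 2) - (c1 + c2 + 1) / 2)"
    by (simp only: power2_eq_square square_diff_square_factored)
  also have "(of_int k + (1 + (c1 - c2)) / 2) + (c1 + c2 + 1) / 2 = c1 + of_int k + 1" by (simp add: field_simps)
  also have "(of_int k + (1 + (c1 - c2)) / 2) - (c1 + c2 + 1) / 2 = of_int k - c2" by (simp add: field_simps)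
  finally show ?thesis .
qed

lemma rescale_pos_sq: "(cmod (rescale z n))\<^sup>2 > 0" using rescale_nonzero by simp

lemma \<omega>_pos: "K k \<Longrightarrow> \<omega> k > 0"
  using w1_pos by (simp add: om1_def rescale_pos_sq rescale_nonzero)

lemma \<omega>_step: "K k \<Longrightarrow> \<omega> (k + 1) * (cmod (c2 - of_int k))\<^sup>2 = \<omega> k * A k"
  using w1_step by (simp add: A_def)

text \<open>Positivity is inherited from the norms through \<open>\<omega>_step\<close>, which
  avoids a case distinction on the parameters.\<close>

lemma A_pos: assumes "K k" shows "A k > 0"
proof -
  have "\<omega> (k + 1) * (cmod (c2 - of_int k))\<^sup>2 > 0"
    using \<omega>_pos[OF K_add[OF assms, of 1]] c2_neq[OF assms] by simp
  then show ?thesis unfolding \<omega>_step[OF assms] using \<omega>_pos[OF assms] by (simp add: zero_less_mult_iff)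
qed

lemma E1_rescale: "K (k - 1) \<Longrightarrow> Ecoef c1 c2 (k - 1) * rescale c2 (nat k) = (c2 - of_int k + 1) * rescale c2 (nat (k - 1))"
proof -
  assume k: "K (k - 1)"
  have "\<not> negint c1" using cases by (auto simp: negint_def)
  moreover have "nat k = Suc (nat (k - 1))" "of_nat (nat (k - 1)) = (of_int k - 1 :: complex)" if "negint c2"
  proof -
    have "c1 = 0" using that cases by (auto simp: negint_def)
    then have "k \<ge> 1" using k[unfolded K_iff] by simp
    then show "nat k = Suc (nat (k - 1))" "of_nat (nat (k - 1)) = (of_int k - 1 :: complex)"
      by (auto simp: of_nat_nat)
  qed
  ultimately show ?thesis by (cases "negint c2") (auto simp: Ecoef_def rescale_def algebra_simps)
qed

lemma F1_rescale: "K k \<Longrightarrow> Fcoef c1 c2 (k + 1) * rescale c2 (nat k) = (c1 + of_int k + 1) * rescale c2 (nat (k + 1))"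
proof -
  assume k: "K k"
  have "\<not> negint c1" using cases by (auto simp: negint_def)
  moreover have "nat (k + 1) = Suc (nat k)" "of_nat (nat k) = (of_int k :: complex)" if "negint c2"
  proof -
    have "c1 = 0" using that cases by (auto simp: negint_def)
    then have "k \<ge> 0" using k[unfolded K_iff] by simp
    then show "nat (k + 1) = Suc (nat k)" "of_nat (nat k) = (of_int k :: complex)"
      by (auto simp: of_nat_nat nat_add_distrib)
  qed
  ultimately show ?thesis by (cases "negint c2") (auto simp: Fcoef_def rescale_def algebra_simps)
qed

lemma FS_zero: "u \<in> FS c1 c2 c \<Longrightarrow> \<not> K k \<Longrightarrow> u k m = 0"
  by (auto simp: FS_def)

lemma FS_zero_pos: "u \<in> FS c1 c2 c \<Longrightarrow> m > 0 \<Longrightarrow> u k m = 0"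
  using c by (force simp: FS_def inK_neg_0)

lemma normal_form_tE:
  assumes u: "u \<in> FS c1 c2 c"
  shows "normal_form c2 c (tE c1 c2 c u) = nE c2 (normal_form c2 c u)"
proof (intro ext)
  fix k l
  show "normal_form c2 c (tE c1 c2 c u) k l = nE c2 (normal_form c2 c u) k l"
  proof (cases "K k")
    case True
    have "(if K k \<and> K (k - 1) then Ecoef c1 c2 (k - 1) else 0) * u (k - 1) (- int l) * rescale c2 (nat k)
       = (c2 - of_int k + 1) * (u (k - 1) (- int l) * rescale c2 (nat (k - 1)))"
      using True E1_rescale[of k] FS_zero[OF u, of "k - 1"] by (auto simp: mult_ac)
    moreover have "(if inK (of_real c) 0 (- int l) \<and> inK (of_real c) 0 (- int l - 1) then Ecoef (of_real c) 0 (- int l - 1) else 0)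
          * u k (- int l - 1) * rescale (of_real c) l
        = (of_nat l + 1) * (u k (- int (Suc l)) * rescale (of_real c) (Suc l))"
    proof -
      have e: "- int (Suc l) = - int l - 1" by simp
      have k: "inK (of_real c) 0 (- int l) \<and> inK (of_real c) 0 (- int l - 1)" using c by (simp add: inK_neg_0)
      have "Ecoef (of_real c) 0 (- int l - 1) * u k (- int l - 1) * rescale (of_real c) l
          = Ecoef (of_real c) 0 (- int l - 1) * rescale (of_real c) l * u k (- int l - 1)" by (simp only: mult_ac)
      then show ?thesis unfolding rescale_Ecoef e if_P[OF k] by (simp only: mult_ac)
    qed
    moreover have "(X1 * u1 + X2 * u2) * rk * rl = X1 * u1 * rk * rl + X2 * u2 * rl * rk" for X1 u1 X2 u2 rk rl :: complex
      by (simp add: algebra_simps)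
    moreover have "a * (x * p) * rl + b * (y * q) * rk = a * (x * p * rl) + b * (y * rk * q)" for a x p rl b y q rk :: complex
      by simp
    ultimately show ?thesis unfolding normal_form_def nE_def tE_apply by (simp only:)
  next
    case False
    then have "\<not> K (k - 1)" unfolding K_iff by auto
    with False show ?thesis by (simp add: normal_form_def tE_apply nE_def FS_zero[OF u])
  qed
qed

lemma normal_form_tF:
  assumes u: "u \<in> FS c1 c2 c"
  shows "normal_form c2 c (tF c1 c2 c u) = nF c1 c (normal_form c2 c u)"
proof (intro ext)
  fix k l
  show "normal_form c2 c (tF c1 c2 c u) k l = nF c1 c (normal_form c2 c u) k l"
  proof (cases "K k")
    case True
    have "(if K k \<and> K (k + 1) then Fcoef c1 c2 (k + 1) else 0) * u (k + 1) (- int l) * rescale c2 (nat k)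
       = (c1 + of_int k + 1) * (u (k + 1) (- int l) * rescale c2 (nat (k + 1)))"
      using True F1_rescale[OF True] K_add[OF True, of 1] by (auto simp: mult_ac)
    moreover have "(if inK (of_real c) 0 (- int l) \<and> inK (of_real c) 0 (- int l + 1) then Fcoef (of_real c) 0 (- int l + 1) else 0) *
          u k (- int l + 1) * rescale (of_real c) l
        = (if l = 0 then 0 else (of_real c - of_nat l + 1) * (u k (- int (l - 1)) * rescale (of_real c) (l - 1)))"
    proof (cases l)
      case 0
      then show ?thesis using c by (simp add: inK_neg_0)
    next
      case (Suc l')
      have e: "- int (Suc l') + 1 = - int l'" by simp
      show ?thesis unfolding Suc e using c
        using rescale_Fcoef[of "of_real c" l']
        by (simp add: inK_neg_0 mult_ac del: int_Suc)
    qed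
    moreover have "(X1 * u1 + X2 * u2) * rk * rl = X1 * u1 * rk * rl + X2 * u2 * rl * rk" for X1 u1 X2 u2 rk rl :: complex
      by (simp add: algebra_simps)
    moreover have "(a * (x * p)) * rl + (if l = 0 then 0 else b * (y * ry)) * rk
        = a * (x * p * rl) + (if l = 0 then 0 else b * (y * rk * ry))" for a x p rk rl b y ry :: complex by simp
    ultimately show ?thesis unfolding normal_form_def nF_def tF_apply by (simp only:)
  next
    case False
    \<comment> \<open>An index outside \<open>K\<close> has its successor inside \<open>K\<close>
      only for \<open>k = -1\<close>, and there the coefficient \<open>c1 + k + 1\<close> vanishes;
      so the untruncated formula of \<open>nF\<close> agrees with the action.\<close>
    then have "k + 1 \<le> 0" "c1 = 0" by (auto simp: K_iff)
    then have "(c1 + of_int k + 1) * u (k + 1) m = 0" for m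
    proof (cases "k + 1 = 0")
      case True
      then have "of_int (k + 1) = (0::complex)" by simp
      then show ?thesis using \<open>c1 = 0\<close> by simp
    next
      case nz: False
      then have "\<not> K (k + 1)" using \<open>k + 1 \<le> 0\<close> \<open>c1 = 0\<close> unfolding K_iff by auto
      then show ?thesis by (simp add: FS_zero[OF u])
    qed
    from this[of "- int l"] this[of 0] False show ?thesis
      by (auto simp: normal_form_def tF_apply nF_def FS_zero[OF u])
  qed
qed

definition nHT :: "(int \<Rightarrow> nat \<Rightarrow> complex) set" where
  "nHT = {R. (\<forall>k l. R k l \<noteq> 0 \<longrightarrow> K k) \<and> (\<lambda>(k, l). (cmod (R k l))\<^sup>2 * \<omega> k * om2 c l) summable_on UNIV}"

definition denormalize :: "(int \<Rightarrow> nat \<Rightarrow> complex) \<Rightarrow> int \<Rightarrow> int \<Rightarrow> complex" where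
  "denormalize R = (\<lambda>k m. if m \<le> 0 then R k (nat (- m)) / (rescale c2 (nat k) * rescale (of_real c) (nat (- m))) else 0)"

lemma normal_form_denormalize: "normal_form c2 c (denormalize R) = R"
  by (intro ext) (simp add: normal_form_def denormalize_def rescale_nonzero)

lemma denormalize_FS: "(\<And>k l. R k l \<noteq> 0 \<Longrightarrow> K k) \<Longrightarrow> denormalize R \<in> FS c1 c2 c"
  using c by (auto simp: FS_def denormalize_def inK_neg_0 split: if_splits)

lemma normal_form_inj:
  assumes "u \<in> FS c1 c2 c" "v \<in> FS c1 c2 c" "normal_form c2 c u = normal_form c2 c v"
  shows "u = v"
proof (intro ext)
  fix k m
  show "u k m = v k m"
  proof (cases "m \<le> 0")
    case True
    have "normal_form c2 c u k (nat (- m)) = normal_form c2 c v k (nat (- m))" using assms(3) by simp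
    then show ?thesis using True by (simp add: normal_form_def rescale_nonzero)
  next
    case False
    then show ?thesis using assms(1,2) by (simp add: FS_zero_pos)
  qed
qed

lemma HT_iff_normalize:
  assumes u: "u \<in> FS c1 c2 c"
  shows "u \<in> HT c1 c2 c \<longleftrightarrow> normal_form c2 c u \<in> nHT"
proof -
  let ?f = "\<lambda>(k, m). (cmod (u k m))\<^sup>2 * w1 c1 c2 k * w2 c m"
  let ?h = "\<lambda>(k, l). (k, - int l)"
  have inj: "inj_on ?h (UNIV :: (int \<times> nat) set)" by (auto simp: inj_on_def)
  have "u \<in> HT c1 c2 c \<longleftrightarrow> ?f summable_on UNIV" using u by (simp add: HT_def)
  also have "\<dots> \<longleftrightarrow> ?f summable_on (?h ` UNIV)"
  proof (rule summable_on_cong_neutral)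
    fix x :: "int \<times> int" assume x: "x \<in> UNIV - range ?h"
    obtain k m where km: "x = (k, m)" by (cases x)
    have "m > 0"
    proof (rule ccontr)
      assume "\<not> m > 0"
      then have "x = ?h (k, nat (- m))" by (simp add: km)
      then show False using x by blast
    qed
    then show "?f x = 0" using FS_zero_pos[OF u] km by simp
  qed auto
  also have "\<dots> \<longleftrightarrow> (?f \<circ> ?h) summable_on UNIV" by (rule summable_on_reindex[OF inj])
  also have "?f \<circ> ?h = (\<lambda>(k, l). (cmod (normal_form c2 c u k l))\<^sup>2 * \<omega> k * om2 c l)"
    by (auto simp: fun_eq_iff normal_form_def om1_def om2_def norm_mult power_mult_distrib rescale_nonzero)
  also have "\<dots> summable_on UNIV \<longleftrightarrow> normal_form c2 c u \<in> nHT"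
    using FS_zero[OF u] by (auto simp: nHT_def normal_form_def)
  finally show ?thesis .
qed

definition normal_family :: "complex \<Rightarrow> complex \<Rightarrow> (int \<Rightarrow> int \<Rightarrow> nat \<Rightarrow> complex) \<Rightarrow> bool" where
  "normal_family d1 d2 R \<longleftrightarrow> (\<forall>j. inK d1 d2 j \<longrightarrow>
     R j \<in> nHT \<and> (\<exists>k l. R j k l \<noteq> 0) \<and>
     (\<forall>k l. R j k l \<noteq> 0 \<longrightarrow> Hcoef d1 d2 j = of_real (\<delta> + c + 2 * of_int (k - int l))) \<and>
     nE c2 (R j) = (\<lambda>k l. if inK d1 d2 (j + 1) then Ecoef d1 d2 j * R (j + 1) k l else 0) \<and>
     nF c1 c (R j) = (\<lambda>k l. if inK d1 d2 (j - 1) then Fcoef d1 d2 j * R (j - 1) k l else 0))"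

lemma wt_eq: "c1 - c2 + of_real c + 2 * of_int (k + - int l) = of_real (\<delta> + c + 2 * of_int (k - int l))"
  by (simp add: \<delta>)

lemma hilbert_submodule_imp_normal_family:
  assumes "hilbert_submodule d1 d2 c1 c2 c"
  shows "\<exists>R. normal_family d1 d2 R"
proof -
  obtain U where "module_family d1 d2 c1 c2 c U" using hilbert_submodule_imp_family[OF assms] by blast
  note U = this[unfolded module_family_def, rule_format]
  have "normal_family d1 d2 (\<lambda>j. normal_form c2 c (U j))"
    unfolding normal_family_def
  proof (intro allI impI conjI)
    fix j assume j: "inK d1 d2 j"
    note Uj = U[OF j]
    have fs: "U j \<in> FS c1 c2 c" using Uj by (simp add: HT_def)
    show "normal_form c2 c (U j) \<in> nHT" using Uj HT_iff_normalize[OF fs] by simp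
    obtain k m where km: "U j k m \<noteq> 0" using Uj by (auto simp: fun_eq_iff)
    then have "m \<le> 0" using fs c by (auto simp: FS_def inK_neg_0)
    then have "normal_form c2 c (U j) k (nat (- m)) \<noteq> 0" using km by (simp add: normal_form_def rescale_nonzero)
    then show "\<exists>k l. normal_form c2 c (U j) k l \<noteq> 0" by blast
    show "Hcoef d1 d2 j = of_real (\<delta> + c + 2 * of_int (k - int l))" if "normal_form c2 c (U j) k l \<noteq> 0" for k l
    proof -
      have nz: "U j k (- int l) \<noteq> 0" using that by (auto simp: normal_form_def)
      have "tH c1 c2 c (U j) k (- int l) = Hcoef d1 d2 j * U j k (- int l)" using Uj by (simp add: fun_eq_iff)
      then show ?thesis unfolding tH_apply[OF fs] wt_eq using nz by simp
    qed
    show "nE c2 (normal_form c2 c (U j)) = (\<lambda>k l. if inK d1 d2 (j + 1) then Ecoef d1 d2 j * normal_form c2 c (U (j + 1)) k l else 0)"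
      unfolding normal_form_tE[OF fs, symmetric] using Uj by (simp add: fun_eq_iff normal_form_def)
    show "nF c1 c (normal_form c2 c (U j)) = (\<lambda>k l. if inK d1 d2 (j - 1) then Fcoef d1 d2 j * normal_form c2 c (U (j - 1)) k l else 0)"
      unfolding normal_form_tF[OF fs, symmetric] using Uj by (simp add: fun_eq_iff normal_form_def)
  qed
  then show ?thesis by blast
qed

lemma tE_FS: "u \<in> FS c1 c2 c \<Longrightarrow> tE c1 c2 c u \<in> FS c1 c2 c"
  by (auto simp: FS_def tE_apply split: if_splits)

lemma tF_FS: "u \<in> FS c1 c2 c \<Longrightarrow> tF c1 c2 c u \<in> FS c1 c2 c"
  by (auto simp: FS_def tF_apply split: if_splits)

lemma normal_family_imp_hilbert_submodule:
  assumes R: "normal_family d1 d2 R" and j0: "inK d1 d2 j0"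
  shows "hilbert_submodule d1 d2 c1 c2 c"
proof (rule family_imp_hilbert_submodule[OF _ j0])
  note R' = R[unfolded normal_family_def, rule_format]
  have supp: "R j k l \<noteq> 0 \<Longrightarrow> K k" if "inK d1 d2 j" for j k l using R'[OF that] by (auto simp: nHT_def)
  have fs: "denormalize (R j) \<in> FS c1 c2 c" if "inK d1 d2 j" for j by (rule denormalize_FS[OF supp[OF that]])
  show "module_family d1 d2 c1 c2 c (\<lambda>j. denormalize (R j))"
    unfolding module_family_def
  proof (intro allI impI conjI)
    fix j assume j: "inK d1 d2 j"
    note Rj = R'[OF j] and fsj = fs[OF j]
    show "denormalize (R j) \<in> HT c1 c2 c" using Rj by (simp add: HT_iff_normalize[OF fsj] normal_form_denormalize)
    show "denormalize (R j) \<noteq> (\<lambda>k m. 0)"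
    proof
      assume "denormalize (R j) = (\<lambda>k m. 0)"
      then have "normal_form c2 c (denormalize (R j)) = (\<lambda>k l. 0)" by (simp add: normal_form_def)
      then show False using Rj by (auto simp: normal_form_denormalize)
    qed
    show "tH c1 c2 c (denormalize (R j)) = (\<lambda>k m. Hcoef d1 d2 j * denormalize (R j) k m)"
    proof (intro ext)
      fix k m
      show "tH c1 c2 c (denormalize (R j)) k m = Hcoef d1 d2 j * denormalize (R j) k m"
      proof (cases "denormalize (R j) k m = 0")
        case False
        then have m: "m \<le> 0" "R j k (nat (- m)) \<noteq> 0" by (auto simp: denormalize_def split: if_splits)
        then have "Hcoef d1 d2 j = of_real (\<delta> + c + 2 * of_int (k - int (nat (- m))))" using Rj by blast
        also have "\<dots> = c1 - c2 + of_real c + 2 * of_int (k + m)" using m \<delta> by (simp add: nat_minus_as_int)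
        finally show ?thesis using tH_apply[OF fsj] by simp
      qed (simp add: tH_apply[OF fsj])
    qed
    show "tE c1 c2 c (denormalize (R j)) = (\<lambda>k m. if inK d1 d2 (j + 1) then Ecoef d1 d2 j * denormalize (R (j + 1)) k m else 0)"
    proof (rule normal_form_inj[OF tE_FS[OF fsj]])
      show "(\<lambda>k m. if inK d1 d2 (j + 1) then Ecoef d1 d2 j * denormalize (R (j + 1)) k m else 0) \<in> FS c1 c2 c"
        using fs[of "j + 1"] by (auto simp: FS_def)
      show "normal_form c2 c (tE c1 c2 c (denormalize (R j)))
        = normal_form c2 c (\<lambda>k m. if inK d1 d2 (j + 1) then Ecoef d1 d2 j * denormalize (R (j + 1)) k m else 0)"
      proof -
        have "normal_form c2 c (\<lambda>k m. if inK d1 d2 (j + 1) then Ecoef d1 d2 j * denormalize (R (j + 1)) k m else 0)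
          = (\<lambda>k l. if inK d1 d2 (j + 1) then Ecoef d1 d2 j * normal_form c2 c (denormalize (R (j + 1))) k l else 0)"
          by (simp add: fun_eq_iff normal_form_def)
        then show ?thesis unfolding normal_form_tE[OF fsj] normal_form_denormalize using Rj by simp
      qed
    qed
    show "tF c1 c2 c (denormalize (R j)) = (\<lambda>k m. if inK d1 d2 (j - 1) then Fcoef d1 d2 j * denormalize (R (j - 1)) k m else 0)"
    proof (rule normal_form_inj[OF tF_FS[OF fsj]])
      show "(\<lambda>k m. if inK d1 d2 (j - 1) then Fcoef d1 d2 j * denormalize (R (j - 1)) k m else 0) \<in> FS c1 c2 c"
        using fs[of "j - 1"] by (auto simp: FS_def)
      show "normal_form c2 c (tF c1 c2 c (denormalize (R j)))
        = normal_form c2 c (\<lambda>k m. if inK d1 d2 (j - 1) then Fcoef d1 d2 j * denormalize (R (j - 1)) k m else 0)"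
      proof -
        have "normal_form c2 c (\<lambda>k m. if inK d1 d2 (j - 1) then Fcoef d1 d2 j * denormalize (R (j - 1)) k m else 0)
          = (\<lambda>k l. if inK d1 d2 (j - 1) then Fcoef d1 d2 j * normal_form c2 c (denormalize (R (j - 1))) k l else 0)"
          by (simp add: fun_eq_iff normal_form_def)
        then show ?thesis unfolding normal_form_tF[OF fsj] normal_form_denormalize using Rj by simp
      qed
    qed
  qed
qed

text \<open>Weight vectors live on a single diagonal, so membership in \<open>nHT\<close> amounts to
  convergence of an ordinary series; \<open>summable_imp_nHT\<close> is the converse.\<close>

lemma nHT_imp_summable:
  assumes "R \<in> nHT"
  shows "summable (\<lambda>l. (cmod (R (n + int l) l))\<^sup>2 * \<omega> (n + int l) * om2 c l)"
proof -
  let ?f = "\<lambda>(k, l). (cmod (R k l))\<^sup>2 * \<omega> k * om2 c l"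
  let ?h = "\<lambda>l. (n + int l, l)"
  have "?f summable_on range ?h" using assms by (auto simp: nHT_def intro: summable_on_subset_banach)
  then have "(?f \<circ> ?h) summable_on UNIV" by (subst summable_on_reindex[symmetric]) (auto simp: inj_on_def)
  then show ?thesis by (auto dest!: summable_on_imp_summable simp: o_def)
qed

lemma summable_imp_nHT:
  assumes supp: "\<And>k l. R k l \<noteq> 0 \<Longrightarrow> K k \<and> k = n + int l"
    and sum: "summable (\<lambda>l. (cmod (R (n + int l) l))\<^sup>2 * \<omega> (n + int l) * om2 c l)"
  shows "R \<in> nHT"
proof -
  let ?f = "\<lambda>(k, l). (cmod (R k l))\<^sup>2 * \<omega> k * om2 c l"
  let ?h = "\<lambda>l. (n + int l, l)"
  have "(cmod (R (n + int l) l))\<^sup>2 * \<omega> (n + int l) * om2 c l \<ge> 0" for l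
    using supp[of "n + int l" l] \<omega>_pos[of "n + int l"] om2_pos[OF c, of l]
    by (cases "R (n + int l) l = 0") auto
  then have "(?f \<circ> ?h) summable_on UNIV" using sum by (simp add: summable_on_UNIV_nonneg_real_iff o_def)
  then have "?f summable_on range ?h" by (subst summable_on_reindex) (auto simp: inj_on_def)
  also have "?f summable_on range ?h \<longleftrightarrow> ?f summable_on UNIV"
  proof (rule summable_on_cong_neutral)
    fix x :: "int \<times> nat" assume x: "x \<in> UNIV - range ?h"
    obtain k l where kl: "x = (k, l)" by (cases x)
    then have "k \<noteq> n + int l" using x by auto
    then have "R k l = 0" using supp by blast
    then show "?f x = 0" by (simp add: kl)
  qed auto
  finally show ?thesis using supp by (auto simp: nHT_def)
qed

end


section \<open>Necessary conditions\<close>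

context tensor_setup begin

lemma \<omega>_om2_step:
  assumes "K (n + int l)"
  shows "\<omega> (n + int (Suc l)) * om2 c (Suc l) * (cmod (c2 - of_int (n + int l)))\<^sup>2 * (real l - c)
      = \<omega> (n + int l) * om2 c l * A (n + int l) * (real l + 1)"
proof -
  have e: "n + int (Suc l) = (n + int l) + 1" by simp
  have "\<omega> (n + int (Suc l)) * om2 c (Suc l) * (cmod (c2 - of_int (n + int l)))\<^sup>2 * (real l - c)
      = (\<omega> ((n + int l) + 1) * (cmod (c2 - of_int (n + int l)))\<^sup>2) * (om2 c (Suc l) * (real l - c))"
    unfolding e by (simp only: mult_ac)
  also have "\<dots> = (\<omega> (n + int l) * A (n + int l)) * (om2 c l * (real l + 1))"
    unfolding \<omega>_step[OF assms] om2_step[OF c] ..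
  finally show ?thesis by (simp only: mult_ac)
qed

text \<open>Ratio of consecutive squared norms along the diagonal \<open>k - l = n\<close> for the
  solution of E u = 0, written with monic quadratics to fit
  \<open>ratio_expansion_quadratic\<close>. The coefficient of 1/l comes out as the weight on this
  diagonal.\<close>

definition E_kernel_ratio :: "int \<Rightarrow> nat \<Rightarrow> real" where
  "E_kernel_ratio n l = ((real l)\<^sup>2 + (2 * n + 1 + \<delta>) * real l + ((n + (1 + \<delta>) / 2)\<^sup>2 - g)) / ((real l)\<^sup>2 + (1 - c) * real l + - c)"

lemma E_kernel_ratio_expansion: "ratio_expansion (E_kernel_ratio n) (\<delta> + c + 2 * of_int n)"
proof -
  have e: "\<delta> + c + 2 * of_int n = (2 * real_of_int n + 1 + \<delta>) - (1 - c)" by simp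
  show ?thesis unfolding E_kernel_ratio_def[abs_def] e by (rule ratio_expansion_quadratic)
qed

lemma E_kernel_ratio_mult: "E_kernel_ratio n l * ((real l + 1) * (real l - c)) = A (n + int l)"
proof -
  have "A (n + int l) = (real l)\<^sup>2 + (2 * n + 1 + \<delta>) * real l + ((n + (1 + \<delta>) / 2)\<^sup>2 - g)"
    by (simp add: A_def power2_eq_square field_simps)
  moreover have "(real l + 1) * (real l - c) = (real l)\<^sup>2 + (1 - c) * real l + - c"
    by (simp add: power2_eq_square algebra_simps)
  moreover have "(real l + 1) * (real l - c) \<noteq> 0" using c by auto
  ultimately show ?thesis unfolding E_kernel_ratio_def by simp
qed

lemma E_kernel_weight_step:
  assumes K: "K (n + int l)" and u: "(of_nat l + 1) * u' = (of_int n + of_nat l - c2) * u"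
  shows "(cmod u')\<^sup>2 * \<omega> (n + int (Suc l)) * om2 c (Suc l) = E_kernel_ratio n l * ((cmod u)\<^sup>2 * \<omega> (n + int l) * om2 c l)"
proof -
  have "cmod (of_nat l + 1) = real l + 1" by (metis norm_of_nat of_nat_Suc add.commute)
  then have uu: "(real l + 1)\<^sup>2 * (cmod u')\<^sup>2 = (cmod (c2 - of_int (n + int l)))\<^sup>2 * (cmod u)\<^sup>2"
    using arg_cong[OF u, of "\<lambda>z. (cmod z)\<^sup>2"]
    by (simp add: norm_mult power_mult_distrib norm_minus_commute)
  have "((cmod u')\<^sup>2 * \<omega> (n + int (Suc l)) * om2 c (Suc l)) * ((real l + 1)\<^sup>2 * (real l - c))
      = ((real l + 1)\<^sup>2 * (cmod u')\<^sup>2) * (\<omega> (n + int (Suc l)) * om2 c (Suc l) * (real l - c))"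
    by (simp only: mult_ac)
  also have "\<dots> = (cmod u)\<^sup>2 * (\<omega> (n + int (Suc l)) * om2 c (Suc l) * (cmod (c2 - of_int (n + int l)))\<^sup>2 * (real l - c))"
    unfolding uu by (simp only: mult_ac)
  also have "\<dots> = (E_kernel_ratio n l * ((cmod u)\<^sup>2 * \<omega> (n + int l) * om2 c l)) * ((real l + 1)\<^sup>2 * (real l - c))"
    unfolding \<omega>_om2_step[OF K] E_kernel_ratio_mult[symmetric] by (simp only: power2_eq_square mult_ac)
  finally show ?thesis using c by (subst (asm) mult_right_cancel) auto
qed

text \<open>E u = 0 propagates from \<open>l = 0\<close>, so the component at x(n) and y(0) is
  nonzero, which forces \<open>n \<ge> 0\<close> when \<open>c1 = 0\<close>. Then no term vanishes,
  and the squared norms are of order \<open>l\<close> to the power \<open>lam\<close>.\<close>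

lemma highest_weight_necessary:
  assumes R: "R \<in> nHT" and nz: "\<exists>k l. R k l \<noteq> 0"
    and wt: "\<And>k l. R k l \<noteq> 0 \<Longrightarrow> lam = \<delta> + c + 2 * of_int (k - int l)"
    and E0: "nE c2 R = (\<lambda>k l. 0)"
  shows "\<exists>n. lam = \<delta> + c + 2 * of_int n \<and> lam < -1 \<and> (c1 = 0 \<longrightarrow> 0 \<le> n)"
proof -
  obtain k0 l0 where kl0: "R k0 l0 \<noteq> 0" using nz by blast
  define n where "n = k0 - int l0"
  have lam: "lam = \<delta> + c + 2 * of_int n" using wt[OF kl0] by (simp add: n_def)
  define u where "u l = R (n + int l) l" for l
  have u_step: "(of_nat l + 1) * u (Suc l) = (of_int n + of_nat l - c2) * u l" for l
    using fun_cong[OF fun_cong[OF E0, of "n + int (Suc l)"], of l] unfolding nE_def u_def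
    by (simp add: algebra_simps)
  have u0: "u 0 \<noteq> 0"
  proof
    assume "u 0 = 0"
    have "u l = 0" for l
    proof (induction l)
      case (Suc l)
      have "(of_nat l + 1 :: complex) \<noteq> 0" by (metis of_nat_Suc of_nat_eq_0_iff nat.distinct(1) add.commute)
      then show ?case using u_step[of l] Suc by simp
    qed (rule \<open>u 0 = 0\<close>)
    then show False using kl0 by (metis n_def u_def diff_add_cancel)
  qed
  have Kn: "K (n + int l)" for l
  proof (rule K_add)
    show "K n" using R u0 by (auto simp: nHT_def u_def)
  qed simp
  have u_nz: "u l \<noteq> 0" for l
  proof (induction l)
    case (Suc l)
    then show ?case using u_step[of l] c2_neq[OF Kn[of l]] by auto
  qed (rule u0)
  define T where "T l = (cmod (u l))\<^sup>2 * \<omega> (n + int l) * om2 c l" for l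
  have T_pos: "T l > 0" for l unfolding T_def using u_nz \<omega>_pos[OF Kn] om2_pos[OF c] by simp
  have "lam < -1"
  proof (rule ccontr)
    assume "\<not> lam < -1"
    have "\<not> summable T"
    proof (rule gauss_test_divergence[OF E_kernel_ratio_expansion])
      show "- 1 \<le> \<delta> + c + 2 * of_int n" using \<open>\<not> lam < -1\<close> lam by simp
      show "E_kernel_ratio n l * T l \<le> T (Suc l)" for l
        unfolding T_def using E_kernel_weight_step[OF Kn u_step] by simp
      show "0 \<le> T l" for l using T_pos[of l] by simp
    qed (use T_pos in auto)
    moreover have "summable T" unfolding T_def u_def by (rule nHT_imp_summable[OF R])
    ultimately show False by simp
  qed
  moreover have "c1 = 0 \<longrightarrow> 0 \<le> n" using Kn[of 0] by (simp add: K_iff)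
  ultimately show ?thesis using lam by blast
qed

text \<open>No coefficient \<open>c1 + k + 1\<close> vanishes, so the equation at \<open>l\<close>
  expresses row \<open>l\<close> through row \<open>l - 1\<close> and makes row 0 zero. Lowest
  weight vectors therefore do not exist even among formal sums.\<close>

lemma nF_zero_imp_zero:
  assumes "c1 \<notin> \<int>" and F0: "nF c1 c R = (\<lambda>k l. 0)"
  shows "R k l = 0"
proof -
  have c1: "c1 + of_int k + 1 \<noteq> 0" for k
  proof
    assume "c1 + of_int k + 1 = 0"
    then have "c1 = of_int (- k - 1)" by (simp add: algebra_simps eq_neg_iff_add_eq_0)
    then show False using assms(1) by (metis Ints_of_int)
  qed
  show ?thesis
  proof (induction l arbitrary: k)
    case 0
    then show ?case using fun_cong[OF fun_cong[OF F0, of "k - 1"], of 0] c1[of "k - 1"] by (simp add: nF_def)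
  next
    case (Suc l)
    then show ?case using fun_cong[OF fun_cong[OF F0, of "k - 1"], of "Suc l"] c1[of "k - 1"] by (simp add: nF_def)
  qed
qed

lemma not_Ints_inK: "d1 \<notin> \<int> \<Longrightarrow> d2 \<notin> \<int> \<Longrightarrow> inK d1 d2 j"
  by (simp add: inK_def)

text \<open>Here \<open>u\<close> is a vector on the diagonal \<open>k = n + l\<close>, \<open>v = E u\<close>, and the second equation is the
  Casimir eigenvalue equation in the form \<open>F E u = (S - t\<^sup>2) u\<close> with \<open>2 t - 1\<close> the weight of \<open>u\<close>.\<close>
lemma doubly_infinite_sequences:
  assumes hs: "hilbert_submodule d1 d2 c1 c2 c" and d: "d1 \<notin> \<int>" "d2 \<notin> \<int>"
    and S: "((d1 + d2 + 1) / 2)\<^sup>2 = of_real S"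
  shows "\<exists>n0. d1 - d2 = of_real (\<delta> + c + 2 * of_int n0)"
    and "\<exists>u v. (\<exists>l. u l \<noteq> 0) \<and>
     (\<forall>l. v l = (c2 - of_int n - of_nat l) * u l + (of_nat l + 1) * u (Suc l)) \<and>
     (\<forall>l. (c1 + of_int n + of_nat l + 1) * v l + (if l = 0 then 0 else (of_real c - of_nat l + 1) * v (l - 1))
        = of_real (S - (of_int n + (1 + \<delta> + c) / 2)\<^sup>2) * u l) \<and>
     summable (\<lambda>l. (cmod (u l))\<^sup>2 * \<omega> (n + int l) * om2 c l) \<and>
     summable (\<lambda>l. (cmod (v l))\<^sup>2 * \<omega> (n + int l + 1) * om2 c l)"
proof -
  obtain R where "normal_family d1 d2 R" using hilbert_submodule_imp_normal_family[OF hs] by blast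
  note R = this[unfolded normal_family_def, rule_format, OF not_Ints_inK[OF d]]
  have nn: "\<not> negint d1" "\<not> negint d2" using d by (auto simp: negint_def)
  have E: "nE c2 (R j) = (\<lambda>k l. (d2 - of_int j) * R (j + 1) k l)" for j
    using R[of j] nn not_Ints_inK[OF d] by (simp add: Ecoef_def)
  have F: "nF c1 c (R j) = (\<lambda>k l. (d1 + of_int j) * R (j - 1) k l)" for j
    using R[of j] nn not_Ints_inK[OF d] by (simp add: Fcoef_def)
  obtain k0 l0 where kl0: "R 0 k0 l0 \<noteq> 0" using R by blast
  define n0 where "n0 = k0 - int l0"
  have dd: "d1 - d2 = of_real (\<delta> + c + 2 * of_int n0)"
    using R[of 0] kl0 by (auto simp: Hcoef_def n0_def)
  then show "\<exists>n0. d1 - d2 = of_real (\<delta> + c + 2 * of_int n0)" by blast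
  \<comment> \<open>All integers index basis vectors of a doubly infinite module, so the diagonal
    \<open>n\<close> can be prescribed; \<open>n0\<close> is the diagonal of
    \<open>R 0\<close>.\<close>
  define j where "j = n - n0"
  have diag: "k = n + int l" if "R j k l \<noteq> 0" for k l
  proof -
    have "Hcoef d1 d2 j = of_real (\<delta> + c + 2 * of_int (k - int l))" using R that by blast
    then have "(of_real (\<delta> + c + 2 * of_int n0 + 2 * of_int j) :: complex) = of_real (\<delta> + c + 2 * of_int (k - int l))"
      using dd by (simp add: Hcoef_def)
    then have "\<delta> + c + 2 * of_int n0 + 2 * of_int j = \<delta> + c + 2 * of_int (k - int l)" by (simp only: of_real_eq_iff)
    then have "real_of_int (n0 + j) = of_int (k - int l)" by simp
    then show ?thesis unfolding of_int_eq_iff by (simp add: j_def)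
  qed
  define u where "u l = R j (n + int l) l" for l
  define v where "v l = nE c2 (R j) (n + int l + 1) l" for l
  \<comment> \<open>The scalar by which F E acts on x(j), as a difference of squares.\<close>
  have q: "(d2 - of_int j) * (d1 + of_int j + 1) = of_real (S - (of_int n + (1 + \<delta> + c) / 2)\<^sup>2)"
  proof -
    have td: "complex_of_real (of_int n + (1 + \<delta> + c) / 2) = (d1 - d2 + 2 * of_int j + 1) / 2"
      unfolding dd by (simp add: j_def field_simps)
    have "of_real (S - (of_int n + (1 + \<delta> + c) / 2)\<^sup>2) = ((d1 + d2 + 1) / 2)\<^sup>2 - ((d1 - d2 + 2 * of_int j + 1) / 2)\<^sup>2"
      by (simp only: of_real_diff[of S] of_real_power[of "_ + _"] td S)
    also have "\<dots> = ((d1 + d2 + 1) / 2 + (d1 - d2 + 2 * of_int j + 1) / 2) * ((d1 + d2 + 1) / 2 - (d1 - d2 + 2 * of_int j + 1) / 2)"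
      by (simp only: power2_eq_square square_diff_square_factored)
    also have "(d1 + d2 + 1) / 2 + (d1 - d2 + 2 * of_int j + 1) / 2 = d1 + of_int j + 1" by (simp add: field_simps)
    also have "(d1 + d2 + 1) / 2 - (d1 - d2 + 2 * of_int j + 1) / 2 = d2 - of_int j" by (simp add: field_simps)
    finally show ?thesis by (simp add: mult.commute)
  qed
  have FE: "nF c1 c (nE c2 (R j)) = (\<lambda>k l. (d2 - of_int j) * (d1 + of_int j + 1) * R j k l)"
  proof -
    have "nF c1 c (nE c2 (R j)) = (\<lambda>k l. (d2 - of_int j) * nF c1 c (R (j + 1)) k l)"
      unfolding E by (intro ext) (simp add: nF_def algebra_simps)
    then show ?thesis unfolding F by (simp add: mult.assoc add.assoc)
  qed
  have "\<exists>l. u l \<noteq> 0"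
  proof -
    obtain k l where "R j k l \<noteq> 0" using R by blast
    then show ?thesis using diag[of k l] by (auto simp: u_def)
  qed
  moreover have "v l = (c2 - of_int n - of_nat l) * u l + (of_nat l + 1) * u (Suc l)" for l
    by (simp add: v_def u_def nE_def algebra_simps)
  moreover have "(c1 + of_int n + of_nat l + 1) * v l + (if l = 0 then 0 else (of_real c - of_nat l + 1) * v (l - 1))
        = of_real (S - (of_int n + (1 + \<delta> + c) / 2)\<^sup>2) * u l" for l
  proof -
    have e: "n + int (l - 1) + 1 = n + int l" if "l \<noteq> 0" using that by (simp add: of_nat_diff)
    have "nF c1 c (nE c2 (R j)) (n + int l) l = of_real (S - (of_int n + (1 + \<delta> + c) / 2)\<^sup>2) * u l"
      unfolding FE q u_def ..
    then show ?thesis unfolding v_def nF_def[of _ _ "nE c2 (R j)"] using e by (auto simp: add_ac)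
  qed
  moreover have "summable (\<lambda>l. (cmod (u l))\<^sup>2 * \<omega> (n + int l) * om2 c l)"
    unfolding u_def using R by (intro nHT_imp_summable) blast
  moreover have "summable (\<lambda>l. (cmod (v l))\<^sup>2 * \<omega> (n + int l + 1) * om2 c l)"
  proof -
    have s: "summable (\<lambda>l. (cmod (R (j + 1) (n + 1 + int l) l))\<^sup>2 * \<omega> (n + 1 + int l) * om2 c l)"
      using R by (intro nHT_imp_summable) blast
    have "(cmod (v l))\<^sup>2 * \<omega> (n + int l + 1) * om2 c l
       = (cmod (d2 - of_int j))\<^sup>2 * ((cmod (R (j + 1) (n + 1 + int l) l))\<^sup>2 * \<omega> (n + 1 + int l) * om2 c l)" for l
    proof -
      have e: "n + int l + 1 = n + 1 + int l" by simp
      show ?thesis unfolding v_def E e by (simp only: norm_mult power_mult_distrib mult.assoc)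
    qed
    then show ?thesis using summable_mult[OF s, of "(cmod (d2 - of_int j))\<^sup>2"] by (simp only:)
  qed
  ultimately show "\<exists>u v. (\<exists>l. u l \<noteq> 0) \<and>
     (\<forall>l. v l = (c2 - of_int n - of_nat l) * u l + (of_nat l + 1) * u (Suc l)) \<and>
     (\<forall>l. (c1 + of_int n + of_nat l + 1) * v l + (if l = 0 then 0 else (of_real c - of_nat l + 1) * v (l - 1))
        = of_real (S - (of_int n + (1 + \<delta> + c) / 2)\<^sup>2) * u l) \<and>
     summable (\<lambda>l. (cmod (u l))\<^sup>2 * \<omega> (n + int l) * om2 c l) \<and>
     summable (\<lambda>l. (cmod (v l))\<^sup>2 * \<omega> (n + int l + 1) * om2 c l)"
    by blast
qed

text \<open>Dividing by the solution \<open>(n - c\<^sub>2)\<^sub>l / l!\<close> of \<open>E u = 0\<close>.\<close>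
lemma doubly_infinite_necessary:
  assumes hs: "hilbert_submodule d1 d2 c1 c2 c" and d: "d1 \<notin> \<int>" "d2 \<notin> \<int>"
    and S: "((d1 + d2 + 1) / 2)\<^sup>2 = of_real S"
  shows "S \<ge> 0" and "g > c\<^sup>2 / 4"
proof -
  \<comment> \<open>Large enough for \<open>t > 0\<close>, and nonnegative so that the whole
    diagonal lies over \<open>K\<close>.\<close>
  define n where "n = max 0 (\<lceil>- (1 + \<delta> + c) / 2\<rceil> + 1)"
  define t where "t = of_int n + (1 + \<delta> + c) / 2"
  have n0: "n \<ge> 0" and t: "t > 0" unfolding n_def t_def by linarith+
  have Kn: "K (n + int l)" for l using n0 by (simp add: K_iff)
  obtain u v where unz: "\<exists>l. u l \<noteq> 0"
    and v: "\<And>l. v l = (c2 - of_int n - of_nat l) * u l + (of_nat l + 1) * u (Suc l)"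
    and cas: "\<And>l. (c1 + of_int n + of_nat l + 1) * v l + (if l = 0 then 0 else (of_real c - of_nat l + 1) * v (l - 1))
        = of_real (S - t\<^sup>2) * u l"
    and sum_u: "summable (\<lambda>l. (cmod (u l))\<^sup>2 * \<omega> (n + int l) * om2 c l)"
    and sum_v: "summable (\<lambda>l. (cmod (v l))\<^sup>2 * \<omega> (n + int l + 1) * om2 c l)"
    using doubly_infinite_sequences(2)[OF assms, of n] unfolding t_def by blast
  define G where "G l = (\<Prod>i<l. (of_int n + of_nat i - c2) / (of_nat i + 1))" for l
  have s1: "(of_nat i + 1 :: complex) \<noteq> 0" for i by (metis of_nat_Suc of_nat_eq_0_iff nat.distinct(1) add.commute)
  have cn: "of_int n + of_nat i - c2 \<noteq> 0" for i using c2_neq[OF Kn[of i]] by auto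
  have Gnz: "G l \<noteq> 0" for l using s1 cn by (simp add: G_def)
  have GS: "(of_nat l + 1) * G (Suc l) = (of_int n + of_nat l - c2) * G l" for l
    using s1[of l] by (simp add: G_def)
  define h where "h l = u l / G l" for l
  have u: "u l = G l * h l" for l using Gnz by (simp add: h_def)
  \<comment> \<open>The product of the two parameters
    \<open>(\<plusminus>(c1 + c2 + 1) - c) / 2\<close>, whose sum is \<open>- c\<close>.\<close>
  define e where "e = c\<^sup>2 / 4 - g"
  have up: "up_coeff t (- c) e l = A (n + int l)" for l
    by (simp add: up_coeff_def A_def t_def e_def power2_eq_square field_simps)
  have up_pos: "up_coeff t (- c) e l > 0" for l unfolding up by (rule A_pos[OF Kn])
  have Aeq: "of_real (A (n + int l)) = (c1 + of_int n + of_nat l + 1) * (of_int n + of_nat l - c2)" for l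
    unfolding A_eq by (simp add: add_ac)
  have vG: "v l = (of_int n + of_nat l - c2) * G l * (h (Suc l) - h l)" for l
  proof -
    have "v l = (c2 - of_int n - of_nat l) * (G l * h l) + ((of_nat l + 1) * G (Suc l)) * h (Suc l)"
      unfolding v u by (simp only: mult.assoc)
    then show ?thesis unfolding GS by (simp add: algebra_simps)
  qed
  have rec: "dual_hahn_rec t (- c) e S h"
    unfolding dual_hahn_rec_def up
  proof
    fix l
    have "(if l = 0 then 0 else (of_real c - of_nat l + 1) * v (l - 1))
        = - (of_real (real l * (real l + - c - 1)) * G l * (h l - h (l - 1)))"
    proof (cases l)
      case (Suc m)
      have "(of_real c - of_nat l + 1) * v (l - 1) = (of_real c - of_nat m) * ((of_nat m + 1) * G (Suc m)) * (h (Suc m) - h m)"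
        unfolding Suc vG GS by simp
      then show ?thesis unfolding Suc by (simp add: algebra_simps)
    qed simp
    then have *: "(c1 + of_int n + of_nat l + 1) * v l - of_real (real l * (real l + - c - 1)) * G l * (h l - h (l - 1))
        = of_real (S - t\<^sup>2) * u l" using cas[of l] by simp
    have "G l * (of_real (A (n + int l)) * (h (Suc l) - h l) - of_real (real l * (real l + - c - 1)) * (h l - h (l - 1)))
        = G l * (of_real (S - t\<^sup>2) * h l)"
    proof -
      have "G0 * (a * b * D - C * D') = G0 * (q * h0)" if "a * (b * G0 * D) - C * G0 * D' = q * (G0 * h0)"
        for G0 a b D C D' q h0 :: complex using that by (simp add: algebra_simps)
      then show ?thesis using * unfolding vG u Aeq by blast
    qed
    then show "of_real (A (n + int l)) * (h (Suc l) - h l) - of_real (real l * (real l + - c - 1)) * (h l - h (l - 1))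
        = of_real (S - t\<^sup>2) * h l"
      using Gnz[of l] by (simp only: mult_cancel_left) simp
  qed
  have h0: "h 0 \<noteq> 0"
  proof
    assume "h 0 = 0"
    then have "u l = 0" for l using dual_hahn_rec_zero[OF rec less_imp_neq[OF up_pos, symmetric]] by (simp add: u)
    then show False using unz by blast
  qed
  define W where "W l = (cmod (G l))\<^sup>2 * \<omega> (n + int l) * om2 c l" for l
  have W: "dual_hahn_weight t (- c) e W"
    unfolding dual_hahn_weight_def up
  proof (intro allI conjI)
    fix l
    show "W l > 0" unfolding W_def using \<omega>_pos[OF Kn] om2_pos[OF c] Gnz by simp
    show "W (Suc l) * ((real l + 1) * (real l + - c)) = W l * A (n + int l)"
      unfolding W_def E_kernel_weight_step[OF Kn GS] E_kernel_ratio_mult[symmetric] by simp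
  qed
  have sum_h: "summable (\<lambda>l. W l * (cmod (h l))\<^sup>2)"
    using sum_u unfolding u W_def norm_mult power_mult_distrib by (simp only: mult_ac)
  \<comment> \<open>This series is the squared norm of v = E u: by unitarity of the first factor the
    two weights coincide term by term.\<close>
  have sum_D: "summable (\<lambda>l. W l * up_coeff t (- c) e l * (cmod (h (Suc l) - h l))\<^sup>2)"
  proof -
    have "(cmod (v l))\<^sup>2 * \<omega> (n + int l + 1) * om2 c l = W l * up_coeff t (- c) e l * (cmod (h (Suc l) - h l))\<^sup>2" for l
    proof -
      have "cmod (v l) = cmod (c2 - of_int (n + int l)) * cmod (G l) * cmod (h (Suc l) - h l)"
        unfolding vG norm_mult by (simp add: norm_minus_commute)
      then have "(cmod (v l))\<^sup>2 * \<omega> (n + int l + 1) * om2 c l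
         = (\<omega> (n + int l + 1) * (cmod (c2 - of_int (n + int l)))\<^sup>2) * (cmod (G l))\<^sup>2 * (cmod (h (Suc l) - h l))\<^sup>2 * om2 c l"
        by (simp only: power_mult_distrib mult_ac)
      then show ?thesis unfolding \<omega>_step[OF Kn] up W_def by (simp only: mult_ac)
    qed
    then show ?thesis using sum_v by simp
  qed
  have nc: "- c > 0" using c by simp
  show S0: "S \<ge> 0"
  proof (rule ccontr)
    assume "\<not> S \<ge> 0"
    then have "- ((sqrt (- S))\<^sup>2) = S" "sqrt (- S) \<noteq> 0" by auto
    then show False
      using dual_hahn_not_l2_osc[OF t nc up_pos, of "sqrt (- S)" h W] rec W h0 sum_h sum_D by simp
  qed
  \<comment> \<open>Otherwise both remaining parameters have nonnegative real part, and the growth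
    estimate excludes every solution with \<open>S \<ge> 0\<close>.\<close>
  show "g > c\<^sup>2 / 4"
  proof (rule ccontr)
    assume "\<not> g > c\<^sup>2 / 4"
    then have "e \<ge> 0" by (simp add: e_def)
    then show False using dual_hahn_not_l2_pos[OF t nc _ S0 rec W h0] sum_h by simp
  qed
qed

end


section \<open>Point masses at a negative parameter\<close>

context tensor_setup begin

text \<open>Continuous dual Hahn polynomials are symmetric in their parameters; only the
  normalisation singles one out. \<open>Z\<close> is the quotient of Pochhammer symbols that gives
  this role to a negative parameter \<open>t'\<close>: by \<open>Z1\<close>, \<open>Z2\<close> and
  \<open>ident\<close> the Casimir equation for \<open>u = Z * h\<close> becomes the recurrence for
  h with \<open>t'\<close>, \<open>\<rho>\<close>, \<open>e\<close>. Then
  \<open>dual_hahn_not_l2_neg\<close> leaves only the eigenvalue of the constant solution.\<close>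

lemma real_parameters_necessary:
  fixes p1 p2 t' \<rho> e :: real and Z :: "nat \<Rightarrow> real"
  assumes hs: "hilbert_submodule d1 d2 c1 c2 c" and d: "d1 \<notin> \<int>" "d2 \<notin> \<int>"
    and S: "((d1 + d2 + 1) / 2)\<^sup>2 = of_real S"
    and p: "c1 = of_real p1" "c2 = of_real p2" and n0: "n \<ge> 0"
    and P: "of_int n + 1 + p1 > 0" and Q: "of_int n - p2 > 0"
    and t': "-1 < t'" "t' < 0" "\<rho> + t' > 0" and e: "e \<ge> 0"
    and U0: "up_coeff t' \<rho> e 0 \<noteq> 0"
    and Znz: "\<And>l. Z l \<noteq> 0"
    and Z1: "\<And>l. (of_int n + real l + 1 + p1) * (real l + 1) * Z (Suc l) = up_coeff t' \<rho> e l * Z l"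
    and Z2: "\<And>l. (real l - c) * (of_int n + real l - p2) * Z l = (real l + 1) * (real l + \<rho>) * Z (Suc l)"
    and ident: "\<And>l. (of_int n + real l + 1 + p1) * (of_int n + real l - p2) + real l * (real l - 1 - c) + t'\<^sup>2
        = up_coeff t' \<rho> e l + real l * (real l + \<rho> - 1) + (of_int n + (1 + \<delta> + c) / 2)\<^sup>2"
  shows "S = t'\<^sup>2"
proof (rule ccontr)
  assume St: "S \<noteq> t'\<^sup>2"
  define t where "t = of_int n + (1 + \<delta> + c) / 2"
  have Kn: "K (n + int l)" for l using n0 by (simp add: K_iff)
  obtain u v where unz: "\<exists>l. u l \<noteq> 0"
    and v: "\<And>l. v l = (c2 - of_int n - of_nat l) * u l + (of_nat l + 1) * u (Suc l)"
    and cas: "\<And>l. (c1 + of_int n + of_nat l + 1) * v l + (if l = 0 then 0 else (of_real c - of_nat l + 1) * v (l - 1))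
        = of_real (S - t\<^sup>2) * u l"
    and sum_u: "summable (\<lambda>l. (cmod (u l))\<^sup>2 * \<omega> (n + int l) * om2 c l)"
    using doubly_infinite_sequences(2)[OF hs d S, of n] unfolding t_def by blast
  have S0: "S \<ge> 0" by (rule doubly_infinite_necessary(1)[OF hs d S])
  define Pl where "Pl l = of_int n + real l + 1 + p1" for l
  define Ql where "Ql l = of_int n + real l - p2" for l
  define U where "U l = up_coeff t' \<rho> e l" for l
  have Pl: "Pl l > 0" and Ql: "Ql l > 0" for l using P Q by (auto simp: Pl_def Ql_def)
  have lc: "real l - c > 0" for l using c by (smt (verit) of_nat_0_le_iff)
  note Z1' = Z1[folded Pl_def U_def] and Z2' = Z2[folded Ql_def] and ident' = ident[folded Pl_def Ql_def U_def t_def]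
  define h where "h l = u l / of_real (Z l)" for l
  have u: "u l = of_real (Z l) * h l" for l using Znz by (simp add: h_def)
  have rec: "dual_hahn_rec t' \<rho> e S h"
    unfolding dual_hahn_rec_def U_def[symmetric]
  proof
    fix l
    have v': "v l = - of_real (Ql l) * (of_real (Z l) * h l) + of_real (real l + 1) * (of_real (Z (Suc l)) * h (Suc l))" for l
      unfolding v u p Ql_def by simp
    have Pc: "c1 + of_int n + of_nat l + 1 = of_real (Pl l)" unfolding p Pl_def by simp
    have a: "of_real (Pl l) * v l = - of_real (Pl l * Ql l) * of_real (Z l) * h l + of_real (U l) * of_real (Z l) * h (Suc l)"
    proof -
      have "of_real (Pl l) * v l = - of_real (Pl l * Ql l) * of_real (Z l) * h l + of_real (Pl l * (real l + 1) * Z (Suc l)) * h (Suc l)"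
        unfolding v' by (simp add: algebra_simps)
      then show ?thesis unfolding Z1' by simp
    qed
    have b: "(if l = 0 then 0 else (of_real c - of_nat l + 1) * v (l - 1))
       = of_real (real l * (real l + \<rho> - 1)) * of_real (Z l) * h (l - 1) - of_real (real l * (real l - 1 - c)) * of_real (Z l) * h l"
    proof (cases l)
      case (Suc m)
      have "(of_real c - of_nat l + 1) * v (l - 1)
         = of_real ((real m - c) * Ql m * Z m) * h m - of_real ((real m - c) * (real m + 1) * Z (Suc m)) * h (Suc m)"
        unfolding Suc by (simp add: v' algebra_simps)
      then show ?thesis unfolding Z2' unfolding Suc by (simp add: algebra_simps)
    qed simp
    have "- of_real (Pl l * Ql l) * of_real (Z l) * h l + of_real (U l) * of_real (Z l) * h (Suc l)
       + (of_real (real l * (real l + \<rho> - 1)) * of_real (Z l) * h (l - 1) - of_real (real l * (real l - 1 - c)) * of_real (Z l) * h l)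
       = of_real (S - t\<^sup>2) * (of_real (Z l) * h l)"
      using cas[of l] unfolding Pc a b u .
    then have "of_real (Z l) * (- of_real (Pl l * Ql l) * h l + of_real (U l) * h (Suc l)
       + (of_real (real l * (real l + \<rho> - 1)) * h (l - 1) - of_real (real l * (real l - 1 - c)) * h l))
       = of_real (Z l) * (of_real (S - t\<^sup>2) * h l)"
      by (simp only: distrib_left right_diff_distrib mult_minus_left mult_minus_right mult_ac)
    then have eq: "- of_real (Pl l * Ql l) * h l + of_real (U l) * h (Suc l)
       + (of_real (real l * (real l + \<rho> - 1)) * h (l - 1) - of_real (real l * (real l - 1 - c)) * h l)
       = of_real (S - t\<^sup>2) * h l"
      using Znz[of l] by (simp only: mult_cancel_left of_real_eq_0_iff) simp
    have r: "Pl l * Ql l = U l + real l * (real l + \<rho> - 1) + t\<^sup>2 - real l * (real l - 1 - c) - t'\<^sup>2"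
      using ident'[of l] by linarith
    have "complex_of_real (Pl l * Ql l) = of_real (U l) + of_real (real l * (real l + \<rho> - 1)) + of_real (t\<^sup>2)
        - of_real (real l * (real l - 1 - c)) - of_real (t'\<^sup>2)"
      unfolding r by (simp only: of_real_add of_real_diff)
    then have "of_real (Pl l * Ql l) * h l = (of_real (U l) + of_real (real l * (real l + \<rho> - 1)) + of_real (t\<^sup>2)
        - of_real (real l * (real l - 1 - c)) - of_real (t'\<^sup>2)) * h l" by (rule arg_cong)
    then show "of_real (U l) * (h (Suc l) - h l) - of_real (real l * (real l + \<rho> - 1)) * (h l - h (l - 1))
       = of_real (S - t'\<^sup>2) * h l"
      using eq unfolding of_real_diff by (simp only: mult_minus_left) (simp only: ring_distribs, algebra)
  qed
  have U_pos: "U l \<noteq> 0" for l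
  proof
    assume "U l = 0"
    then have "Pl l * (real l + 1) * Z (Suc l) = 0" using Z1'[of l] by simp
    then show False using Pl[of l] Znz[of "Suc l"] by simp
  qed
  have h0: "h 0 \<noteq> 0"
  proof
    assume "h 0 = 0"
    then have "u l = 0" for l using dual_hahn_rec_zero[OF rec U_pos[unfolded U_def]] by (simp add: u)
    then show False using unz by blast
  qed
  define W where "W l = \<omega> (n + int l) * om2 c l * (Z l)\<^sup>2" for l
  have W: "dual_hahn_weight t' \<rho> e W"
    unfolding dual_hahn_weight_def U_def[symmetric]
  proof (intro allI conjI)
    fix l
    show "W l > 0" unfolding W_def using \<omega>_pos[OF Kn] om2_pos[OF c] Znz by simp
    have cq: "(cmod (c2 - of_int (n + int l)))\<^sup>2 = (Ql l)\<^sup>2"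
    proof -
      have "c2 - of_int (n + int l) = of_real (- Ql l)" unfolding p Ql_def by simp
      then show ?thesis by (simp only: norm_of_real) simp
    qed
    have Apq: "A (n + int l) = Pl l * Ql l"
    proof -
      have "complex_of_real (A (n + int l)) = of_real (Pl l * Ql l)"
        unfolding A_eq p Pl_def Ql_def by (simp add: algebra_simps)
      then show ?thesis by (simp only: of_real_eq_iff)
    qed
    have s: "\<omega> (n + int (Suc l)) * om2 c (Suc l) * (Ql l)\<^sup>2 * (real l - c)
      = \<omega> (n + int l) * om2 c l * (Pl l * Ql l) * (real l + 1)"
      using \<omega>_om2_step[OF Kn, of l] unfolding cq Apq .
    define X where "X = \<omega> (n + int (Suc l)) * om2 c (Suc l)"
    define Y where "Y = \<omega> (n + int l) * om2 c l"
    have "W (Suc l) * ((real l + 1) * (real l + \<rho>)) * (Pl l * (real l + 1) * Ql l)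
       = X * ((real l + 1) * (real l + \<rho>) * Z (Suc l)) * (Pl l * (real l + 1) * Z (Suc l)) * Ql l"
      by (simp add: W_def X_def power2_eq_square)
    also have "\<dots> = (X * (Ql l)\<^sup>2 * (real l - c)) * U l * (Z l)\<^sup>2"
      unfolding Z1' Z2'[symmetric] by (simp add: power2_eq_square)
    also have "\<dots> = W l * U l * (Pl l * (real l + 1) * Ql l)"
      unfolding X_def s by (simp add: W_def)
    finally show "W (Suc l) * ((real l + 1) * (real l + \<rho>)) = W l * U l"
      using Pl[of l] Ql[of l] by simp
  qed
  have "summable (\<lambda>l. W l * (cmod (h l))\<^sup>2)"
    using sum_u unfolding u W_def norm_mult power_mult_distrib norm_of_real power2_abs by (simp only: mult_ac)
  then show False using dual_hahn_not_l2_neg[OF t' e S0 St U0 rec W h0] by simp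
qed

text \<open>A square summable solution for \<open>g > c\<^sup>2/4\<close> must be the point mass of the spectral measure of the
  continuous dual Hahn polynomials attached to the negative one of the parameters
  \<open>(\<plusminus>(c\<^sub>1 + c\<^sub>2 + 1) - c) / 2\<close>.\<close>
lemma real_parameters_point_mass_minus:
  fixes p1 p2 :: real
  assumes hs: "hilbert_submodule d1 d2 c1 c2 c" and d: "d1 \<notin> \<int>" "d2 \<notin> \<int>"
    and S: "((d1 + d2 + 1) / 2)\<^sup>2 = of_real S"
    and p: "c1 = of_real p1" "c2 = of_real p2"
    and s: "p1 + p2 + 1 < c" "p1 + p2 + 1 - c > -2"
  shows "S = ((p1 + p2 + 1 - c) / 2)\<^sup>2"
proof -
  have dl: "\<delta> = p1 - p2"
  proof -
    have "complex_of_real \<delta> = of_real (p1 - p2)" using \<delta> unfolding p by simp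
    then show ?thesis by (simp only: of_real_eq_iff)
  qed
  \<comment> \<open>A diagonal so far out that all positivity conditions below become linear
    consequences.\<close>
  define n where "n = \<lceil>\<bar>p1\<bar> + \<bar>p2\<bar> + \<bar>c\<bar> + 5\<rceil>"
  have n: "of_int n \<ge> \<bar>p1\<bar> + \<bar>p2\<bar> + \<bar>c\<bar> + 5" unfolding n_def by linarith
  then have n0: "n \<ge> 0" by linarith
  have nb: "of_int n \<ge> 5 - p1 - p2 - c" "of_int n \<ge> 5 + p1 + p2 - c" "of_int n \<ge> 5 - p1 + p2 - c" "of_int n \<ge> 5 + p1 - p2 - c"
    using n c by linarith+
  \<comment> \<open>\<open>?t\<close> is the negative parameter; \<open>?\<rho>\<close> and
    \<open>?e\<close> are the sum and the product of the other two,
    \<open>n + (1 + p1 - p2 + c) / 2\<close> and \<open>(- (p1 + p2 + 1) - c) / 2\<close>.\<close>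
  let ?t = "(p1 + p2 + 1 - c) / 2" and ?\<rho> = "of_int n - p2"
  let ?e = "(of_int n + (1 + p1 - p2 + c) / 2) * ((- (p1 + p2 + 1) - c) / 2)"
  define Z where "Z l = (\<Prod>i<l. (real i - c) / (real i + 1))" for l
  have lc: "real l - c > 0" for l using c by (smt (verit) of_nat_0_le_iff)
  have U: "up_coeff ?t ?\<rho> ?e l = (of_int n + real l + 1 + p1) * (real l - c)" for l
    unfolding up_coeff_def by (simp add: field_simps)
  have ZS: "(real l + 1) * Z (Suc l) = (real l - c) * Z l" for l by (simp add: Z_def)
  show ?thesis
  proof (rule real_parameters_necessary[OF hs d S p n0, where \<rho> = ?\<rho> and e = ?e and Z = Z])
    show "0 < of_int n + 1 + p1" "0 < of_int n - p2" "-1 < ?t" "?t < 0" "?\<rho> + ?t > 0" using nb s c by (simp_all add: field_simps)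
    show "?e \<ge> 0" using nb s c by (intro mult_nonneg_nonneg) (simp_all add: field_simps)
    show "up_coeff ?t ?\<rho> ?e 0 \<noteq> 0" unfolding U using n c by simp
    show "Z l \<noteq> 0" for l unfolding Z_def using lc by (auto simp: less_imp_neq[symmetric])
    show "(of_int n + real l + 1 + p1) * (real l + 1) * Z (Suc l) = up_coeff ?t ?\<rho> ?e l * Z l" for l
      unfolding U mult.assoc ZS ..
    show "(real l - c) * (of_int n + real l - p2) * Z l = (real l + 1) * (real l + ?\<rho>) * Z (Suc l)" for l
      using ZS[of l] by (metis (no_types, lifting) add.commute add_diff_eq mult.assoc mult.left_commute)
    show "(of_int n + real l + 1 + p1) * (of_int n + real l - p2) + real l * (real l - 1 - c) + ?t\<^sup>2
        = up_coeff ?t ?\<rho> ?e l + real l * (real l + ?\<rho> - 1) + (of_int n + (1 + \<delta> + c) / 2)\<^sup>2" for l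
      unfolding U dl by (simp add: power2_eq_square field_simps)
  qed
qed

text \<open>Here \<open>- (p1 + p2 + 1 + c) / 2\<close> is negative. The sequence u is the symmetric
  polynomial divided by \<open>l! (n + 1 + p1)_l\<close>, so singling out this parameter brings the
  factor \<open>(n - p2)_l / (n + 1 + p1)_l\<close> into \<open>Z\<close> besides
  \<open>(- c)_l / l!\<close>.\<close>

lemma real_parameters_point_mass_plus:
  fixes p1 p2 :: real
  assumes hs: "hilbert_submodule d1 d2 c1 c2 c" and d: "d1 \<notin> \<int>" "d2 \<notin> \<int>"
    and S: "((d1 + d2 + 1) / 2)\<^sup>2 = of_real S"
    and p: "c1 = of_real p1" "c2 = of_real p2"
    and s: "p1 + p2 + 1 > - c" "p1 + p2 + 1 + c < 2"
  shows "S = ((p1 + p2 + 1 + c) / 2)\<^sup>2"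
proof -
  have dl: "\<delta> = p1 - p2"
  proof -
    have "complex_of_real \<delta> = of_real (p1 - p2)" using \<delta> unfolding p by simp
    then show ?thesis by (simp only: of_real_eq_iff)
  qed
  define n where "n = \<lceil>\<bar>p1\<bar> + \<bar>p2\<bar> + \<bar>c\<bar> + 5\<rceil>"
  have n: "of_int n \<ge> \<bar>p1\<bar> + \<bar>p2\<bar> + \<bar>c\<bar> + 5" unfolding n_def by linarith
  then have n0: "n \<ge> 0" by linarith
  have nb: "of_int n \<ge> 5 - p1 - p2 - c" "of_int n \<ge> 5 + p1 + p2 - c" "of_int n \<ge> 5 - p1 + p2 - c" "of_int n \<ge> 5 + p1 - p2 - c"
    using n c by linarith+
  let ?t = "- (p1 + p2 + 1 + c) / 2" and ?\<rho> = "of_int n + 1 + p1"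
  let ?e = "(of_int n + (1 + p1 - p2 + c) / 2) * ((p1 + p2 + 1 - c) / 2)"
  have lc: "real l - c > 0" for l using c by (smt (verit) of_nat_0_le_iff)
  have P: "of_int n + real l + 1 + p1 > 0" and Q: "of_int n + real l - p2 > 0" for l
    using n of_nat_0_le_iff[of l, where 'a = real] by linarith+
  define Z where "Z l = (\<Prod>i<l. ((of_int n + real i - p2) * (real i - c)) / ((of_int n + real i + 1 + p1) * (real i + 1)))" for l
  have U: "up_coeff ?t ?\<rho> ?e l = (of_int n + real l - p2) * (real l - c)" for l
    unfolding up_coeff_def by (simp add: field_simps)
  have ZS: "(of_int n + real l + 1 + p1) * (real l + 1) * Z (Suc l) = (of_int n + real l - p2) * (real l - c) * Z l" for l
  proof -
    have "(of_int n + real l + 1 + p1) * (real l + 1) \<noteq> 0" using P[of l] by auto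
    then show ?thesis by (simp add: Z_def)
  qed
  have "S = ?t\<^sup>2"
  proof (rule real_parameters_necessary[OF hs d S p n0, where \<rho> = ?\<rho> and e = ?e and Z = Z])
    show "0 < of_int n + 1 + p1" "0 < of_int n - p2" "-1 < ?t" "?t < 0" "?\<rho> + ?t > 0" using nb s c by (simp_all add: field_simps)
    show "?e \<ge> 0" using nb s c by (intro mult_nonneg_nonneg) (simp_all add: field_simps)
    show "up_coeff ?t ?\<rho> ?e 0 \<noteq> 0" unfolding U using Q[of 0] c by simp
    show "Z l \<noteq> 0" for l unfolding Z_def using lc P Q by (auto simp: less_imp_neq[symmetric])
    show "(of_int n + real l + 1 + p1) * (real l + 1) * Z (Suc l) = up_coeff ?t ?\<rho> ?e l * Z l" for l
      unfolding U ZS ..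
    show "(real l - c) * (of_int n + real l - p2) * Z l = (real l + 1) * (real l + ?\<rho>) * Z (Suc l)" for l
      using ZS[of l] by (simp add: mult_ac add_ac)
    show "(of_int n + real l + 1 + p1) * (of_int n + real l - p2) + real l * (real l - 1 - c) + ?t\<^sup>2
        = up_coeff ?t ?\<rho> ?e l + real l * (real l + ?\<rho> - 1) + (of_int n + (1 + \<delta> + c) / 2)\<^sup>2" for l
      unfolding U dl by (simp add: power2_eq_square field_simps)
  qed
  then show ?thesis by (simp add: power2_eq_square algebra_simps)
qed

end


section \<open>Highest weight submodules\<close>

text \<open>With nonvanishing ratios a first-order recurrence can be solved in both directions from
  the value 1 at 0.\<close>

lemma int_product_exists:
  fixes r :: "int \<Rightarrow> complex"
  assumes r: "\<And>k. r k \<noteq> 0"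
  shows "\<exists>G. (\<forall>k. G k \<noteq> 0) \<and> (\<forall>k. G (k + 1) = r k * G k)"
proof -
  define G where "G k = (if k \<ge> 0 then (\<Prod>i<nat k. r (int i)) else 1 / (\<Prod>i<nat (- k). r (- int i - 1)))" for k
  have "G (k + 1) = r k * G k" for k
  proof (cases "k \<ge> 0")
    case True
    then have "nat (k + 1) = Suc (nat k)" by simp
    then show ?thesis using True by (simp add: G_def mult.commute)
  next
    case False
    define m where "m = nat (- k - 1)"
    have m: "k = - int m - 1" "nat (- k) = Suc m" "nat (- (k + 1)) = m" using False by (auto simp: m_def)
    show ?thesis
    proof (cases "k = -1")
      case True
      then have "m = 0" by (simp add: m_def)
      then show ?thesis using True r[of "-1"] by (simp add: G_def)
    next
      case nk: False
      then have "G (k + 1) = 1 / (\<Prod>i<m. r (- int i - 1))" using False m by (simp add: G_def)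
      moreover have "G k = 1 / ((\<Prod>i<m. r (- int i - 1)) * r k)" using False m by (simp add: G_def)
      ultimately show ?thesis using r[of k] by simp
    qed
  qed
  moreover have "G k \<noteq> 0" for k using r by (simp add: G_def)
  ultimately show ?thesis by blast
qed

lemma degree_backward_difference:
  fixes p :: "complex poly"
  shows "degree (p - pcompose p [:-1, 1:]) \<le> degree p - 1"
proof (induction p)
  case (pCons a p)
  show ?case
  proof (cases "p = 0")
    case False
    let ?q = "pcompose p [:-1, 1:]"
    have e: "pCons a p - pcompose (pCons a p) [:-1, 1:] = [:0, 1:] * (p - ?q) + ?q"
      by (simp add: pcompose_pCons algebra_simps)
    have "degree ([:0, 1:] * (p - ?q)) \<le> degree p"
    proof (cases "degree p = 0")
      case True
      then obtain b where "p = [:b:]" using degree_eq_zeroE by blast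
      then show ?thesis by (simp add: pcompose_pCons)
    next
      case dp: False
      have "degree ([:0, 1:] * (p - ?q)) \<le> degree [:0, 1 :: complex:] + degree (p - ?q)" by (rule degree_mult_le)
      then show ?thesis using pCons.IH dp by simp
    qed
    moreover have "degree ?q \<le> degree p" by (simp add: degree_pcompose)
    ultimately show ?thesis unfolding e using False by (simp add: degree_add_le)
  qed (simp add: pcompose_pCons)
qed simp

lemma poly_growth:
  fixes p :: "complex poly"
  shows "\<exists>C. \<forall>l. cmod (poly p (of_nat l)) \<le> C * (real l + 1) ^ degree p"
proof -
  have "cmod (poly p (of_nat l)) \<le> (\<Sum>i\<le>degree p. cmod (coeff p i)) * (real l + 1) ^ degree p" for l
  proof -
    have "cmod (poly p (of_nat l)) \<le> (\<Sum>i\<le>degree p. cmod (coeff p i) * real l ^ i)"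
      unfolding poly_altdef by (rule order_trans[OF norm_sum]) (simp add: norm_mult norm_power)
    also have "\<dots> \<le> (\<Sum>i\<le>degree p. cmod (coeff p i) * (real l + 1) ^ degree p)"
    proof (intro sum_mono mult_left_mono)
      fix i assume "i \<in> {..degree p}"
      have "real l ^ i \<le> (real l + 1) ^ i" by (intro power_mono) auto
      also have "\<dots> \<le> (real l + 1) ^ degree p" using \<open>i \<in> _\<close> by (intro power_increasing) auto
      finally show "real l ^ i \<le> (real l + 1) ^ degree p" .
    qed simp
    finally show ?thesis by (simp only: sum_distrib_right)
  qed
  then show ?thesis by blast
qed

lemma ratio_expansion_power:
  assumes "ratio_expansion r \<kappa>"
  shows "ratio_expansion (\<lambda>l. r l ^ m) (real m * \<kappa>)"
proof (induction m)
  case 0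
  show ?case by (simp add: ratio_expansion_def)
next
  case (Suc m)
  show ?case using ratio_expansion_mult[OF assms Suc] by (simp add: algebra_simps)
qed

lemma nE_scale: "nE c2 (\<lambda>k l. a * R k l) = (\<lambda>k l. a * nE c2 R k l)"
  by (intro ext) (simp add: nE_def algebra_simps)

lemma nF_scale: "nF c1 c (\<lambda>k l. a * R k l) = (\<lambda>k l. a * nF c1 c R k l)"
  by (intro ext) (simp add: nF_def algebra_simps)

context tensor_setup begin

lemma nE_nF_commutator:
  "nE c2 (nF c1 c R) k l = nF c1 c (nE c2 R) k l + of_real (\<delta> + c + 2 * of_int (k - int l)) * R k l"
proof -
  have d: "complex_of_real (\<delta> + c + 2 * of_int (k - int l)) = c1 - c2 + of_real c + 2 * of_int k - 2 * of_nat l"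
    using \<delta> by simp
  show ?thesis unfolding d by (cases l) (simp_all add: nE_def nF_def algebra_simps)
qed

text \<open>\<open>F\<^sup>j\<close> of the highest weight vector \<open>\<Sum> G(k)/l! x(k) \<otimes> y(l)\<close> multiplies its coefficients by a
  polynomial in \<open>l\<close> of degree at most \<open>j\<close>.\<close>

context
  fixes n :: int and G :: "int \<Rightarrow> complex"
  assumes n: "c1 = 0 \<longrightarrow> n \<ge> 0"
    and G_nz: "G k \<noteq> 0 \<longleftrightarrow> K k"
    and G_step: "K k \<Longrightarrow> G (k + 1) = (of_int k - c2) * G k"
begin

text \<open>The summands are the actions of F on the two tensor factors after dividing by
  \<open>G k / fact l\<close>: the ratio of consecutive \<open>G\<close> gives the second linear
  factor of the first summand, the ratio of factorials the factor \<open>l\<close> of the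
  second.\<close>

primrec hw_poly :: "nat \<Rightarrow> complex poly" where
  "hw_poly 0 = 1"
| "hw_poly (Suc j) = [:c1 + of_int (n - int j), 1:] * [:of_int (n - int j - 1) - c2, 1:] * hw_poly j
     + [:of_real c + 1, -1:] * [:0, 1:] * pcompose (hw_poly j) [:-1, 1:]"

definition hw_vec :: "nat \<Rightarrow> int \<Rightarrow> nat \<Rightarrow> complex" where
  "hw_vec j k l = (if k = n - int j + int l then G k / fact l * poly (hw_poly j) (of_nat l) else 0)"

text \<open>The two quadratic factors have leading coefficients 1 and -1. Their sum is at most
  linear, and the rest contains a backward difference, which costs one degree. The bound
  \<open>2 * j\<close> would not do: each F lowers the weight by 2, and as norms are squared this
  pays for one degree only.\<close>

lemma degree_hw_poly: "degree (hw_poly j) \<le> j"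
proof (induction j)
  case (Suc j)
  let ?P = "hw_poly j"
  let ?A = "[:c1 + of_int (n - int j), 1:] * [:of_int (n - int j - 1) - c2, 1:]" and ?B = "[:of_real c + 1, -1:] * [:0, 1 :: complex:]"
  have e: "hw_poly (Suc j) = (?A + ?B) * ?P - ?B * (?P - pcompose ?P [:-1, 1:])"
    by (simp only: hw_poly.simps) (simp only: algebra_simps)
  have "degree (?A + ?B) \<le> 1" by simp
  then have "degree ((?A + ?B) * ?P) \<le> Suc j"
    using degree_mult_le[of "?A + ?B" ?P] Suc by linarith
  moreover have "degree (?B * (?P - pcompose ?P [:-1, 1:])) \<le> Suc j"
  proof (cases "degree ?P = 0")
    case True
    then obtain b where "?P = [:b:]" using degree_eq_zeroE by blast
    then show ?thesis by (simp add: pcompose_pCons)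
  next
    case False
    have "degree ?B \<le> 2" by simp
    then have "degree (?B * (?P - pcompose ?P [:-1, 1:])) \<le> 2 + (degree ?P - 1)"
      using degree_mult_le[of ?B "?P - pcompose ?P [:-1, 1:]"] degree_backward_difference[of ?P] by linarith
    then show ?thesis using False Suc by linarith
  qed
  ultimately show ?case unfolding e by (rule degree_diff_le)
qed simp

text \<open>Extends \<open>G_step\<close> beyond \<open>K\<close>: for \<open>c1 = 0\<close> and
  \<open>k = -1\<close> the factor \<open>c1 + k + 1\<close> annihilates the nonzero value
  \<open>G 0\<close>.\<close>

lemma G_rel: "(c1 + of_int k + 1) * G (k + 1) = (c1 + of_int k + 1) * ((of_int k - c2) * G k)"
proof (cases "K k")
  case False
  then have k: "c1 = 0" "k < 0" by (auto simp: K_iff)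
  have "G k = 0" using False G_nz by blast
  moreover have "(c1 + of_int k + 1) * G (k + 1) = 0"
  proof (cases "k = -1")
    case False
    then have "\<not> K (k + 1)" using k unfolding K_iff by auto
    then show ?thesis using G_nz by auto
  qed (simp add: k)
  ultimately show ?thesis by simp
qed (simp add: G_step)

lemma nF_hw_vec: "nF c1 c (hw_vec j) = hw_vec (Suc j)"
proof (intro ext)
  fix k l
  show "nF c1 c (hw_vec j) k l = hw_vec (Suc j) k l"
  proof (cases "k = n - int (Suc j) + int l")
    case False
    then have "hw_vec j (k + 1) l = 0" "l \<noteq> 0 \<Longrightarrow> hw_vec j k (l - 1) = 0" by (auto simp: hw_vec_def of_nat_diff)
    then show ?thesis using False by (simp add: nF_def hw_vec_def)
  next
    case k: True
    have A: "(c1 + of_int k + 1) * hw_vec j (k + 1) l = G k / fact l * ((c1 + of_int k + 1) * (of_int k - c2) * poly (hw_poly j) (of_nat l))"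
    proof -
      have "(c1 + of_int k + 1) * hw_vec j (k + 1) l = ((c1 + of_int k + 1) * G (k + 1)) / fact l * poly (hw_poly j) (of_nat l)"
        using k by (simp add: hw_vec_def)
      then show ?thesis unfolding G_rel by simp
    qed
    have B: "(if l = 0 then 0 else (of_real c - of_nat l + 1) * hw_vec j k (l - 1))
        = G k / fact l * ((of_real c - of_nat l + 1) * of_nat l * poly (hw_poly j) (of_nat l - 1))"
    proof (cases l)
      case (Suc m)
      have "G k / fact (Suc m) * of_nat (Suc m) = G k / fact m"
      proof -
        have "(of_nat (Suc m) :: complex) \<noteq> 0" by (simp only: of_nat_eq_0_iff)
        then show ?thesis unfolding fact_Suc by (simp del: of_nat_Suc)
      qed
      then have f: "G k / fact m = G k / fact (Suc m) * of_nat (Suc m)" ..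
      have "(of_nat (Suc m) - 1 :: complex) = of_nat m" by simp
      moreover have "hw_vec j k m = G k / fact m * poly (hw_poly j) (of_nat m)" using k Suc by (simp add: hw_vec_def)
      ultimately show ?thesis unfolding Suc by (simp only: f diff_Suc_1 nat.distinct if_False mult_ac)
    qed simp
    have "c1 + of_int k + 1 = c1 + of_int (n - int j) + of_nat l" "of_int k - c2 = of_int (n - int j - 1) - c2 + of_nat l"
      using k by simp_all
    moreover have "poly (hw_poly (Suc j)) (of_nat l) = (c1 + of_int (n - int j) + of_nat l) * (of_int (n - int j - 1) - c2 + of_nat l)
        * poly (hw_poly j) (of_nat l) + (of_real c - of_nat l + 1) * of_nat l * poly (hw_poly j) (of_nat l - 1)"
    proof -
      have "poly (hw_poly (Suc j)) (of_nat l) = (c1 + of_int (n - int j) + of_nat l) * (of_int (n - int j - 1) - c2 + of_nat l)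
        * poly (hw_poly j) (of_nat l) + (of_real c + 1 + - of_nat l) * of_nat l * poly (hw_poly j) (-1 + of_nat l)"
        by (simp only: hw_poly.simps poly_add poly_mult poly_pCons poly_0 poly_pcompose) simp
      then show ?thesis by (simp add: add_ac)
    qed
    moreover have "hw_vec (Suc j) k l = G k / fact l * poly (hw_poly (Suc j)) (of_nat l)" using k by (simp add: hw_vec_def del: hw_poly.simps)
    ultimately have "hw_vec (Suc j) k l = G k / fact l * ((c1 + of_int k + 1) * (of_int k - c2) * poly (hw_poly j) (of_nat l)
        + (of_real c - of_nat l + 1) * of_nat l * poly (hw_poly j) (of_nat l - 1))"
      by (simp only:)
    then show ?thesis unfolding nF_def A B by (simp only: distrib_left)
  qed
qed

lemma nE_hw_vec_0: "nE c2 (hw_vec 0) = (\<lambda>k l. 0)"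
proof (intro ext)
  fix k l
  show "nE c2 (hw_vec 0) k l = 0"
  proof (cases "k = n + int l + 1")
    case True
    then have "K (k - 1)" using n by (auto simp: K_iff)
    then have "G k = (of_int k - 1 - c2) * G (k - 1)" using G_step[of "k - 1"] by simp
    moreover have "(of_nat l + 1) / fact (Suc l) = (1 / fact l :: complex)"
    proof -
      have "(of_nat l + 1 :: complex) \<noteq> 0" by (metis of_nat_Suc of_nat_eq_0_iff nat.distinct(1) add.commute)
      then show ?thesis by (simp add: fact_Suc add.commute)
    qed
    then have "(of_nat l + 1) * (G k / fact (Suc l)) = G k / fact l"
      by (metis (no_types, lifting) mult.commute mult.right_neutral times_divide_eq_right times_divide_eq_left)
    ultimately show ?thesis using True by (simp add: nE_def hw_vec_def del: fact_Suc) (simp add: field_simps)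
  qed (auto simp: nE_def hw_vec_def)
qed

text \<open>The familiar sl(2) identity, obtained by moving E past one F at a time.\<close>

lemma nE_hw_vec:
  "nE c2 (hw_vec (Suc j)) = (\<lambda>k l. of_real ((real j + 1) * (\<delta> + c + 2 * of_int n - real j)) * hw_vec j k l)"
proof -
  let ?lam = "\<delta> + c + 2 * of_int n"
  have wt: "of_real (\<delta> + c + 2 * of_int (k - int l)) * hw_vec j k l = of_real (?lam - 2 * real j) * hw_vec j k l" for j k l
  proof (cases "k = n - int j + int l")
    case True
    have "\<delta> + c + 2 * of_int (k - int l) = ?lam - 2 * real j" by (simp add: True)
    then show ?thesis by (simp only:)
  qed (simp add: hw_vec_def)
  have comm: "nE c2 (hw_vec (Suc j)) k l = nF c1 c (nE c2 (hw_vec j)) k l + of_real (?lam - 2 * real j) * hw_vec j k l" for j k l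
    unfolding nF_hw_vec[symmetric] nE_nF_commutator wt ..
  show ?thesis
  proof (induction j)
    case 0
    show ?case by (intro ext) (simp add: comm nE_hw_vec_0 nF_def)
  next
    case (Suc j)
    have "nF c1 c (nE c2 (hw_vec (Suc j))) k l = of_real ((real j + 1) * (?lam - real j)) * hw_vec (Suc j) k l" for k l
    proof -
      have "nF c1 c (nE c2 (hw_vec (Suc j))) k l = of_real ((real j + 1) * (?lam - real j)) * nF c1 c (hw_vec j) k l"
        unfolding Suc nF_scale ..
      then show ?thesis unfolding nF_hw_vec .
    qed
    then show ?case unfolding comm[of "Suc j"]
      by (intro ext) (simp only: distrib_right[symmetric] of_real_add[symmetric], simp add: algebra_simps)
  qed
qed

lemma hw_vec_nHT:
  assumes lam: "\<delta> + c + 2 * of_int n < -1"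
  shows "hw_vec j \<in> nHT"
proof (rule summable_imp_nHT)
  show "K k \<and> k = n - int j + int l" if "hw_vec j k l \<noteq> 0" for k l
    using that G_nz by (auto simp: hw_vec_def split: if_splits)
  obtain C where C: "\<And>l. cmod (poly (hw_poly j) (of_nat l)) \<le> C * (real l + 1) ^ degree (hw_poly j)"
    using poly_growth by blast
  define m where "m = n - int j"
  \<comment> \<open>\<open>C\<^sup>2 * T\<close> dominates the squared norms. The diagonal
    \<open>m\<close> lowers the exponent by \<open>2 * j\<close> and the polynomial raises it by
    \<open>2 * j\<close>, so the exponent remains the highest weight.\<close>
  define T where "T l = ((real l + 1)\<^sup>2) ^ j * ((cmod (G (m + int l) / fact l))\<^sup>2 * \<omega> (m + int l) * om2 c l)" for l
  have "cmod (poly (hw_poly j) 0) \<le> C" using C[of 0] by simp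
  then have C0: "C \<ge> 0" by (rule order_trans[OF norm_ge_zero])
  define L where "L = nat (- m)"
  have KL: "K (m + int l)" if "l \<ge> L" for l using that by (auto simp: K_iff L_def)
  let ?b = "\<lambda>l. ((real l)\<^sup>2 + 4 * real l + 4) / ((real l)\<^sup>2 + 2 * real l + 1)"
  have sum_T: "summable T"
  proof (rule ratio_expansion_convergence)
    show "ratio_expansion (\<lambda>l. E_kernel_ratio m l * ?b l ^ j) ((\<delta> + c + 2 * of_int m) + real j * (4 - 2))"
      by (intro ratio_expansion_mult ratio_expansion_power ratio_expansion_quadratic E_kernel_ratio_expansion)
    show "(\<delta> + c + 2 * of_int m) + real j * (4 - 2) < -1" using lam by (simp add: m_def)
    show "\<forall>\<^sub>F l in sequentially. 0 < T l"
      unfolding eventually_sequentially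
    proof (intro exI[of _ L] allI impI)
      fix l assume "l \<ge> L"
      then have "G (m + int l) \<noteq> 0" "\<omega> (m + int l) > 0" using KL G_nz \<omega>_pos by auto
      then show "T l > 0" unfolding T_def using om2_pos[OF c, of l] of_nat_0_le_iff[of l, where 'a = real]
        by (intro mult_pos_pos zero_less_power) (auto simp del: of_nat_0_le_iff)
    qed
    show "\<forall>\<^sub>F l in sequentially. T (Suc l) = E_kernel_ratio m l * ?b l ^ j * T l"
      unfolding eventually_sequentially
    proof (intro exI[of _ L] allI impI)
      fix l assume "l \<ge> L"
      note Kl = KL[OF this]
      have b: "((real (Suc l) + 1)\<^sup>2) ^ j = ?b l ^ j * ((real l + 1)\<^sup>2) ^ j"
      proof -
        have "(real l)\<^sup>2 + 4 * real l + 4 = (real (Suc l) + 1)\<^sup>2" "(real l)\<^sup>2 + 2 * real l + 1 = (real l + 1)\<^sup>2"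
          by (simp_all add: power2_eq_square algebra_simps)
        then show ?thesis by (simp only: power_divide) simp
      qed
      have "(of_nat l + 1) * (G (m + int (Suc l)) / fact (Suc l)) = (of_int m + of_nat l - c2) * (G (m + int l) / fact l)"
      proof -
        have e: "m + int (Suc l) = (m + int l) + 1" by simp
        have "(of_nat l + 1 :: complex) \<noteq> 0" by (metis of_nat_Suc of_nat_eq_0_iff nat.distinct(1) add.commute)
        then show ?thesis unfolding e G_step[OF Kl] by (simp add: add.commute)
      qed
      from E_kernel_weight_step[OF Kl this] show "T (Suc l) = E_kernel_ratio m l * ?b l ^ j * T l"
        unfolding T_def b by (simp only: mult_ac)
    qed
  qed
  have "(cmod (hw_vec j (m + int l) l))\<^sup>2 * \<omega> (m + int l) * om2 c l \<le> C\<^sup>2 * T l \<and>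
      0 \<le> (cmod (hw_vec j (m + int l) l))\<^sup>2 * \<omega> (m + int l) * om2 c l" for l
  proof (cases "K (m + int l)")
    case True
    have w: "\<omega> (m + int l) * om2 c l \<ge> 0" using \<omega>_pos[OF True] om2_pos[OF c, of l] by simp
    have "cmod (poly (hw_poly j) (of_nat l)) \<le> C * (real l + 1) ^ j"
    proof -
      have "(real l + 1) ^ degree (hw_poly j) \<le> (real l + 1) ^ j" by (intro power_increasing degree_hw_poly) simp
      then show ?thesis using C[of l] mult_left_mono[OF _ C0] by (meson order_trans)
    qed
    then have "(cmod (poly (hw_poly j) (of_nat l)))\<^sup>2 \<le> (C * (real l + 1) ^ j)\<^sup>2" by (intro power_mono) auto
    also have "\<dots> = C\<^sup>2 * ((real l + 1)\<^sup>2) ^ j" by (simp add: power_mult_distrib power_mult[symmetric] mult.commute)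
    finally have "(cmod (poly (hw_poly j) (of_nat l)))\<^sup>2 * ((cmod (G (m + int l) / fact l))\<^sup>2 * (\<omega> (m + int l) * om2 c l))
      \<le> C\<^sup>2 * ((real l + 1)\<^sup>2) ^ j * ((cmod (G (m + int l) / fact l))\<^sup>2 * (\<omega> (m + int l) * om2 c l))"
      by (rule mult_right_mono[OF _ mult_nonneg_nonneg[OF _ w]]) auto
    moreover have "(cmod (hw_vec j (m + int l) l))\<^sup>2 * \<omega> (m + int l) * om2 c l
        = (cmod (poly (hw_poly j) (of_nat l)))\<^sup>2 * ((cmod (G (m + int l) / fact l))\<^sup>2 * (\<omega> (m + int l) * om2 c l))"
      by (simp add: hw_vec_def m_def norm_mult norm_divide power_mult_distrib power_divide)
    ultimately have "(cmod (hw_vec j (m + int l) l))\<^sup>2 * \<omega> (m + int l) * om2 c l \<le> C\<^sup>2 * T l"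
      by (simp only: T_def mult_ac)
    moreover have "0 \<le> (cmod (hw_vec j (m + int l) l))\<^sup>2 * \<omega> (m + int l) * om2 c l"
      using mult_nonneg_nonneg[OF zero_le_power2 w, of "cmod (hw_vec j (m + int l) l)"] by (simp only: mult.assoc)
    ultimately show ?thesis ..
  next
    case False
    then have "G (m + int l) = 0" using G_nz by blast
    then show ?thesis by (simp add: hw_vec_def T_def m_def[symmetric])
  qed
  then have bound: "norm ((cmod (hw_vec j (m + int l) l))\<^sup>2 * \<omega> (m + int l) * om2 c l) \<le> C\<^sup>2 * T l" for l
    by (simp only: real_norm_def abs_of_nonneg)
  show "summable (\<lambda>l. (cmod (hw_vec j (n - int j + int l) l))\<^sup>2 * \<omega> (n - int j + int l) * om2 c l)"
    unfolding m_def[symmetric]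
    by (rule summable_comparison_test'[OF summable_mult[OF sum_T] bound])
qed

text \<open>Apply E: by \<open>nE_hw_vec\<close> it returns the previous vector with a factor that
  is nonzero for a negative weight.\<close>

lemma hw_vec_nonzero:
  assumes lam: "\<delta> + c + 2 * of_int n < 0"
  shows "\<exists>k l. hw_vec j k l \<noteq> 0"
proof (induction j)
  case 0
  have "hw_vec 0 n 0 \<noteq> 0" using n G_nz[of n] by (simp add: hw_vec_def K_iff)
  then show ?case by blast
next
  case (Suc j)
  show ?case
  proof (rule ccontr)
    assume "\<nexists>k l. hw_vec (Suc j) k l \<noteq> 0"
    then have "hw_vec (Suc j) = (\<lambda>k l. 0)" by (auto simp: fun_eq_iff)
    then have z: "of_real ((real j + 1) * (\<delta> + c + 2 * of_int n - real j)) * hw_vec j k l = 0" for k l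
      using fun_cong[OF fun_cong[OF nE_hw_vec[of j], of k], of l] by (simp add: nE_def)
    have "(real j + 1) * (\<delta> + c + 2 * of_int n - real j) \<noteq> 0" using lam by auto
    then have "hw_vec j k l = 0" for k l using z[of k l] by (metis mult_eq_0_iff of_real_eq_0_iff)
    then show False using Suc by blast
  qed
qed

lemma highest_weight_submodule:
  assumes lam: "lam = \<delta> + c + 2 * of_int n" "lam < -1"
  shows "hilbert_submodule (of_real lam) 0 c1 c2 c"
proof -
  have l0: "lam < 0" using lam by simp
  let ?F = "\<lambda>i. Fcoef (of_real lam) 0 (- int i)" and ?E = "\<lambda>i. Ecoef (of_real lam) 0 (- int i)"
  have lnz: "(of_real lam - of_nat i :: complex) \<noteq> 0" for i
  proof -
    have "(of_real lam - of_nat i :: complex) = of_real (lam - real i)" by simp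
    then show ?thesis using l0 by (simp only: of_real_eq_0_iff)
  qed
  have Fnz: "?F i \<noteq> 0" for i using lnz[of i] by (simp add: Fcoef_def not_negint_0)
  have EF: "?E (Suc i) * ?F i = of_real ((real i + 1) * (lam - real i))" for i
    by (simp add: Ecoef_def Fcoef_def not_negint_0 algebra_simps)
  \<comment> \<open>Scales the vectors so that F has the coefficients of N(lam,0); by
    \<open>EF\<close> the coefficients of E then fit as well, whether or not \<open>lam\<close> is
    an integer.\<close>
  define r where "r i = (\<Prod>m<i. 1 / ?F m)" for i
  have rnz: "r i \<noteq> 0" for i unfolding r_def using Fnz by simp
  have rS: "r i = ?F i * r (Suc i)" for i using Fnz[of i] by (simp add: r_def)
  define R where "R j = (\<lambda>k l. r (nat (- j)) * hw_vec (nat (- j)) k l)" for j :: int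
  have "normal_family (of_real lam) 0 R"
    unfolding normal_family_def
  proof (intro allI impI)
    fix j assume "inK (of_real lam) 0 j"
    then have "j \<le> 0" using l0 by (simp add: inK_neg_0)
    then obtain i where j: "j = - int i" by (metis nonneg_int_cases neg_0_le_iff_le minus_minus)
    have Rj: "R j = (\<lambda>k l. r i * hw_vec i k l)" by (simp add: R_def j)
    have Rm: "R (j - 1) = (\<lambda>k l. r (Suc i) * hw_vec (Suc i) k l)"
    proof -
      have "nat (- (j - 1)) = Suc i" using j by simp
      then show ?thesis by (simp add: R_def)
    qed
    show "R j \<in> nHT \<and> (\<exists>k l. R j k l \<noteq> 0) \<and>
     (\<forall>k l. R j k l \<noteq> 0 \<longrightarrow> Hcoef (of_real lam) 0 j = of_real (\<delta> + c + 2 * of_int (k - int l))) \<and>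
     nE c2 (R j) = (\<lambda>k l. if inK (of_real lam) 0 (j + 1) then Ecoef (of_real lam) 0 j * R (j + 1) k l else 0) \<and>
     nF c1 c (R j) = (\<lambda>k l. if inK (of_real lam) 0 (j - 1) then Fcoef (of_real lam) 0 j * R (j - 1) k l else 0)"
    proof (intro conjI allI impI)
      have "hw_vec i \<in> nHT" using lam by (intro hw_vec_nHT) simp
      then have "(\<lambda>x. (cmod (r i))\<^sup>2 * (\<lambda>(k, l). (cmod (hw_vec i k l))\<^sup>2 * \<omega> k * om2 c l) x) summable_on UNIV"
        by (intro summable_on_cmult_right) (simp add: nHT_def)
      then show "R j \<in> nHT" using \<open>hw_vec i \<in> nHT\<close> unfolding Rj
        by (simp add: nHT_def norm_mult power_mult_distrib case_prod_unfold mult.assoc)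
      show "\<exists>k l. R j k l \<noteq> 0" using hw_vec_nonzero[of i] l0 lam rnz[of i] unfolding Rj by auto
      show "Hcoef (of_real lam) 0 j = of_real (\<delta> + c + 2 * of_int (k - int l))" if "R j k l \<noteq> 0" for k l
      proof -
        have "k = n - int i + int l" using that unfolding Rj by (auto simp: hw_vec_def split: if_splits)
        then show ?thesis using lam by (simp add: Hcoef_def j)
      qed
      show "nE c2 (R j) = (\<lambda>k l. if inK (of_real lam) 0 (j + 1) then Ecoef (of_real lam) 0 j * R (j + 1) k l else 0)"
      proof (cases i)
        case 0
        have "nE c2 (R j) = (\<lambda>k l. r i * nE c2 (hw_vec i) k l)" unfolding Rj nE_scale ..
        then show ?thesis using l0 by (simp add: 0 nE_hw_vec_0 j inK_neg_0)
      next
        case (Suc m)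
        have jp: "R (j + 1) = (\<lambda>k l. r m * hw_vec m k l)" "inK (of_real lam) 0 (j + 1)"
          using l0 by (simp_all add: R_def j Suc inK_neg_0)
        have "nE c2 (R j) = (\<lambda>k l. r i * nE c2 (hw_vec i) k l)" unfolding Rj nE_scale ..
        also have "\<dots> = (\<lambda>k l. r i * (?E (Suc m) * ?F m * hw_vec m k l))"
          unfolding EF Suc nE_hw_vec using lam by (simp add: add_ac)
        also have "\<dots> = (\<lambda>k l. ?E i * (?F m * r (Suc m)) * hw_vec m k l)" unfolding Suc by (simp only: mult_ac)
        also have "\<dots> = (\<lambda>k l. Ecoef (of_real lam) 0 j * R (j + 1) k l)" unfolding rS[of m, symmetric] jp by (simp only: j mult.assoc)
        finally show ?thesis using jp by simp
      qed
      have jm: "inK (of_real lam) 0 (j - 1)" using l0 by (simp add: j inK_neg_0)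
      have "nF c1 c (R j) = (\<lambda>k l. r i * nF c1 c (hw_vec i) k l)" unfolding Rj nF_scale ..
      also have "\<dots> = (\<lambda>k l. Fcoef (of_real lam) 0 j * R (j - 1) k l)"
        unfolding nF_hw_vec Rm by (simp only: rS[of i] j mult.assoc)
      finally show "nF c1 c (R j) = (\<lambda>k l. if inK (of_real lam) 0 (j - 1) then Fcoef (of_real lam) 0 j * R (j - 1) k l else 0)"
        using jm by simp
    qed
  qed
  moreover have "inK (of_real lam) 0 0" using l0 by (simp add: inK_neg_0)
  ultimately show ?thesis by (rule normal_family_imp_hilbert_submodule)
qed

end

lemma highest_weight_sufficient:
  assumes n: "c1 = 0 \<longrightarrow> n \<ge> 0" and lam: "lam = \<delta> + c + 2 * of_int n" "lam < -1"
  shows "hilbert_submodule (of_real lam) 0 c1 c2 c"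
proof -
  have "(if K k then of_int k - c2 else 1) \<noteq> 0" for k using c2_neq[of k] by auto
  then obtain G0 where G0: "\<And>k. G0 k \<noteq> 0" "\<And>k. G0 (k + 1) = (if K k then of_int k - c2 else 1) * G0 k"
    using int_product_exists[of "\<lambda>k. if K k then of_int k - c2 else 1"] by blast
  show ?thesis
  proof (rule highest_weight_submodule[OF n _ _ lam])
    show "(if K k then G0 k else 0) \<noteq> 0 \<longleftrightarrow> K k" for k using G0 by simp
    show "(if K (k + 1) then G0 (k + 1) else 0) = (of_int k - c2) * (if K k then G0 k else 0)" if "K k" for k
      using that K_add[OF that, of 1] G0(2)[of k] by simp
  qed
qed

end


section \<open>Complementary series submodules and isomorphisms\<close>

context tensor_setup begin

definition Y :: "nat \<Rightarrow> real" where "Y l = (\<Prod>i<l. (real i - c) / (real i + 1))"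

lemma Y_step: "(real l + 1) * Y (Suc l) = (real l - c) * Y l"
  by (simp add: Y_def)

lemma Y_pos: "Y l > 0"
proof -
  have "real i - c > 0" for i using c by (smt (verit) of_nat_0_le_iff)
  then show ?thesis unfolding Y_def by (intro prod_pos) simp
qed

text \<open>For real parameters the eigenvectors in the complementary series have product form
  \<open>\<Sum> X(k) Y(l) x(k) \<otimes> y(l)\<close> on every diagonal; \<open>E_rel\<close> and \<open>F_rel\<close> are what this form requires of \<open>X\<close>.\<close>
lemma product_form_submodule:
  fixes p1 p2 q :: real
  assumes p: "c1 = of_real p1" "c2 = of_real p2"
    and d: "d1 = of_real q" "d1 - d2 = of_real (\<delta> + c)" "d1 \<notin> \<int>" "d2 \<notin> \<int>"
    and q: "2 * q - p1 + p2 - c < -1"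
    and X_nz: "\<And>k. X k \<noteq> 0 \<longleftrightarrow> K k"
    and E_rel: "\<And>k. (c2 - of_int k + 1) * X (k - 1) = (d2 + of_real c + 1 - of_int k) * X k"
    and F_rel: "\<And>k. (c1 + of_int k + 1) * X (k + 1) = (d1 + 1 + of_int k) * X k"
  shows "hilbert_submodule d1 d2 c1 c2 c"
proof -
  define R where "R j k l = (if k = j + int l then X k * of_real (Y l) else 0)" for j k l
  have nn: "\<not> negint d1" "\<not> negint d2" using d by (auto simp: negint_def)
  have Yc: "(of_nat l + 1) * complex_of_real (Y (Suc l)) = (of_nat l - of_real c) * of_real (Y l)" for l
    using arg_cong[OF Y_step[of l], of complex_of_real] by simp
  have "normal_family d1 d2 R"
    unfolding normal_family_def
  proof (intro allI impI conjI)
    fix j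
    show "R j \<in> nHT"
    proof (rule summable_imp_nHT)
      show "K k \<and> k = j + int l" if "R j k l \<noteq> 0" for k l using that X_nz by (auto simp: R_def split: if_splits)
      define T where "T l = (cmod (R j (j + int l) l))\<^sup>2 * \<omega> (j + int l) * om2 c l" for l
      define L where "L = nat (- j)"
      have KL: "K (j + int l)" if "l \<ge> L" for l using that by (auto simp: K_iff L_def)
      have T_eq: "T l = (cmod (X (j + int l)))\<^sup>2 * (Y l)\<^sup>2 * (\<omega> (j + int l) * om2 c l)" for l
        by (simp add: T_def R_def norm_mult power_mult_distrib)
      \<comment> \<open>\<open>?a\<close> is the squared ratio of \<open>X\<close> times the norm
        ratio of the first factor, \<open>?b\<close> the same for \<open>Y\<close> and the second
        factor, expanded by \<open>l + 1\<close> to obtain monic quadratics. The total exponent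
        \<open>2 * q - p1 + p2 - c\<close> is the same on all diagonals.\<close>
      let ?a = "\<lambda>l. ((real l)\<^sup>2 + 2 * (q + 1 + j) * real l + (q + 1 + j)\<^sup>2) / ((real l)\<^sup>2 + (2 * j + 1 + p1 - p2) * real l + (j + 1 + p1) * (j - p2))"
      let ?b = "\<lambda>l. ((real l)\<^sup>2 + (1 - c) * real l + - c) / ((real l)\<^sup>2 + 2 * real l + 1)"
      have "summable T"
      proof (rule ratio_expansion_convergence)
        show "ratio_expansion (\<lambda>l. ?a l * ?b l) ((2 * (q + 1 + j) - (2 * j + 1 + p1 - p2)) + ((1 - c) - 2))"
          by (intro ratio_expansion_mult ratio_expansion_quadratic)
        show "(2 * (q + 1 + j) - (2 * j + 1 + p1 - p2)) + ((1 - c) - 2) < -1" using q by simp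
        show "\<forall>\<^sub>F l in sequentially. 0 < T l"
          unfolding eventually_sequentially T_eq
        proof (intro exI[of _ L] allI impI)
          fix l assume "l \<ge> L"
          then show "0 < (cmod (X (j + int l)))\<^sup>2 * (Y l)\<^sup>2 * (\<omega> (j + int l) * om2 c l)"
            using KL[of l] X_nz Y_pos[of l] \<omega>_pos om2_pos[OF c, of l] by (intro mult_pos_pos zero_less_power) auto
        qed
        show "\<forall>\<^sub>F l in sequentially. T (Suc l) = ?a l * ?b l * T l"
          unfolding eventually_sequentially
        proof (intro exI[of _ L] allI impI)
          fix l assume "l \<ge> L"
          note Kl = KL[OF this]
          define P where "P = of_int j + real l + 1 + p1"
          define Q where "Q = of_int j + real l - p2"
          define N where "N = q + 1 + of_int j + real l"
          have Pc: "c1 + of_int (j + int l) + 1 = of_real P" and Qc: "of_int (j + int l) - c2 = of_real Q"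
            and Nc: "d1 + 1 + of_int (j + int l) = of_real N"
            unfolding p d P_def Q_def N_def by simp_all
          have PQ: "P \<noteq> 0" "Q \<noteq> 0" using c1_neq[OF Kl] c2_neq[OF Kl] Pc Qc by auto
          have l1: "real l + 1 \<noteq> 0" "real l - c \<noteq> 0" using c by auto
          have e: "j + int (Suc l) = (j + int l) + 1" by simp
          have X1: "P\<^sup>2 * (cmod (X (j + int (Suc l))))\<^sup>2 = N\<^sup>2 * (cmod (X (j + int l)))\<^sup>2"
            using arg_cong[OF F_rel[of "j + int l"], of "\<lambda>z. (cmod z)\<^sup>2"] unfolding Pc Nc e
            by (simp add: norm_mult power_mult_distrib)
          have Y1: "(real l + 1)\<^sup>2 * (Y (Suc l))\<^sup>2 = (real l - c)\<^sup>2 * (Y l)\<^sup>2"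
            using arg_cong[OF Y_step[of l], of "\<lambda>z. z\<^sup>2"] by (simp only: power_mult_distrib)
          have AA: "A (j + int l) = P * Q"
            using A_eq[of "j + int l"] unfolding Pc Qc of_real_mult[symmetric] of_real_eq_iff .
          have cq: "(cmod (c2 - of_int (j + int l)))\<^sup>2 = Q\<^sup>2"
            using arg_cong[OF Qc, of "\<lambda>z. (cmod z)\<^sup>2"] by (simp add: norm_minus_commute)
          define V where "V = \<omega> (j + int (Suc l)) * om2 c (Suc l)"
          define V0 where "V0 = \<omega> (j + int l) * om2 c l"
          have V: "V * Q\<^sup>2 * (real l - c) = V0 * (P * Q) * (real l + 1)"
            using \<omega>_om2_step[OF Kl] unfolding cq AA V_def V0_def .
          have "T (Suc l) * (P * Q * (real l + 1)\<^sup>2) * (P * Q * (real l - c))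
            = (P\<^sup>2 * (cmod (X (j + int (Suc l))))\<^sup>2) * ((real l + 1)\<^sup>2 * (Y (Suc l))\<^sup>2) * (V * Q\<^sup>2 * (real l - c))"
            unfolding T_eq V_def by (simp only: power2_eq_square mult_ac)
          also have "\<dots> = T l * (N\<^sup>2 * ((real l + 1) * (real l - c))) * (P * Q * (real l - c))"
            unfolding X1 Y1 V T_eq V0_def by (simp only: power2_eq_square mult_ac)
          finally have "T (Suc l) * (P * Q * (real l + 1)\<^sup>2) = T l * (N\<^sup>2 * ((real l + 1) * (real l - c)))"
            using PQ l1 by simp
          moreover have "u = a / b * (e / f) * v" if "u * (b * f) = v * (a * e)" "b \<noteq> 0" "f \<noteq> 0" for u v a b e f :: real
            using that by (simp add: field_simps)
          moreover have "P * Q \<noteq> 0" "(real l + 1)\<^sup>2 \<noteq> 0" using PQ l1 by simp_all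
          ultimately have "T (Suc l) = N\<^sup>2 / (P * Q) * ((real l + 1) * (real l - c) / (real l + 1)\<^sup>2) * T l" by blast
          moreover have "N\<^sup>2 = (real l)\<^sup>2 + 2 * (q + 1 + j) * real l + (q + 1 + j)\<^sup>2"
            "P * Q = (real l)\<^sup>2 + (2 * j + 1 + p1 - p2) * real l + (j + 1 + p1) * (j - p2)"
            "(real l + 1) * (real l - c) = (real l)\<^sup>2 + (1 - c) * real l + - c"
            "(real l + 1)\<^sup>2 = (real l)\<^sup>2 + 2 * real l + 1"
            unfolding P_def Q_def N_def by (simp_all add: power2_eq_square algebra_simps)
          ultimately show "T (Suc l) = ?a l * ?b l * T l" by (simp only:)
        qed
      qed
      then show "summable (\<lambda>l. (cmod (R j (j + int l) l))\<^sup>2 * \<omega> (j + int l) * om2 c l)" unfolding T_def .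
    qed
    show "\<exists>k l. R j k l \<noteq> 0"
    proof -
      have "K (j + int (nat (- j)))" by (simp add: K_iff)
      then have "R j (j + int (nat (- j))) (nat (- j)) \<noteq> 0" using X_nz Y_pos[of "nat (- j)"] by (simp add: R_def)
      then show ?thesis by blast
    qed
    show "Hcoef d1 d2 j = of_real (\<delta> + c + 2 * of_int (k - int l))" if "R j k l \<noteq> 0" for k l
    proof -
      have "k = j + int l" using that by (auto simp: R_def split: if_splits)
      then show ?thesis using d(2) by (simp add: Hcoef_def)
    qed
    show "nE c2 (R j) = (\<lambda>k l. if inK d1 d2 (j + 1) then Ecoef d1 d2 j * R (j + 1) k l else 0)"
    proof (intro ext)
      fix k l
      have "nE c2 (R j) k l = (d2 - of_int j) * R (j + 1) k l"
      proof (cases "k = j + 1 + int l")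
        case True
        have "nE c2 (R j) k l = ((c2 - of_int k + 1) * X (k - 1)) * of_real (Y l) + X k * ((of_nat l + 1) * of_real (Y (Suc l)))"
          using True by (simp add: nE_def R_def mult_ac)
        also have "\<dots> = (d2 + of_real c + 1 - of_int k) * X k * of_real (Y l) + X k * ((of_nat l - of_real c) * of_real (Y l))"
          unfolding Yc E_rel ..
        also have "\<dots> = (d2 - of_int j) * (X k * of_real (Y l))" using True by (simp add: algebra_simps)
        finally show ?thesis using True by (simp add: R_def)
      qed (auto simp: nE_def R_def)
      then show "nE c2 (R j) k l = (if inK d1 d2 (j + 1) then Ecoef d1 d2 j * R (j + 1) k l else 0)"
        using nn not_Ints_inK[OF d(3,4)] by (simp add: Ecoef_def)
    qed
    show "nF c1 c (R j) = (\<lambda>k l. if inK d1 d2 (j - 1) then Fcoef d1 d2 j * R (j - 1) k l else 0)"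
    proof (intro ext)
      fix k l
      have "nF c1 c (R j) k l = (d1 + of_int j) * R (j - 1) k l"
      proof (cases "k = j - 1 + int l")
        case True
        have "(if l = 0 then 0 else (of_real c - of_nat l + 1) * R j k (l - 1)) = - of_nat l * (X k * of_real (Y l))"
        proof (cases l)
          case (Suc m)
          have "(of_real c - of_nat l + 1) * R j k (l - 1) = - X k * ((of_nat m - of_real c) * of_real (Y m))"
            using True by (simp add: R_def Suc algebra_simps)
          then show ?thesis unfolding Yc[symmetric] by (simp add: Suc algebra_simps)
        qed simp
        moreover have "(c1 + of_int k + 1) * R j (k + 1) l = ((c1 + of_int k + 1) * X (k + 1)) * of_real (Y l)"
          using True by (simp add: R_def)
        ultimately have "nF c1 c (R j) k l = ((d1 + 1 + of_int k) * X k) * of_real (Y l) + - of_nat l * (X k * of_real (Y l))"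
          unfolding nF_def F_rel by (simp only:)
        moreover have "of_int k = (of_int j - 1 + of_nat l :: complex)" using True by simp
        moreover have "R (j - 1) k l = X k * of_real (Y l)" using True by (simp add: R_def)
        ultimately show ?thesis by (simp add: algebra_simps)
      next
        case False
        then show ?thesis by (auto simp: nF_def R_def of_nat_diff)
      qed
      then show "nF c1 c (R j) k l = (if inK d1 d2 (j - 1) then Fcoef d1 d2 j * R (j - 1) k l else 0)"
        using nn not_Ints_inK[OF d(3,4)] by (simp add: Fcoef_def)
    qed
  qed
  then show ?thesis using not_Ints_inK[OF d(3,4)] by (rule normal_family_imp_hilbert_submodule)
qed

text \<open>Here \<open>X(k)\<close> is, up to a constant, the inverse of the weight of \<open>x(k)\<close>.\<close>
lemma complementary_sufficient_plus:
  fixes p1 p2 :: real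
  assumes p: "c1 = of_real p1" "c2 = of_real p2" and s: "p1 + p2 + 1 > - c"
    and d: "d1 = -1 - c2" "d2 = -1 - c1 - of_real c" "d1 \<notin> \<int>" "d2 \<notin> \<int>"
  shows "hilbert_submodule d1 d2 c1 c2 c"
proof -
  let ?r = "\<lambda>k. if K k then (of_int k - c2) / (c1 + of_int k + 1) else 1"
  have "?r k \<noteq> 0" for k using c2_neq[of k] c1_neq[of k] by auto
  then obtain X0 where X0: "\<And>k. X0 k \<noteq> 0" "\<And>k. X0 (k + 1) = ?r k * X0 k"
    using int_product_exists[of ?r] by blast
  define X where "X k = (if K k then X0 k else 0)" for k
  have X_nz: "X k \<noteq> 0 \<longleftrightarrow> K k" for k using X0 by (simp add: X_def)
  have X_rel: "(c1 + of_int k + 1) * X (k + 1) = (of_int k - c2) * X k" for k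
  proof (cases "K k")
    case True
    then show ?thesis using X0(2)[of k] K_add[OF True, of 1] c1_neq[OF True] by (simp add: X_def)
  next
    case False
    have "(c1 + of_int k + 1) * X (k + 1) = 0"
    proof (cases "k = -1")
      case True
      then show ?thesis using False by (simp add: K_iff)
    next
      case k: False
      then have "\<not> K (k + 1)" using False unfolding K_iff by auto
      then show ?thesis using X_nz by auto
    qed
    moreover have "X k = 0" using False X_nz by blast
    ultimately show ?thesis by simp
  qed
  show ?thesis
  \<comment> \<open>With this \<open>X\<close> the operator F has the coefficient
    \<open>k - c2\<close>, which has to be \<open>d1 + 1 + k\<close>. So the product form yields the
    reflected copy of N(c1 + c, c2).\<close>
  proof (rule product_form_submodule[OF p, where q = "-1 - p2" and X = X])
    show "d1 - d2 = of_real (\<delta> + c)" using \<delta> by (simp add: d algebra_simps)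
    show "(c2 - of_int k + 1) * X (k - 1) = (d2 + of_real c + 1 - of_int k) * X k" for k
      using X_rel[of "k - 1"] by (simp add: d algebra_simps)
    show "(c1 + of_int k + 1) * X (k + 1) = (d1 + 1 + of_int k) * X k" for k
      unfolding X_rel by (simp add: d)
  qed (use p d s X_nz in auto)
qed

text \<open>Constant \<open>X\<close> works: on a diagonal the vector is then \<open>Y\<close>, the
  factor \<open>Z\<close> of \<open>real_parameters_point_mass_minus\<close>, that is, the constant
  solution of the renormalised recurrence.\<close>

lemma complementary_sufficient_minus:
  fixes p1 p2 :: real
  assumes p: "c1 = of_real p1" "c2 = of_real p2" and c1_Ints: "c1 \<notin> \<int>" and s: "p1 + p2 + 1 < c"
    and d: "d1 = c1" "d2 = c2 - of_real c" "d2 \<notin> \<int>"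
  shows "hilbert_submodule d1 d2 c1 c2 c"
proof (rule product_form_submodule[OF p, where q = p1 and X = "\<lambda>_. 1"])
  show "d1 - d2 = of_real (\<delta> + c)" using \<delta> by (simp add: d)
  have "c1 \<noteq> 0" using c1_Ints by auto
  then show "(1::complex) \<noteq> 0 \<longleftrightarrow> K k" for k by (simp add: K_iff)
qed (use p d s c1_Ints in auto)

lemma highest_weight_of_submodule:
  assumes hs: "hilbert_submodule d1 d2 c1 c2 c" and j: "inK d1 d2 j" "\<not> inK d1 d2 (j + 1)"
    and lam: "Hcoef d1 d2 j = of_real lam"
  shows "\<exists>n. lam = \<delta> + c + 2 * of_int n \<and> lam < -1 \<and> (c1 = 0 \<longrightarrow> 0 \<le> n)"
proof -
  obtain R where "normal_family d1 d2 R" using hilbert_submodule_imp_normal_family[OF hs] by blast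
  note R = this[unfolded normal_family_def, rule_format, OF j(1)]
  show ?thesis
  proof (rule highest_weight_necessary[of "R j"])
    show "R j \<in> nHT" "\<exists>k l. R j k l \<noteq> 0" using R by blast+
    show "lam = \<delta> + c + 2 * of_int (k - int l)" if "R j k l \<noteq> 0" for k l
      using R that lam by (metis of_real_eq_iff)
    show "nE c2 (R j) = (\<lambda>k l. 0)" using R j(2) by simp
  qed
qed

lemma no_lowest_weight_submodule:
  assumes "c1 \<notin> \<int>" and hs: "hilbert_submodule d1 d2 c1 c2 c" and j: "inK d1 d2 j" "\<not> inK d1 d2 (j - 1)"
  shows False
proof -
  obtain R where "normal_family d1 d2 R" using hilbert_submodule_imp_normal_family[OF hs] by blast
  note R = this[unfolded normal_family_def, rule_format, OF j(1)]
  have "nF c1 c (R j) = (\<lambda>k l. 0)" using R j(2) by simp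
  then have "R j k l = 0" for k l by (rule nF_zero_imp_zero[OF assms(1)])
  then show False using R by blast
qed

end

section \<open>Isomorphisms among the modules\<close>

lemma Niso_trans:
  assumes "Niso d1 d2 e1 e2" "Niso e1 e2 f1 f2"
  shows "Niso d1 d2 f1 f2"
proof -
  obtain T where T: "bij_betw T (Nvec d1 d2) (Nvec e1 e2)"
    "\<And>v w. v \<in> Nvec d1 d2 \<Longrightarrow> w \<in> Nvec d1 d2 \<Longrightarrow> T (\<lambda>k. v k + w k) = (\<lambda>k. T v k + T w k)"
    "\<And>v a. v \<in> Nvec d1 d2 \<Longrightarrow> T (\<lambda>k. a * v k) = (\<lambda>k. a * T v k)"
    "\<And>v. v \<in> Nvec d1 d2 \<Longrightarrow> T (actH d1 d2 v) = actH e1 e2 (T v) \<and>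
       T (actE d1 d2 v) = actE e1 e2 (T v) \<and> T (actF d1 d2 v) = actF e1 e2 (T v)"
    using assms(1) unfolding Niso_def by blast
  obtain U where U: "bij_betw U (Nvec e1 e2) (Nvec f1 f2)"
    "\<And>v w. v \<in> Nvec e1 e2 \<Longrightarrow> w \<in> Nvec e1 e2 \<Longrightarrow> U (\<lambda>k. v k + w k) = (\<lambda>k. U v k + U w k)"
    "\<And>v a. v \<in> Nvec e1 e2 \<Longrightarrow> U (\<lambda>k. a * v k) = (\<lambda>k. a * U v k)"
    "\<And>v. v \<in> Nvec e1 e2 \<Longrightarrow> U (actH e1 e2 v) = actH f1 f2 (U v) \<and>
       U (actE e1 e2 v) = actE f1 f2 (U v) \<and> U (actF e1 e2 v) = actF f1 f2 (U v)"
    using assms(2) unfolding Niso_def by blast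
  have TN: "T v \<in> Nvec e1 e2" if "v \<in> Nvec d1 d2" for v using T(1) that by (rule bij_betw_apply)
  show ?thesis
    unfolding Niso_def
    by (rule exI[of _ "U \<circ> T"]) (auto simp: bij_betw_trans[OF T(1) U(1)] T(2-4) U(2-4) TN)
qed

text \<open>The reflection keeps \<open>b1 - b2\<close> and changes the sign of
  \<open>b1 + b2 + 1\<close>, so weights and Casimir eigenvalue agree; a diagonal rescaling
  \<open>\<rho>\<close> of the basis does the rest.\<close>

lemma Niso_reflect:
  assumes b: "b1 \<notin> \<int>" "b2 \<notin> \<int>"
  shows "Niso b1 b2 (-1 - b2) (-1 - b1)"
proof -
  have b1: "b1 + of_int k \<noteq> 0" for k
    using b(1) by (metis Ints_of_int add_eq_0_iff2 of_int_minus)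
  have b2: "b2 - of_int k \<noteq> 0" for k using b(2) by auto
  have b': "-1 - b2 \<notin> \<int>" "-1 - b1 \<notin> \<int>"
    using b by (metis Ints_1 Ints_diff Ints_minus diff_diff_eq2 diff_add_cancel minus_diff_eq add_diff_cancel)+
  have r: "(-1 - b1 - of_int k) / (b2 - of_int k) \<noteq> 0" for k
  proof -
    have e: "-1 - b1 - of_int k = - (b1 + of_int (k + 1))" by simp
    show ?thesis unfolding e using b1[of "k + 1"] b2[of k] by (simp only: divide_eq_0_iff neg_equal_0_iff_equal) simp
  qed
  obtain \<rho> where \<rho>: "\<And>k. \<rho> k \<noteq> 0" "\<And>k. \<rho> (k + 1) = (-1 - b1 - of_int k) / (b2 - of_int k) * \<rho> k"
    using int_product_exists[of "\<lambda>k. (-1 - b1 - of_int k) / (b2 - of_int k)", OF r] by blast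
  have \<rho>1: "\<rho> (k + 1) * (b2 - of_int k) = (-1 - b1 - of_int k) * \<rho> k" for k using \<rho>(2)[of k] b2[of k] by simp
  have K: "inK b1 b2 k" "inK (-1 - b2) (-1 - b1) k" for k using b b' by (auto simp: inK_def)
  have N: "\<not> negint b1" "\<not> negint b2" "\<not> negint (-1 - b1)" "\<not> negint (-1 - b2)" using b b' by (auto simp: negint_def)
  have Nv: "Nvec b1 b2 = {v. finite {k. v k \<noteq> 0}}" "Nvec (-1 - b2) (-1 - b1) = {v. finite {k. v k \<noteq> 0}}"
    using K by (auto simp: Nvec_def)
  show ?thesis
    unfolding Niso_def
  proof (rule exI[of _ "\<lambda>v k. \<rho> k * v k"], intro conjI ballI allI)
    show "bij_betw (\<lambda>v k. \<rho> k * v k) (Nvec b1 b2) (Nvec (-1 - b2) (-1 - b1))"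
      unfolding Nv using \<rho>(1) by (intro bij_betwI[where g = "\<lambda>v k. v k / \<rho> k"]) auto
    fix v
    show "(\<lambda>k. \<rho> k * actH b1 b2 v k) = actH (-1 - b2) (-1 - b1) (\<lambda>k. \<rho> k * v k)"
      by (auto simp: actH_def K Hcoef_def algebra_simps)
    show "(\<lambda>k. \<rho> k * actE b1 b2 v k) = actE (-1 - b2) (-1 - b1) (\<lambda>k. \<rho> k * v k)"
    proof
      fix k
      have "\<rho> k * (b2 - of_int (k - 1)) = (-1 - b1 - of_int (k - 1)) * \<rho> (k - 1)" using \<rho>1[of "k - 1"] by simp
      then have "\<rho> k * (b2 - of_int (k - 1)) * v (k - 1) = (-1 - b1 - of_int (k - 1)) * \<rho> (k - 1) * v (k - 1)" by (rule arg_cong)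
      then show "\<rho> k * actE b1 b2 v k = actE (-1 - b2) (-1 - b1) (\<lambda>k. \<rho> k * v k) k"
        using N by (simp only: actE_def K Ecoef_def simp_thms if_True mult.assoc)
    qed
    show "(\<lambda>k. \<rho> k * actF b1 b2 v k) = actF (-1 - b2) (-1 - b1) (\<lambda>k. \<rho> k * v k)"
    proof
      fix k
      have "\<rho> k * (b1 + of_int (k + 1)) = (-1 - b2 + of_int (k + 1)) * \<rho> (k + 1)" using \<rho>1[of k] by (simp add: algebra_simps)
      then have "\<rho> k * (b1 + of_int (k + 1)) * v (k + 1) = (-1 - b2 + of_int (k + 1)) * \<rho> (k + 1) * v (k + 1)" by (rule arg_cong)
      then show "\<rho> k * actF b1 b2 v k = actF (-1 - b2) (-1 - b1) (\<lambda>k. \<rho> k * v k) k"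
        using N by (simp only: actF_def K Fcoef_def simp_thms if_True mult.assoc)
    qed
  qed (auto simp: algebra_simps)
qed

lemma isoclass_reflect:
  assumes b: "b1 \<notin> \<int>" "b2 \<notin> \<int>"
  shows "isoclass (-1 - b2, -1 - b1) = isoclass (b1, b2)"
proof -
  have b': "-1 - b2 \<notin> \<int>" "-1 - b1 \<notin> \<int>"
    using b by (metis Ints_1 Ints_diff Ints_minus diff_diff_eq2 diff_add_cancel minus_diff_eq add_diff_cancel)+
  have "Niso (-1 - b2) (-1 - b1) b1 b2" using Niso_reflect[OF b'] by simp
  then show ?thesis using Niso_reflect[OF b] unfolding isoclass_def by (auto intro: Niso_trans)
qed


section \<open>The discrete spectrum\<close>

lemma open_unit_not_Ints: "-1 < r \<Longrightarrow> r < 0 \<Longrightarrow> complex_of_real r \<notin> \<int>"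
proof
  assume r: "-1 < r" "r < 0" and "complex_of_real r \<in> \<int>"
  then have "r \<in> \<int>" by simp
  then obtain i where "r = of_int i" by (auto elim: Ints_cases)
  then have "real_of_int (-1) < real_of_int i" "real_of_int i < real_of_int 0" using r by simp_all
  then have "-1 < i" "i < 0" by (simp_all only: of_int_less_iff)
  then show False by simp
qed

text \<open>Both \<open>b1 - b2\<close> and \<open>e1 - e2\<close> lie strictly between -1 and 1, so
  no nonzero even shift is possible; the two signs of the square root are related by
  reflection.\<close>

lemma complementary_isoclass:
  fixes b1 b2 e1 e2 :: real
  assumes b: "-1 < b1" "b1 < 0" "-1 < b2" "b2 < 0" and e: "-1 < e1" "e1 < 0" "-1 < e2" "e2 < 0"
    and S: "((b1 + b2 + 1) / 2)\<^sup>2 = ((e1 + e2 + 1) / 2)\<^sup>2"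
    and wt: "b1 - b2 = e1 - e2 + 2 * of_int n"
  shows "isoclass (of_real b1, of_real b2) = isoclass (of_real e1, of_real e2)"
proof -
  have "n = 0"
  proof -
    have "real_of_int n < real_of_int 1" "real_of_int n > real_of_int (-1)" using b e wt by simp_all
    then have "n < 1" "n > -1" by (simp_all only: of_int_less_iff)
    then show ?thesis by simp
  qed
  then have wt': "b1 - b2 = e1 - e2" using wt by simp
  have "b1 + b2 + 1 = e1 + e2 + 1 \<or> b1 + b2 + 1 = - (e1 + e2 + 1)"
  proof -
    have "(b1 + b2 + 1) / 2 = (e1 + e2 + 1) / 2 \<or> (b1 + b2 + 1) / 2 = - ((e1 + e2 + 1) / 2)"
      using S by (simp only: power2_eq_iff)
    then show ?thesis
    proof
      assume "(b1 + b2 + 1) / 2 = - ((e1 + e2 + 1) / 2)"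
      then have "b1 + b2 + 1 = - (e1 + e2 + 1)" by (simp add: field_simps)
      then show ?thesis ..
    qed simp
  qed
  then show ?thesis
  proof
    assume "b1 + b2 + 1 = e1 + e2 + 1"
    then have "b1 = e1" "b2 = e2" using wt' by linarith+
    then show ?thesis by simp
  next
    assume "b1 + b2 + 1 = - (e1 + e2 + 1)"
    then have "b1 = -1 - e2" "b2 = -1 - e1" using wt' by linarith+
    then show ?thesis using isoclass_reflect[OF open_unit_not_Ints[OF e(1,2)] open_unit_not_Ints[OF e(3,4)]] by simp
  qed
qed

text \<open>The principal series parametrisation contains the pairs (-1 - i, i) with integral i.
  Their modules are not doubly infinite but have highest weight -1 or lowest weight 1 (limits of
  discrete series), whence the two extra cases. Nonintegral x with \<open>y = 0\<close> stays in the
  case \<open>principal\<close>, with \<open>S = 0\<close>.\<close>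

lemma candidate_cases:
  assumes "candidate d"
  obtains (highest) lam where "lam < 0" "d = (complex_of_real lam, 0)"
  | (lowest) lam where "lam < 0" "d = (0, complex_of_real lam)"
  | (principal) S where "fst d \<notin> \<int>" "snd d \<notin> \<int>" "((fst d + snd d + 1) / 2)\<^sup>2 = complex_of_real S" "S \<le> 0"
  | (highest_limit) j where "inK (fst d) (snd d) j" "\<not> inK (fst d) (snd d) (j + 1)" "Hcoef (fst d) (snd d) j = complex_of_real (-1)"
  | (lowest_limit) j where "inK (fst d) (snd d) j" "\<not> inK (fst d) (snd d) (j - 1)" "Hcoef (fst d) (snd d) j = complex_of_real 1"
  | (complementary) b1 b2 :: real where "-1 < b1" "b1 < 0" "-1 < b2" "b2 < 0" "d = (complex_of_real b1, complex_of_real b2)"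
proof -
  consider (1) lam :: real where "lam < 0" "d = (complex_of_real lam, 0)"
    | (2) lam :: real where "lam < 0" "d = (0, complex_of_real lam)"
    | (3) x y :: real where "d = (- 1 - complex_of_real x + \<i> * complex_of_real y, complex_of_real x + \<i> * complex_of_real y)"
    | (4) b1 b2 :: real where "-1 < b1" "b1 < 0" "-1 < b2" "b2 < 0" "d = (complex_of_real b1, complex_of_real b2)"
    using assms unfolding candidate_def by blast
  then show thesis
  proof cases
    case (3 x y)
    show thesis
    proof (cases "y = 0 \<and> x \<in> \<int>")
      case False
      have "fst d \<notin> \<int>"
      proof
        assume "fst d \<in> \<int>"
        then obtain i where i: "- 1 - complex_of_real x + \<i> * complex_of_real y = of_int i" using 3 by (auto elim: Ints_cases)
        have "y = 0" using arg_cong[OF i, of Im] by simp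
        moreover have "x = of_int (- 1 - i)" using arg_cong[OF i, of Re] by simp
        ultimately show False using False by (metis Ints_of_int)
      qed
      moreover have "snd d \<notin> \<int>"
      proof
        assume "snd d \<in> \<int>"
        then obtain i where i: "complex_of_real x + \<i> * complex_of_real y = of_int i" using 3 by (auto elim: Ints_cases)
        have "y = 0" using arg_cong[OF i, of Im] by simp
        moreover have "x = of_int i" using arg_cong[OF i, of Re] by simp
        ultimately show False using False by (metis Ints_of_int)
      qed
      moreover have "((fst d + snd d + 1) / 2)\<^sup>2 = complex_of_real (- (y\<^sup>2))"
        using 3 by (simp add: power_mult_distrib)
      ultimately show thesis by (rule principal) simp
    next
      case True
      then obtain i where i: "x = of_int i" by (auto elim: Ints_cases)
      have d: "d = (of_int (- 1 - i), of_int i)" using 3 True i by simp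
      show thesis
      proof (cases "i \<ge> 0")
        case i0: True
        show thesis
        proof (rule highest_limit[of i])
          show "inK (fst d) (snd d) i" "\<not> inK (fst d) (snd d) (i + 1)" using i0 by (auto simp: d inK_def)
          show "Hcoef (fst d) (snd d) i = complex_of_real (-1)" by (simp add: d Hcoef_def)
        qed
      next
        case i0: False
        show thesis
        proof (rule lowest_limit[of "i + 1"])
          show "inK (fst d) (snd d) (i + 1)" "\<not> inK (fst d) (snd d) (i + 1 - 1)" using i0 by (auto simp: d inK_def)
          show "Hcoef (fst d) (snd d) (i + 1) = complex_of_real 1" by (simp add: d Hcoef_def)
        qed
      qed
    qed
  qed (rule highest lowest complementary, assumption+)+
qed

lemma disc_spectrum_eqI:
  assumes "\<And>d. candidate d \<Longrightarrow> hilbert_submodule (fst d) (snd d) c1 c2 c \<Longrightarrow> isoclass d \<in> isoclass ` S"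
    and "\<And>e. e \<in> S \<Longrightarrow> \<exists>d. candidate d \<and> hilbert_submodule (fst d) (snd d) c1 c2 c \<and> isoclass d = isoclass e"
  shows "disc_spectrum c1 c2 c = isoclass ` S"
  unfolding disc_spectrum_def
proof (intro equalityI subsetI)
  fix X assume "X \<in> {isoclass d |d. candidate d \<and> hilbert_submodule (fst d) (snd d) c1 c2 c}"
  then show "X \<in> isoclass ` S" using assms(1) by blast
next
  fix X assume "X \<in> isoclass ` S"
  then obtain e where e: "e \<in> S" "X = isoclass e" by blast
  obtain d where "candidate d \<and> hilbert_submodule (fst d) (snd d) c1 c2 c" "isoclass d = isoclass e"
    using assms(2)[OF e(1)] by blast
  then show "X \<in> {isoclass d |d. candidate d \<and> hilbert_submodule (fst d) (snd d) c1 c2 c}"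
    unfolding e(2) by (intro CollectI exI[of _ d]) simp
qed

lemma candidate_highest: "lam < 0 \<Longrightarrow> candidate (complex_of_real lam, 0)"
  by (auto simp: candidate_def)

lemma candidate_lowest: "lam < 0 \<Longrightarrow> candidate (0, complex_of_real lam)"
  by (auto simp: candidate_def)

lemma candidate_complementary:
  "-1 < b1 \<Longrightarrow> b1 < 0 \<Longrightarrow> -1 < b2 \<Longrightarrow> b2 < 0 \<Longrightarrow> candidate (complex_of_real b1, complex_of_real b2)"
  unfolding candidate_def by blast

context tensor_setup begin

lemma highest_candidate_necessary:
  assumes "lam < 0" "hilbert_submodule (of_real lam) 0 c1 c2 c"
  shows "\<exists>n. lam = \<delta> + c + 2 * of_int n \<and> lam < -1 \<and> (c1 = 0 \<longrightarrow> 0 \<le> n)"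
proof (rule highest_weight_of_submodule[OF assms(2)])
  show "inK (of_real lam) 0 0" "\<not> inK (of_real lam) 0 (0 + 1)" using assms(1) by (simp_all add: inK_neg_0)
  show "Hcoef (of_real lam) 0 0 = of_real lam" by (simp add: Hcoef_def)
qed

lemma candidate_necessary:
  assumes c1: "c1 \<notin> \<int>" and cand: "candidate d" and hs: "hilbert_submodule (fst d) (snd d) c1 c2 c"
  obtains (highest) n where "\<delta> + c + 2 * of_int n < -1" "d = (complex_of_real (\<delta> + c + 2 * of_int n), 0)"
  | (limit) "g > c\<^sup>2 / 4" "fst d \<notin> \<int>" "snd d \<notin> \<int>" "((fst d + snd d + 1) / 2)\<^sup>2 = complex_of_real 0"
  | (complementary) b1 b2 :: real where "g > c\<^sup>2 / 4" "-1 < b1" "b1 < 0" "-1 < b2" "b2 < 0"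
      "d = (complex_of_real b1, complex_of_real b2)"
  using cand
proof (cases rule: candidate_cases)
  case (highest lam)
  then show ?thesis using highest_candidate_necessary[of lam] hs that(1) by auto
next
  case (lowest lam)
  have "inK (fst d) (snd d) 0" "\<not> inK (fst d) (snd d) (0 - 1)" using lowest by (auto simp: inK_0_neg)
  then show ?thesis using no_lowest_weight_submodule[OF c1 hs] by blast
next
  case (principal S)
  \<comment> \<open>The principal series has \<open>S \<le> 0\<close> and a submodule needs
    \<open>S \<ge> 0\<close>; the value 0 is left to the case \<open>limit\<close>.\<close>
  note nec = doubly_infinite_necessary[OF hs principal(1-3)]
  then have "S = 0" using principal by simp
  then show ?thesis using that(2) principal nec by simp
next
  case (highest_limit j)
  \<comment> \<open>The weight -1 is just the boundary value excluded by
    \<open>lam < -1\<close>.\<close>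
  then show ?thesis using highest_weight_of_submodule[OF hs highest_limit] by simp
next
  case (lowest_limit j)
  then show ?thesis using no_lowest_weight_submodule[OF c1 hs] by blast
next
  case (complementary b1 b2)
  have "((fst d + snd d + 1) / 2)\<^sup>2 = of_real (((b1 + b2 + 1) / 2)\<^sup>2)" using complementary by simp
  moreover have "fst d \<notin> \<int>" "snd d \<notin> \<int>" using complementary open_unit_not_Ints[of b1] open_unit_not_Ints[of b2] by auto
  ultimately have "g > c\<^sup>2 / 4" using doubly_infinite_necessary(2)[OF hs] by blast
  then show ?thesis using that(3) complementary by blast
qed

end

section \<open>The three kinds of first factor\<close>

lemma tensor_setup_lowest:
  assumes a: "a < 0" and b: "b < 0"
  shows "tensor_setup 0 (of_real a) b (- a) (((a + 1) / 2)\<^sup>2)"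
proof
  have w: "w1 0 (of_real a) k = om2 a (nat k) * (cmod (rescale (of_real a) (nat k)))\<^sup>2" if "k \<ge> 0" for k
    using that by (simp add: w1_0_eq_w2[OF a that] om2_def rescale_nonzero)
  have om: "om1 0 (of_real a) k = om2 a (nat k)" if "k \<ge> 0" for k
    using w[OF that] by (simp add: om1_def rescale_nonzero)
  show "b < 0" by (rule b)
  show "0 - complex_of_real a = complex_of_real (- a)" by simp
  show "((0 + complex_of_real a + 1) / 2)\<^sup>2 = complex_of_real (((a + 1) / 2)\<^sup>2)" by simp
  show "(0::complex) = 0 \<and> complex_of_real a \<in> \<real> \<and> Re (complex_of_real a) < 0 \<or> (0::complex) \<notin> \<int> \<and> complex_of_real a \<notin> \<int>"
    using a by simp
  show "w1 0 (of_real a) k > 0" if "inK 0 (of_real a) k" for k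
    using that a om2_pos[OF a] by (simp add: inK_0_neg w rescale_nonzero)
  show "om1 0 (of_real a) (k + 1) * (cmod (complex_of_real a - of_int k))\<^sup>2
      = om1 0 (of_real a) k * ((of_int k + (1 + - a) / 2)\<^sup>2 - ((a + 1) / 2)\<^sup>2)" if "inK 0 (of_real a) k" for k
  proof -
    have k: "k \<ge> 0" using that a by (simp add: inK_0_neg)
    then obtain n where n: "k = int n" by (metis nonneg_int_cases)
    have "complex_of_real a - of_int k = of_real (a - real n)" by (simp add: n)
    then have "(cmod (complex_of_real a - of_int k))\<^sup>2 = (real n - a)\<^sup>2"
      by (simp only: norm_of_real power2_abs power2_commute)
    moreover have "om1 0 (of_real a) (k + 1) = om2 a (Suc n)" "om1 0 (of_real a) k = om2 a n"
      using om[of "k + 1"] om[of k] n by (simp_all add: nat_add_distrib)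
    moreover have "om2 a (Suc n) * (real n - a)\<^sup>2 = om2 a n * (real n + 1) * (real n - a)"
      unfolding om2_step[OF a, symmetric] by (simp add: power2_eq_square)
    moreover have "(of_int k + (1 + - a) / 2)\<^sup>2 - ((a + 1) / 2)\<^sup>2 = (real n + 1) * (real n - a)"
      by (simp add: n power2_eq_square field_simps)
    ultimately show ?thesis by (simp only: mult.assoc)
  qed
qed

text \<open>Numerators and denominators in the norm products coincide, so every basis vector has
  norm 1.\<close>

lemma tensor_setup_principal:
  fixes x y :: real
  assumes y: "y \<noteq> 0" and a: "a < 0"
  shows "tensor_setup (- 1 - complex_of_real x + \<i> * complex_of_real y) (complex_of_real x + \<i> * complex_of_real y) a
      (- 1 - 2 * x) (- (y\<^sup>2))"
proof -
  let ?c1 = "- 1 - complex_of_real x + \<i> * complex_of_real y" and ?c2 = "complex_of_real x + \<i> * complex_of_real y"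
  have not_Ints: "?c1 \<notin> \<int>" "?c2 \<notin> \<int>" using y by (auto simp: complex_is_Int_iff)
  then have ni: "\<not> negint ?c2" by (simp add: negint_def)
  have nz: "of_nat j - 1 - complex_of_real x + \<i> * complex_of_real y \<noteq> 0" "of_nat j + complex_of_real x - \<i> * complex_of_real y \<noteq> 0" for j
    using y by (auto simp: complex_eq_iff)
  have f1: "(of_nat j + ?c1) / (of_nat j - 1 - cnj ?c2) = 1" for j
    using nz(1)[of j] by (simp add: algebra_simps)
  have f2: "(of_nat j + cnj ?c2) / (of_nat j - 1 - ?c1) = 1" for j
    using nz(2)[of j] by (simp add: algebra_simps)
  have w: "w1 ?c1 ?c2 k = 1" for k unfolding w1_def f1 f2 using ni by simp
  have om: "om1 ?c1 ?c2 k = 1" for k using w ni by (simp add: om1_def rescale_def)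
  show ?thesis
  proof
    show "a < 0" by (rule a)
    show "?c1 - ?c2 = complex_of_real (- 1 - 2 * x)" by simp
    show "((?c1 + ?c2 + 1) / 2)\<^sup>2 = complex_of_real (- (y\<^sup>2))" by (simp add: power_mult_distrib)
    show "?c1 = 0 \<and> ?c2 \<in> \<real> \<and> Re ?c2 < 0 \<or> ?c1 \<notin> \<int> \<and> ?c2 \<notin> \<int>" using not_Ints by blast
    show "w1 ?c1 ?c2 k > 0" for k by (simp only: w)
    show "om1 ?c1 ?c2 (k + 1) * (cmod (?c2 - of_int k))\<^sup>2 = om1 ?c1 ?c2 k * ((of_int k + (1 + (- 1 - 2 * x)) / 2)\<^sup>2 - - (y\<^sup>2))" for k
    proof -
      have "(cmod (?c2 - of_int k))\<^sup>2 = (x - of_int k)\<^sup>2 + y\<^sup>2" unfolding cmod_power2 by simp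
      then show ?thesis unfolding om by (simp add: power2_commute)
    qed
  qed
qed

lemma w1_of_real:
  assumes "\<not> negint (complex_of_real p2)"
  shows "w1 (of_real p1) (of_real p2) k = (if k \<ge> 0 then \<Prod>j\<in>{1..nat k}. (real j + p1) / (real j - 1 - p2)
    else \<Prod>j\<in>{1..nat (- k)}. (real j + p2) / (real j - 1 - p1))"
proof -
  have "(of_nat j + complex_of_real p) / (of_nat j - 1 - complex_of_real p') = of_real ((real j + p) / (real j - 1 - p'))" for j p p'
    by simp
  then show ?thesis using assms by (auto simp: w1_def simp del: of_real_divide of_real_prod simp flip: of_real_prod)
qed

lemma tensor_setup_complementary:
  fixes p1 p2 :: real
  assumes p1: "-1 < p1" "p1 < 0" and p2: "-1 < p2" "p2 < 0" and a: "a < 0"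
  shows "tensor_setup (of_real p1) (of_real p2) a (p1 - p2) (((p1 + p2 + 1) / 2)\<^sup>2)"
proof -
  have not_Ints: "complex_of_real p1 \<notin> \<int>" "complex_of_real p2 \<notin> \<int>" by (rule open_unit_not_Ints[OF p1], rule open_unit_not_Ints[OF p2])
  then have ni: "\<not> negint (complex_of_real p2)" by (simp add: negint_def)
  have f: "(real j + p) / (real j - 1 - p') > 0" if "j \<ge> 1" "-1 < p" "p' < 0" for j p p'
    using that by (intro divide_pos_pos) auto
  have om: "om1 (of_real p1) (of_real p2) k = w1 (of_real p1) (of_real p2) k" for k
    using ni by (simp add: om1_def rescale_def)
  show ?thesis
  proof
    show "a < 0" by (rule a)
    show "complex_of_real p1 - complex_of_real p2 = complex_of_real (p1 - p2)" by simp
    show "((complex_of_real p1 + complex_of_real p2 + 1) / 2)\<^sup>2 = complex_of_real (((p1 + p2 + 1) / 2)\<^sup>2)" by simp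
    show "complex_of_real p1 = 0 \<and> complex_of_real p2 \<in> \<real> \<and> Re (complex_of_real p2) < 0 \<or>
      complex_of_real p1 \<notin> \<int> \<and> complex_of_real p2 \<notin> \<int>" using not_Ints by blast
    show "w1 (of_real p1) (of_real p2) k > 0" for k
      unfolding w1_of_real[OF ni] using p1 p2 f by (auto intro!: prod_pos simp del: divide_pos_pos)
    show "om1 (of_real p1) (of_real p2) (k + 1) * (cmod (complex_of_real p2 - of_int k))\<^sup>2
        = om1 (of_real p1) (of_real p2) k * ((of_int k + (1 + (p1 - p2)) / 2)\<^sup>2 - ((p1 + p2 + 1) / 2)\<^sup>2)" for k
    proof -
      have "complex_of_real p2 - of_int k = of_real (p2 - of_int k)" by simp
      then have cm: "(cmod (complex_of_real p2 - of_int k))\<^sup>2 = (of_int k - p2)\<^sup>2"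
        by (simp only: norm_of_real power2_abs power2_commute)
      have AA: "(of_int k + (1 + (p1 - p2)) / 2)\<^sup>2 - ((p1 + p2 + 1) / 2)\<^sup>2 = (of_int k + 1 + p1) * (of_int k - p2)"
        by (simp add: power2_eq_square field_simps)
      have "w1 (of_real p1) (of_real p2) (k + 1) * (of_int k - p2) = w1 (of_real p1) (of_real p2) k * (of_int k + 1 + p1)"
      proof (cases "k \<ge> 0")
        case True
        then obtain n where n: "k = int n" by (metis nonneg_int_cases)
        have "nat (k + 1) = Suc n" "nat k = n" using n by auto
        then have "w1 (of_real p1) (of_real p2) (k + 1) = w1 (of_real p1) (of_real p2) k * ((real (Suc n) + p1) / (real (Suc n) - 1 - p2))"
          unfolding w1_of_real[OF ni] using True by (simp add: atLeastAtMostSuc_conv)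
        then show ?thesis using p2 n by (simp add: field_simps)
      next
        case False
        define m where "m = nat (- k - 1)"
        have m: "k = - int (Suc m)" using False by (simp add: m_def)
        have w0: "w1 (of_real p1) (of_real p2) (- int n) = (\<Prod>j\<in>{1..n}. (real j + p2) / (real j - 1 - p1))" for n
          unfolding w1_of_real[OF ni] by (cases "n = 0") simp_all
        have k1: "k + 1 = - int m" using m by simp
        have "w1 (of_real p1) (of_real p2) k = w1 (of_real p1) (of_real p2) (k + 1) * ((real (Suc m) + p2) / (real (Suc m) - 1 - p1))"
          unfolding k1 unfolding m w0 by (simp add: atLeastAtMostSuc_conv)
        moreover have "real (Suc m) - 1 - p1 \<noteq> 0" using p1 by simp
        moreover have "u * D = v * N" if "u = v * (N / D)" "D \<noteq> 0" for u v N D :: real using that by simp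
        ultimately have "w1 (of_real p1) (of_real p2) k * (real (Suc m) - 1 - p1) = w1 (of_real p1) (of_real p2) (k + 1) * (real (Suc m) + p2)"
          by blast
        moreover have kk: "of_int k = - real (Suc m)" using m by simp
        ultimately show ?thesis unfolding kk by (simp add: algebra_simps)
      qed
      then have "w1 (of_real p1) (of_real p2) (k + 1) * (of_int k - p2)\<^sup>2 = w1 (of_real p1) (of_real p2) k * ((of_int k + 1 + p1) * (of_int k - p2))"
        by (simp add: power2_eq_square)
      then show ?thesis unfolding om cm AA .
    qed
  qed
qed

text \<open>By the symmetry exchanging \<open>a\<close> and \<open>b\<close> one may assume \<open>b \<le> a\<close>; then only the parameter
  \<open>-(a + b + 1)/2\<close> of the continuous dual Hahn polynomials can be negative.\<close>
lemma lowest_doubly_infinite: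
  fixes a b :: real
  assumes ab: "a < 0" "b < 0" and hs: "hilbert_submodule d1 d2 0 (of_real a) b"
    and d: "d1 \<notin> \<int>" "d2 \<notin> \<int>" and S: "((d1 + d2 + 1) / 2)\<^sup>2 = of_real S"
  shows "a + b > -1 \<and> S = ((a + b + 1) / 2)\<^sup>2"
proof -
  have main: "a + b > -1 \<and> S = ((a + b + 1) / 2)\<^sup>2"
    if ab: "a < 0" "b < 0" "b \<le> a" and hs: "hilbert_submodule d1 d2 0 (of_real a) b"
      and d: "d1 \<notin> \<int>" "d2 \<notin> \<int>" and S: "((d1 + d2 + 1) / 2)\<^sup>2 = of_real S" for a b :: real and d1 d2
  proof -
    interpret tensor_setup 0 "of_real a" b "- a" "((a + 1) / 2)\<^sup>2" by (rule tensor_setup_lowest[OF ab(1,2)])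
    have "((a + 1) / 2)\<^sup>2 > b\<^sup>2 / 4" by (rule doubly_infinite_necessary(2)[OF hs d S])
    then have "\<bar>b\<bar>\<^sup>2 < \<bar>a + 1\<bar>\<^sup>2" by (simp add: power_divide)
    then have "\<bar>b\<bar> < \<bar>a + 1\<bar>" by (rule power_less_imp_less_base) simp
    \<comment> \<open>If \<open>a + 1\<close> were negative, the inequality would read
      \<open>a + 1 < b\<close>, which contradicts \<open>b \<le> a\<close>.\<close>
    then have gt: "a + b > -1" using ab by linarith
    have "S = ((0 + a + 1 + b) / 2)\<^sup>2"
      by (rule real_parameters_point_mass_plus[OF hs d S]) (use gt ab in auto)
    then show ?thesis using gt by (simp add: add_ac)
  qed
  show ?thesis
  proof (cases "b \<le> a")
    case True
    then show ?thesis using main[OF ab _ hs d S] by blast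
  next
    case False
    have "inK d1 d2 0" using d by (simp add: inK_def)
    then have hs': "hilbert_submodule d2 d1 0 (of_real b) a" by (rule hilbert_submodule_swap[OF ab _ hs])
    have S': "((d2 + d1 + 1) / 2)\<^sup>2 = of_real S" using S by (simp add: add.commute)
    show ?thesis using main[OF ab(2,1) _ hs' d(2,1) S'] False by (simp add: add.commute)
  qed
qed

lemma lowest_candidate_necessary:
  fixes a b :: real
  assumes ab: "a < 0" "b < 0" and cand: "candidate d" and hs: "hilbert_submodule (fst d) (snd d) 0 (of_real a) b"
  obtains (highest) n :: int where "0 \<le> n" "b - a + 2 * of_int n < -1" "d = (complex_of_real (b - a + 2 * of_int n), 0)"
  | (lowest) n :: int where "0 \<le> n" "a - b + 2 * of_int n < -1" "d = (0, complex_of_real (a - b + 2 * of_int n))"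
  | (complementary) "a + b > -1" "isoclass d = isoclass (complex_of_real b, complex_of_real a)"
proof -
  interpret T: tensor_setup 0 "of_real a" b "- a" "((a + 1) / 2)\<^sup>2" by (rule tensor_setup_lowest[OF ab])
  interpret T': tensor_setup 0 "of_real b" a "- b" "((b + 1) / 2)\<^sup>2" by (rule tensor_setup_lowest[OF ab(2,1)])
  show thesis
    using cand
  proof (cases rule: candidate_cases)
    case (highest lam)
    then have "hilbert_submodule (of_real lam) 0 0 (of_real a) b" using hs by simp
    from T.highest_candidate_necessary[OF highest(1) this] obtain n where "lam = - a + b + 2 * of_int n" "lam < -1" "0 \<le> n" by auto
    then show thesis using that(1)[of n] highest(2) by simp
  next
    case (lowest lam)
    then have "hilbert_submodule 0 (of_real lam) 0 (of_real a) b" using hs by simp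
    moreover have "inK 0 (of_real lam) 0" using lowest by (simp add: inK_0_neg)
    ultimately have "hilbert_submodule (of_real lam) 0 0 (of_real b) a" using hilbert_submodule_swap[OF ab] by blast
    from T'.highest_candidate_necessary[OF lowest(1) this] obtain n where "lam = - b + a + 2 * of_int n" "lam < -1" "0 \<le> n" by auto
    then show thesis using that(2)[of n] lowest(2) by simp
  next
    case (principal S)
    have "a + b > -1 \<and> S = ((a + b + 1) / 2)\<^sup>2" by (rule lowest_doubly_infinite[OF ab hs principal(1-3)])
    then have "S > 0" by simp
    then show thesis using principal(4) by simp
  next
    case (highest_limit j)
    then show thesis using T.highest_weight_of_submodule[OF hs highest_limit] by simp
  next
    case (lowest_limit j)
    have hs': "hilbert_submodule (snd d) (fst d) 0 (of_real b) a" by (rule hilbert_submodule_swap[OF ab lowest_limit(1) hs])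
    have "inK (snd d) (fst d) (- j)" "\<not> inK (snd d) (fst d) (- j + 1)" "Hcoef (snd d) (fst d) (- j) = complex_of_real (-1)"
      using lowest_limit inK_minus[of "snd d" "fst d" "j - 1"] by (simp_all add: inK_minus Hcoef_minus)
    then show thesis using T'.highest_weight_of_submodule[OF hs'] by fastforce
  next
    case (complementary b1 b2)
    have d: "fst d \<notin> \<int>" "snd d \<notin> \<int>"
      using complementary open_unit_not_Ints[of b1] open_unit_not_Ints[of b2] by auto
    have S: "((fst d + snd d + 1) / 2)\<^sup>2 = of_real (((b1 + b2 + 1) / 2)\<^sup>2)" using complementary by simp
    have gt: "a + b > -1" and e: "((b1 + b2 + 1) / 2)\<^sup>2 = ((a + b + 1) / 2)\<^sup>2"
      using lowest_doubly_infinite[OF ab hs d S] by auto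
    obtain n0 where "fst d - snd d = of_real (- a + b + 2 * of_int n0)"
      using T.doubly_infinite_sequences(1)[OF hs d S] by blast
    then have "complex_of_real (b1 - b2) = of_real (b - a + 2 * of_int n0)" using complementary by simp
    then have "b1 - b2 = b - a + 2 * of_int n0" by (simp only: of_real_eq_iff)
    then have "isoclass (of_real b1, of_real b2) = isoclass (complex_of_real b, complex_of_real a)"
      using complementary ab gt e by (intro complementary_isoclass[of _ _ _ _ n0]) (auto simp: add_ac)
    then show thesis using that(3) gt complementary by simp
  qed
qed

lemma lowest_tensor_highest_sufficient:
  fixes a b :: real
  assumes ab: "a < 0" "b < 0" and n: "(n::int) \<ge> 0" and lam: "lam = b - a + 2 * of_int n" "lam < -1"
  shows "hilbert_submodule (of_real lam) 0 0 (of_real a) b"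
proof -
  interpret T: tensor_setup 0 "of_real a" b "- a" "((a + 1) / 2)\<^sup>2" by (rule tensor_setup_lowest[OF ab])
  show ?thesis using n lam by (intro T.highest_weight_sufficient[of n]) auto
qed

text \<open>All three families are listed without a case distinction; in each case of the theorem
  two of them are empty.\<close>

lemma disc_spectrum_lowest:
  fixes a b :: real
  assumes ab: "a < 0" "b < 0"
  shows "disc_spectrum 0 (complex_of_real a) b = isoclass `
     ({(complex_of_real (b - a + 2 * of_int n), 0) | n :: int. 0 \<le> 2 * n \<and> 2 * of_int n < a - b - 1} \<union>
      {(0, complex_of_real (a - b - 2 * of_int n)) | n :: int. a - b + 1 < 2 * of_int n \<and> 2 * n \<le> (0::int)} \<union>
      {e. -1 < a + b \<and> e = (complex_of_real b, complex_of_real a)})"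
    (is "_ = isoclass ` (?H \<union> ?L \<union> ?C)")
proof (rule disc_spectrum_eqI)
  fix d assume "candidate d" "hilbert_submodule (fst d) (snd d) 0 (complex_of_real a) b"
  from ab this show "isoclass d \<in> isoclass ` (?H \<union> ?L \<union> ?C)"
  proof (cases rule: lowest_candidate_necessary)
    case (highest n)
    then have "d \<in> ?H" by (auto intro!: exI[of _ n])
    then show ?thesis by blast
  next
    case (lowest n)
    then have "d \<in> ?L" by (auto intro!: exI[of _ "- n"])
    then show ?thesis by blast
  qed blast
next
  fix e assume "e \<in> ?H \<union> ?L \<union> ?C"
  then consider (highest) n :: int where "e = (complex_of_real (b - a + 2 * of_int n), 0)" "0 \<le> n" "b - a + 2 * of_int n < -1"
    | (lowest) n :: int where "e = (0, complex_of_real (a - b - 2 * of_int n))" "0 \<le> - n" "a - b + 1 < 2 * of_int n"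
    | (complementary) "-1 < a + b" "e = (complex_of_real b, complex_of_real a)"
    by force
  then show "\<exists>d. candidate d \<and> hilbert_submodule (fst d) (snd d) 0 (of_real a) b \<and> isoclass d = isoclass e"
  proof cases
    case (highest n)
    then show ?thesis
      using lowest_tensor_highest_sufficient[OF ab highest(2) refl highest(3)] candidate_highest[of "b - a + 2 * of_int n"]
      by (intro exI[of _ e]) simp
  next
    case (lowest n)
    define lam where "lam = a - b + 2 * of_int (- n)"
    have lam: "lam < -1" using lowest by (simp add: lam_def)
    have "hilbert_submodule (of_real lam) 0 0 (of_real b) a"
      by (rule lowest_tensor_highest_sufficient[OF ab(2,1) lowest(2) lam_def lam])
    moreover have "inK (of_real lam) 0 0" using lam by (simp add: inK_neg_0)
    ultimately have "hilbert_submodule 0 (of_real lam) 0 (of_real a) b"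
      using hilbert_submodule_swap[OF ab(2,1)] by blast
    then show ?thesis
      using candidate_lowest[of lam] lam lowest(1) by (intro exI[of _ e]) (simp add: lam_def)
  next
    case complementary
    interpret T: tensor_setup 0 "of_real a" b "- a" "((a + 1) / 2)\<^sup>2" by (rule tensor_setup_lowest[OF ab])
    \<comment> \<open>The reflection of N(b,a), which is what the product form produces;
      \<open>complementary_isoclass\<close> translates back.\<close>
    let ?d1 = "of_real (-1 - a) :: complex" and ?d2 = "of_real (-1 - b) :: complex"
    have r: "-1 < a" "-1 < b" using complementary ab by linarith+
    have "hilbert_submodule ?d1 ?d2 0 (of_real a) b"
    proof (rule T.complementary_sufficient_plus[of 0 a])
      show "?d1 \<notin> \<int>" "?d2 \<notin> \<int>"
        using ab r by (intro open_unit_not_Ints; simp)+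
    qed (use complementary in auto)
    moreover have "candidate (?d1, ?d2)" using ab r by (intro candidate_complementary) auto
    moreover have "isoclass (?d1, ?d2) = isoclass e"
      unfolding complementary using ab r
      by (intro complementary_isoclass[of _ _ _ _ 0]) (auto simp: power2_eq_square field_simps)
    ultimately show ?thesis by (metis fst_conv snd_conv)
  qed
qed

text \<open>Here \<open>g = - y\<^sup>2\<close> cannot exceed \<open>a\<^sup>2 / 4\<close>, which
  excludes doubly infinite submodules, and \<open>c1\<close> is not an integer, which excludes
  lowest weight modules.\<close>

lemma disc_spectrum_principal:
  fixes x y a :: real
  assumes y: "y \<noteq> 0" and a: "a < 0"
  shows "disc_spectrum (- 1 - complex_of_real x + \<i> * complex_of_real y) (complex_of_real x + \<i> * complex_of_real y) a =
        isoclass ` {(complex_of_real (-1 - 2 * x + a + 2 * of_int n), 0) | n :: int. 2 * of_int n < 2 * x - a}"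
    (is "disc_spectrum ?c1 ?c2 a = isoclass ` ?S")
proof -
  interpret T: tensor_setup ?c1 ?c2 a "- 1 - 2 * x" "- (y\<^sup>2)" by (rule tensor_setup_principal[OF y a])
  have c1: "?c1 \<notin> \<int>" using y by (simp add: complex_is_Int_iff)
  have g: "\<not> - (y\<^sup>2) > a\<^sup>2 / 4" using zero_le_power2[of y] zero_le_power2[of a] by linarith
  show ?thesis
  proof (rule disc_spectrum_eqI)
    fix d assume "candidate d" "hilbert_submodule (fst d) (snd d) ?c1 ?c2 a"
    then show "isoclass d \<in> isoclass ` ?S"
    proof (rule T.candidate_necessary[OF c1])
      fix n :: int assume "- 1 - 2 * x + a + 2 * of_int n < - 1" "d = (complex_of_real (- 1 - 2 * x + a + 2 * of_int n), 0)"
      then have "d \<in> ?S" by (intro CollectI exI[of _ n]) simp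
      then show ?thesis by blast
    qed (use g in blast)+
  next
    fix e assume "e \<in> ?S"
    then obtain n :: int where n: "e = (complex_of_real (-1 - 2 * x + a + 2 * of_int n), 0)" "-1 - 2 * x + a + 2 * of_int n < -1" by force
    have "hilbert_submodule (complex_of_real (-1 - 2 * x + a + 2 * of_int n)) 0 ?c1 ?c2 a"
      using c1 n(2) by (intro T.highest_weight_sufficient[of n]) auto
    then show "\<exists>d. candidate d \<and> hilbert_submodule (fst d) (snd d) ?c1 ?c2 a \<and> isoclass d = isoclass e"
      using candidate_highest[of "-1 - 2 * x + a + 2 * of_int n"] n by (intro exI[of _ e]) simp
  qed
qed

lemma disc_spectrum_complementary:
  fixes a1 a2 a :: real
  assumes a1: "-1 < a1" "a1 < 0" and a2: "-1 < a2" "a2 < 0" and a: "a < 0"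
  defines "S \<equiv> {(complex_of_real (a + a1 - a2 + 2 * of_int n), 0 :: complex) | n :: int. 2 * of_int n < a2 - a1 - a - 1}"
  shows "disc_spectrum (complex_of_real a1) (complex_of_real a2) a = isoclass ` (S \<union>
      {e. (-1 < a + a1 + a2 \<and> e = (complex_of_real (a + a1), complex_of_real a2)) \<or>
          (a1 + a2 - a < -1 \<and> e = (complex_of_real a1, complex_of_real (a2 - a)))})"
    (is "_ = isoclass ` (S \<union> ?C)")
proof -
  let ?c1 = "complex_of_real a1" and ?c2 = "complex_of_real a2"
  interpret T: tensor_setup ?c1 ?c2 a "a1 - a2" "((a1 + a2 + 1) / 2)\<^sup>2" by (rule tensor_setup_complementary[OF a1 a2 a])
  have c1: "?c1 \<notin> \<int>" by (rule open_unit_not_Ints[OF a1])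
  \<comment> \<open>The bound on \<open>g\<close> means
    \<open>\<bar>a\<bar> < \<bar>a1 + a2 + 1\<bar>\<close>; the sign of \<open>a1 + a2 + 1\<close>
    tells which of the two parameters is negative and hence where the point mass lies.\<close>
  have point: "(a + a1 + a2 > -1 \<and> S' = ((a1 + a2 + 1 + a) / 2)\<^sup>2) \<or> (a1 + a2 - a < -1 \<and> S' = ((a1 + a2 + 1 - a) / 2)\<^sup>2)"
    if g: "((a1 + a2 + 1) / 2)\<^sup>2 > a\<^sup>2 / 4" and hs: "hilbert_submodule d1 d2 ?c1 ?c2 a"
      and d: "d1 \<notin> \<int>" "d2 \<notin> \<int>" and S: "((d1 + d2 + 1) / 2)\<^sup>2 = complex_of_real S'" for d1 d2 S'
  proof -
    have "\<bar>a\<bar>\<^sup>2 < \<bar>a1 + a2 + 1\<bar>\<^sup>2" using g by (simp add: power_divide)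
    then have "\<bar>a\<bar> < \<bar>a1 + a2 + 1\<bar>" by (rule power_less_imp_less_base) simp
    then consider "a1 + a2 + 1 > - a" | "a1 + a2 + 1 < a" using a by linarith
    then show ?thesis
    proof cases
      case 1
      have "S' = ((a1 + a2 + 1 + a) / 2)\<^sup>2"
        by (rule T.real_parameters_point_mass_plus[OF hs d S]) (use 1 a1 a2 a in auto)
      then show ?thesis using 1 by simp
    next
      case 2
      have "S' = ((a1 + a2 + 1 - a) / 2)\<^sup>2"
        by (rule T.real_parameters_point_mass_minus[OF hs d S]) (use 2 a1 a2 a in auto)
      then show ?thesis using 2 by simp
    qed
  qed
  show ?thesis
  proof (rule disc_spectrum_eqI)
    fix d assume cand: "candidate d" and hs: "hilbert_submodule (fst d) (snd d) ?c1 ?c2 a"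
    show "isoclass d \<in> isoclass ` (S \<union> ?C)"
    proof (rule T.candidate_necessary[OF c1 cand hs])
      fix n :: int assume n: "a1 - a2 + a + 2 * of_int n < - 1" "d = (complex_of_real (a1 - a2 + a + 2 * of_int n), 0)"
      have "a1 - a2 + a = a + a1 - a2" by simp
      then have "d \<in> S" using n unfolding S_def by (intro CollectI exI[of _ n]) (simp add: add_ac)
      then show ?thesis by blast
    next
      assume "((a1 + a2 + 1) / 2)\<^sup>2 > a\<^sup>2 / 4" "fst d \<notin> \<int>" "snd d \<notin> \<int>" "((fst d + snd d + 1) / 2)\<^sup>2 = complex_of_real 0"
      \<comment> \<open>The point mass is the square of a nonzero parameter, so \<open>S = 0\<close>
        is contradictory.\<close>
      from point[OF this(1) hs this(2-4)] show ?thesis by auto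
    next
      fix b1 b2 :: real
      assume g: "((a1 + a2 + 1) / 2)\<^sup>2 > a\<^sup>2 / 4" and b: "-1 < b1" "b1 < 0" "-1 < b2" "b2 < 0"
        and d: "d = (complex_of_real b1, complex_of_real b2)"
      have nI: "fst d \<notin> \<int>" "snd d \<notin> \<int>" using d b open_unit_not_Ints[of b1] open_unit_not_Ints[of b2] by auto
      have Sb: "((fst d + snd d + 1) / 2)\<^sup>2 = of_real (((b1 + b2 + 1) / 2)\<^sup>2)" using d by simp
      obtain n0 where "fst d - snd d = of_real (a1 - a2 + a + 2 * of_int n0)"
        using T.doubly_infinite_sequences(1)[OF hs nI Sb] by blast
      then have "complex_of_real (b1 - b2) = of_real (a1 - a2 + a + 2 * of_int n0)" using d by simp
      then have n0: "b1 - b2 = a1 - a2 + a + 2 * of_int n0" by (simp only: of_real_eq_iff)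
      from point[OF g hs nI Sb] show ?thesis
      proof
        assume *: "a + a1 + a2 > -1 \<and> ((b1 + b2 + 1) / 2)\<^sup>2 = ((a1 + a2 + 1 + a) / 2)\<^sup>2"
        then have "isoclass d = isoclass (complex_of_real (a + a1), complex_of_real a2)"
          unfolding d using b a1 a2 a n0 by (intro complementary_isoclass[of _ _ _ _ n0]) (auto simp: add_ac)
        moreover have "(complex_of_real (a + a1), complex_of_real a2) \<in> S \<union> ?C" using * by blast
        ultimately show ?thesis by blast
      next
        assume *: "a1 + a2 - a < -1 \<and> ((b1 + b2 + 1) / 2)\<^sup>2 = ((a1 + a2 + 1 - a) / 2)\<^sup>2"
        then have "isoclass d = isoclass (complex_of_real a1, complex_of_real (a2 - a))"
          unfolding d using b a1 a2 a n0 by (intro complementary_isoclass[of _ _ _ _ n0]) (auto simp: algebra_simps)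
        moreover have "(complex_of_real a1, complex_of_real (a2 - a)) \<in> S \<union> ?C" using * by blast
        ultimately show ?thesis by blast
      qed
    qed
  next
    fix e assume "e \<in> S \<union> ?C"
    then consider (hw) n :: int where "e = (complex_of_real (a + a1 - a2 + 2 * of_int n), 0)" "a + a1 - a2 + 2 * of_int n < -1"
      | (plus) "-1 < a + a1 + a2" "e = (complex_of_real (a + a1), complex_of_real a2)"
      | (minus) "a1 + a2 - a < -1" "e = (complex_of_real a1, complex_of_real (a2 - a))"
      unfolding S_def by force
    then show "\<exists>d. candidate d \<and> hilbert_submodule (fst d) (snd d) ?c1 ?c2 a \<and> isoclass d = isoclass e"
    proof cases
      case (hw n)
      have "hilbert_submodule (complex_of_real (a + a1 - a2 + 2 * of_int n)) 0 ?c1 ?c2 a"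
        using c1 hw(2) by (intro T.highest_weight_sufficient[of n]) auto
      then show ?thesis using candidate_highest[of "a + a1 - a2 + 2 * of_int n"] hw by (intro exI[of _ e]) simp
    next
      case plus
      let ?d1 = "complex_of_real (-1 - a2)" and ?d2 = "complex_of_real (-1 - a1 - a)"
      have "hilbert_submodule ?d1 ?d2 ?c1 ?c2 a"
      proof (rule T.complementary_sufficient_plus[of a1 a2])
        show "?d1 \<notin> \<int>" "?d2 \<notin> \<int>"
          using a1 a2 a plus by (intro open_unit_not_Ints; simp)+
      qed (use plus in auto)
      moreover have "candidate (?d1, ?d2)" using a1 a2 a plus by (intro candidate_complementary) auto
      moreover have "isoclass (?d1, ?d2) = isoclass e"
        unfolding plus using a1 a2 a plus(1)
        by (intro complementary_isoclass[of _ _ _ _ 0]) (auto simp: power2_eq_square field_simps)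
      ultimately show ?thesis by (metis fst_conv snd_conv)
    next
      case minus
      have "hilbert_submodule ?c1 (complex_of_real (a2 - a)) ?c1 ?c2 a"
      proof (rule T.complementary_sufficient_minus[of a1 a2])
        show "complex_of_real (a2 - a) \<notin> \<int>" using a1 a2 a minus by (intro open_unit_not_Ints) simp_all
      qed (use minus c1 in auto)
      moreover have "candidate e" unfolding minus using a1 a2 a minus(1) by (intro candidate_complementary) auto
      ultimately show ?thesis using minus by (intro exI[of _ e]) simp
    qed
  qed
qed

theorem mainTheorem8:
  shows
  "(\<forall>a b :: real. a < 0 \<longrightarrow> b < 0 \<longrightarrow>
      ((-1 < a + b \<and> a + b < 0 \<longrightarrow>
          disc_spectrum 0 (complex_of_real a) b =
            isoclass ` {(complex_of_real b, complex_of_real a)}) \<and>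
       (0 < a - b - 1 \<longrightarrow>
          disc_spectrum 0 (complex_of_real a) b =
            isoclass ` {(complex_of_real (b - a + 2 * of_int n), 0) | n :: int.
                          0 \<le> 2 * n \<and> 2 * of_int n < a - b - 1}) \<and>
       (a - b + 1 < 0 \<longrightarrow>
          disc_spectrum 0 (complex_of_real a) b =
            isoclass ` {(0, complex_of_real (a - b - 2 * of_int n)) | n :: int.
                          a - b + 1 < 2 * of_int n \<and> 2 * n \<le> (0::int)}))) \<and>
   (\<forall>x y a :: real. -1 \<le> x \<longrightarrow> x < 0 \<longrightarrow> y \<noteq> 0 \<longrightarrow> a < 0 \<longrightarrow>
      disc_spectrum (- 1 - complex_of_real x + \<i> * complex_of_real y)
                    (complex_of_real x + \<i> * complex_of_real y) a =
        isoclass ` {(complex_of_real (-1 - 2 * x + a + 2 * of_int n), 0) | n :: int.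
                      2 * of_int n < 2 * x - a}) \<and>
   (\<forall>a1 a2 a :: real. -1 < a1 \<longrightarrow> a1 < 0 \<longrightarrow> -1 < a2 \<longrightarrow> a2 < 0 \<longrightarrow> a < 0 \<longrightarrow>
      (let S = {(complex_of_real (a + a1 - a2 + 2 * of_int n), 0) | n :: int.
                  2 * of_int n < a2 - a1 - a - 1}
       in (-1 < a + a1 + a2 \<and> a + a1 + a2 < 0 \<longrightarrow>
             disc_spectrum (complex_of_real a1) (complex_of_real a2) a =
               isoclass ` (S \<union> {(complex_of_real (a + a1), complex_of_real a2)})) \<and>
          (-2 < a1 + a2 - a \<and> a1 + a2 - a < -1 \<longrightarrow>
             disc_spectrum (complex_of_real a1) (complex_of_real a2) a =
               isoclass ` (S \<union> {(complex_of_real a1, complex_of_real (a2 - a))})) \<and>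
          (\<not> (-1 < a + a1 + a2 \<and> a + a1 + a2 < 0) \<and>
           \<not> (-2 < a1 + a2 - a \<and> a1 + a2 - a < -1) \<longrightarrow>
             disc_spectrum (complex_of_real a1) (complex_of_real a2) a =
               isoclass ` S)))"
proof (intro conjI allI impI)
  fix a b :: real
  assume ab: "a < 0" "b < 0"
  define H where "H = {(complex_of_real (b - a + 2 * of_int n), 0 :: complex) | n :: int. 0 \<le> 2 * n \<and> 2 * of_int n < a - b - 1}"
  define L where "L = {(0 :: complex, complex_of_real (a - b - 2 * of_int n)) | n :: int. a - b + 1 < 2 * of_int n \<and> 2 * n \<le> (0::int)}"
  define C where "C = {e. -1 < a + b \<and> e = (complex_of_real b, complex_of_real a)}"
  note spec = disc_spectrum_lowest[OF ab, folded H_def L_def C_def]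
  have H: "H = {}" if "a - b - 1 \<le> 0"
  proof -
    have "\<not> 2 * of_int n < a - b - 1" if "0 \<le> 2 * n" for n :: int
      using that \<open>a - b - 1 \<le> 0\<close> of_int_0_le_iff[of n, where 'a = real] by linarith
    then show ?thesis unfolding H_def by blast
  qed
  have L: "L = {}" if "0 \<le> a - b + 1"
  proof -
    have "\<not> a - b + 1 < 2 * of_int n" if "2 * n \<le> 0" for n :: int
      using that \<open>0 \<le> a - b + 1\<close> of_int_le_0_iff[of n, where 'a = real] by linarith
    then show ?thesis unfolding L_def by blast
  qed
  have C: "C = {}" if "\<not> -1 < a + b" using that by (simp add: C_def)
  show "disc_spectrum 0 (complex_of_real a) b = isoclass ` {(complex_of_real b, complex_of_real a)}"
    if ab1: "-1 < a + b \<and> a + b < 0"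
  proof -
    have "C = {(complex_of_real b, complex_of_real a)}" using ab1 by (auto simp: C_def)
    \<comment> \<open>Both parameters lie between -1 and 0, so \<open>\<bar>a - b\<bar> < 1\<close>
      and the families \<open>H\<close> and \<open>L\<close> are empty.\<close>
    then show ?thesis using spec H L ab ab1 by simp
  qed
  show "disc_spectrum 0 (complex_of_real a) b =
      isoclass ` {(complex_of_real (b - a + 2 * of_int n), 0) | n :: int. 0 \<le> 2 * n \<and> 2 * of_int n < a - b - 1}"
    if "0 < a - b - 1" using spec L C ab that unfolding H_def[symmetric] by simp
  show "disc_spectrum 0 (complex_of_real a) b =
      isoclass ` {(0, complex_of_real (a - b - 2 * of_int n)) | n :: int. a - b + 1 < 2 * of_int n \<and> 2 * n \<le> (0::int)}"
    if "a - b + 1 < 0" using spec H C ab that unfolding L_def[symmetric] by simp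
next
  fix x y a :: real
  assume "y \<noteq> 0" "a < 0"
  then show "disc_spectrum (- 1 - complex_of_real x + \<i> * complex_of_real y) (complex_of_real x + \<i> * complex_of_real y) a =
        isoclass ` {(complex_of_real (-1 - 2 * x + a + 2 * of_int n), 0) | n :: int. 2 * of_int n < 2 * x - a}"
    by (rule disc_spectrum_principal)
next
  fix a1 a2 a :: real
  assume a: "-1 < a1" "a1 < 0" "-1 < a2" "a2 < 0" "a < 0"
  define S where "S = {(complex_of_real (a + a1 - a2 + 2 * of_int n), 0 :: complex) | n :: int. 2 * of_int n < a2 - a1 - a - 1}"
  note spec = disc_spectrum_complementary[OF a, folded S_def]
  \<comment> \<open>Together with \<open>excl\<close> this shows that the three cases of the
    statement correspond to the three possible values of the additional set in
    \<open>spec\<close>.\<close>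
  have lt: "a + a1 + a2 < 0" "-2 < a1 + a2 - a" using a by linarith+
  have excl: "\<not> (-1 < a + a1 + a2 \<and> a1 + a2 - a < -1)" using a by linarith
  show "let S = {(complex_of_real (a + a1 - a2 + 2 * of_int n), 0) | n :: int. 2 * of_int n < a2 - a1 - a - 1}
       in (-1 < a + a1 + a2 \<and> a + a1 + a2 < 0 \<longrightarrow>
             disc_spectrum (complex_of_real a1) (complex_of_real a2) a =
               isoclass ` (S \<union> {(complex_of_real (a + a1), complex_of_real a2)})) \<and>
          (-2 < a1 + a2 - a \<and> a1 + a2 - a < -1 \<longrightarrow>
             disc_spectrum (complex_of_real a1) (complex_of_real a2) a =
               isoclass ` (S \<union> {(complex_of_real a1, complex_of_real (a2 - a))})) \<and>
          (\<not> (-1 < a + a1 + a2 \<and> a + a1 + a2 < 0) \<and>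
           \<not> (-2 < a1 + a2 - a \<and> a1 + a2 - a < -1) \<longrightarrow>
             disc_spectrum (complex_of_real a1) (complex_of_real a2) a =
               isoclass ` S)"
    unfolding Let_def S_def[symmetric]
  proof (intro conjI impI)
    assume "-1 < a + a1 + a2 \<and> a + a1 + a2 < 0"
    then have eq: "{e. (-1 < a + a1 + a2 \<and> e = (complex_of_real (a + a1), complex_of_real a2)) \<or>
          (a1 + a2 - a < -1 \<and> e = (complex_of_real a1, complex_of_real (a2 - a)))} = {(complex_of_real (a + a1), complex_of_real a2)}"
      using excl by auto
    show "disc_spectrum (complex_of_real a1) (complex_of_real a2) a =
               isoclass ` (S \<union> {(complex_of_real (a + a1), complex_of_real a2)})" using spec unfolding eq by simp
  next
    assume "-2 < a1 + a2 - a \<and> a1 + a2 - a < -1"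
    then have eq: "{e. (-1 < a + a1 + a2 \<and> e = (complex_of_real (a + a1), complex_of_real a2)) \<or>
          (a1 + a2 - a < -1 \<and> e = (complex_of_real a1, complex_of_real (a2 - a)))} = {(complex_of_real a1, complex_of_real (a2 - a))}"
      using excl by auto
    show "disc_spectrum (complex_of_real a1) (complex_of_real a2) a =
               isoclass ` (S \<union> {(complex_of_real a1, complex_of_real (a2 - a))})" using spec unfolding eq by simp
  next
    assume "\<not> (-1 < a + a1 + a2 \<and> a + a1 + a2 < 0) \<and> \<not> (-2 < a1 + a2 - a \<and> a1 + a2 - a < -1)"
    then have eq: "{e. (-1 < a + a1 + a2 \<and> e = (complex_of_real (a + a1), complex_of_real a2)) \<or>
          (a1 + a2 - a < -1 \<and> e = (complex_of_real a1, complex_of_real (a2 - a)))} = {}"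
      using lt by auto
    show "disc_spectrum (complex_of_real a1) (complex_of_real a2) a = isoclass ` S" using spec unfolding eq by simp
  qed
qed

end
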